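(* The space $Q_5$ is homotopy equivalent to the (closed, orientable) Riemann surface of genus $4$.
   Context: Let $S^1$ be the circle with a fixed point $\infty\in S^1$. For $n\ge1$ let $T^{n-1}=\{(x_1,\ldots,x_{n-1})\mid x_i\in S^1\}$ be the $(n-1)$-dimensional torus and set $x_n=\infty$. For $1\leq i<j<k\leq n$ let $A_{ijk}\subset T^{n-1}$ be the subset of points satisfying $x_i=x_j=x_k$, and let $A_n=\bigcup_{1\leq i<j<k\leq n}A_{ijk}$. The space $Q_n$ is the complement $T^{n-1}\setminus A_n$; here $n=5$. *)

theory Defs
  imports "HOL-Analysis.Analysis"
begin

abbreviation circle :: "complex set" where
  "circle \<equiv> sphere 0 1"

text \<open>Points of \<open>T\<^sup>n\<^sup>-\<^sup>1\<close> are functions on \<open>{1..n - 1}\<close> that are \<open>undefined\<close> elsewhere; in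
  particular \<open>x n\<close> is not a coordinate of such a point, and \<open>with_base\<close> supplies \<open>x n = p\<close>,
  where \<open>p\<close> is the point written \<open>\<infinity>\<close> in the mathematics.\<close>

definition torus :: "nat \<Rightarrow> (nat \<Rightarrow> complex) topology" where
  "torus n = product_topology (\<lambda>_. top_of_set circle) {1..n - 1}"

definition with_base :: "complex \<Rightarrow> nat \<Rightarrow> (nat \<Rightarrow> complex) \<Rightarrow> nat \<Rightarrow> complex" where
  "with_base p n x = x(n := p)"

definition triple_diagonal ::
    "complex \<Rightarrow> nat \<Rightarrow> nat \<Rightarrow> nat \<Rightarrow> nat \<Rightarrow> (nat \<Rightarrow> complex) set" where
  "triple_diagonal p n i j k =
     {x \<in> topspace (torus n).
        with_base p n x i = with_base p n x j \<and> with_base p n x j = with_base p n x k}"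

definition triple_arrangement :: "complex \<Rightarrow> nat \<Rightarrow> (nat \<Rightarrow> complex) set" where
  "triple_arrangement p n =
     \<Union>{triple_diagonal p n i j k | i j k. 1 \<le> i \<and> i < j \<and> j < k \<and> k \<le> n}"

definition Q_space :: "complex \<Rightarrow> nat \<Rightarrow> (nat \<Rightarrow> complex) topology" where
  "Q_space p n = subtopology (torus n) (topspace (torus n) - triple_arrangement p n)"


text \<open>The space of classes of an equivalence relation \<open>r\<close> on the points of \<open>X\<close>, with the quotient
  topology.\<close>

definition quotient_topology :: "'a topology \<Rightarrow> ('a \<times> 'a) set \<Rightarrow> 'a set topology" where
  "quotient_topology X r =
     topology (\<lambda>U. U \<subseteq> topspace X // r \<and> openin X {x \<in> topspace X. r `` {x} \<in> U})"

lemma openin_quotient_topology: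
  "openin (quotient_topology X r) U \<longleftrightarrow>
     U \<subseteq> topspace X // r \<and> openin X {x \<in> topspace X. r `` {x} \<in> U}"
proof -
  let ?P = "\<lambda>U. U \<subseteq> topspace X // r \<and> openin X {x \<in> topspace X. r `` {x} \<in> U}"
  have "istopology ?P"
    unfolding istopology_def
  proof (intro conjI allI impI)
    fix S T assume S: "?P S" and T: "?P T"
    show "S \<inter> T \<subseteq> topspace X // r"
      using S by blast
    have "{x \<in> topspace X. r `` {x} \<in> S \<inter> T} =
        {x \<in> topspace X. r `` {x} \<in> S} \<inter> {x \<in> topspace X. r `` {x} \<in> T}"
      by blast
    then show "openin X {x \<in> topspace X. r `` {x} \<in> S \<inter> T}"
      using S T by (simp add: openin_Int)
  next
    fix K assume K: "\<forall>S\<in>K. ?P S"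
    then show "\<Union>K \<subseteq> topspace X // r"
      by blast
    have "{x \<in> topspace X. r `` {x} \<in> \<Union>K} = (\<Union>S\<in>K. {x \<in> topspace X. r `` {x} \<in> S})"
      by blast
    then show "openin X {x \<in> topspace X. r `` {x} \<in> \<Union>K}"
      using K by auto
  qed
  then show ?thesis
    by (simp add: quotient_topology_def)
qed

lemma topspace_quotient_topology [simp]:
  "topspace (quotient_topology X r) = topspace X // r"
proof -
  have "{x \<in> topspace X. r `` {x} \<in> topspace X // r} = topspace X"
    by (auto simp: quotientI)
  then have "openin (quotient_topology X r) (topspace X // r)"
    by (simp add: openin_quotient_topology)
  then show ?thesis
    by (metis openin_quotient_topology openin_subset openin_topspace subset_antisym)
qed

lemma quotient_map_quotient_topology:
  "quotient_map X (quotient_topology X r) (\<lambda>x. r `` {x})"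
  by (auto simp: quotient_map_def openin_quotient_topology quotient_def)


text \<open>The closed orientable surface of genus \<open>g \<ge> 1\<close> is the regular \<open>4g\<close>-gon whose sides, read
  counterclockwise, are glued according to the word
  \<open>a\<^sub>1 b\<^sub>1 a\<^sub>1\<^sup>-\<^sup>1 b\<^sub>1\<^sup>-\<^sup>1 \<dots> a\<^sub>g b\<^sub>g a\<^sub>g\<^sup>-\<^sup>1 b\<^sub>g\<^sup>-\<^sup>1\<close>. Sides are numbered from \<open>0\<close>, so the \<open>j\<close>-th
  commutator occupies the sides \<open>4j, \<dots>, 4j + 3\<close>; side \<open>4j + r\<close> with \<open>r \<in> {0, 1}\<close> is glued to side
  \<open>4j + r + 2\<close> with the direction reversed. For \<open>g = 0\<close> the definitions are meaningless.\<close>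

definition polygon_vertex :: "nat \<Rightarrow> nat \<Rightarrow> complex" where
  "polygon_vertex g k = cis (2 * pi * real k / real (4 * g))"

definition polygon_side :: "nat \<Rightarrow> nat \<Rightarrow> real \<Rightarrow> complex" where
  "polygon_side g k = linepath (polygon_vertex g k) (polygon_vertex g (k + 1))"

definition polygon :: "nat \<Rightarrow> complex set" where
  "polygon g = convex hull (polygon_vertex g ` {..<4 * g})"

definition side_pairing :: "nat \<Rightarrow> complex \<Rightarrow> complex \<Rightarrow> bool" where
  "side_pairing g z w \<longleftrightarrow>
     (\<exists>j<g. \<exists>r\<in>{0, 1}. \<exists>t\<in>{0..1}.
        z = polygon_side g (4 * j + r) t \<and> w = polygon_side g (4 * j + r + 2) (1 - t))"

definition gluing_rel :: "nat \<Rightarrow> (complex \<times> complex) set" where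
  "gluing_rel g = {(z, w). z \<in> polygon g \<and> w \<in> polygon g \<and> equivclp (side_pairing g) z w}"

definition closed_orientable_surface :: "nat \<Rightarrow> complex set topology" where
  "closed_orientable_surface g = quotient_topology (top_of_set (polygon g)) (gluing_rel g)"

lemma equiv_gluing_rel: "equiv (polygon g) (gluing_rel g)"
proof (rule equivI)
  show "gluing_rel g \<subseteq> polygon g \<times> polygon g"
    by (auto simp: gluing_rel_def)
  show "refl_on (polygon g) (gluing_rel g)"
    by (auto simp: refl_on_def gluing_rel_def intro: reflpD[OF reflp_equivclp])
  show "sym (gluing_rel g)"
    by (auto simp: sym_def gluing_rel_def intro: sympD[OF symp_equivclp])
  show "trans (gluing_rel g)"
    by (auto simp: trans_def gluing_rel_def intro: transpD[OF transp_equivclp])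
qed

end

theory Submission imports Defs begin

text \<open>
  Call a finite family of closed absolute retracts \<open>A i\<close> in \<open>X\<close>, indexed by an order, good if the sets
  containing a given point are exactly those whose index is above some \<open>k\<close>. Maps between two spaces
  with good covers over the same order, and homotopies between such maps, can be built by extending
  them over one \<open>A i\<close> after the other; hence the two spaces are homotopy equivalent.

  \<open>Q\<^sub>5\<close> is cut by the coincidences \<open>x\<^sub>i = x\<^sub>j\<close> into 24 chambers, one for each cyclic order of the five
  points. Their intersections form a poset with 24 + 60 + 30 elements and a good cover of \<open>Q\<^sub>5\<close>, so
  \<open>Q\<^sub>5\<close> is equivalent to the order complex of this poset: the barycentric subdivision of a closed
  surface with 24 faces, 60 edges and 30 vertices, of Euler characteristic \<open>-6\<close>. A spanning tree of its vertices and a spanning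
  tree of its faces leave over 8 edges. The dual cells along the first tree form a disc \<open>Vertex\<close>, those
  along the second tree a disc \<open>Face\<close>, and the 8 remaining edges give bands. The trees are chosen such
  that the boundary of the face disc runs through the remaining edges according to the word
  \<open>a\<^sub>1 b\<^sub>1 a\<^sub>1\<^sup>-\<^sup>1 b\<^sub>1\<^sup>-\<^sup>1 \<dots> a\<^sub>4 b\<^sub>4 a\<^sub>4\<^sup>-\<^sup>1 b\<^sub>4\<^sup>-\<^sup>1\<close>. So the intersections of these pieces form the same
  order as those of the central disc, the disc around the vertex, and the bands between them in the
  16-gon with glued sides, and the theorem follows from a second comparison of good covers.\<close>

section \<open>Covers by absolute retracts\<close>

text \<open>The configuration space is an open part of a 4-dimensional torus, so it is not itself a
  surface, and an Euler characteristic settles the genus only together with a classification of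
  surfaces. Comparing covers avoids both difficulties: nothing enters but the order formed by the
  intersections. Absolute retracts take the place of contractible sets because a map into one
  extends from any closed subset, and this extension is all that the comparison uses. The 114 cells
  and the pieces formed along the trees are different orders, so a middle space with good covers
  over both is needed. The order complex is this space: the subcomplexes below a cell give the first
  cover, unions of dual cells the second. Covers live in Euclidean spaces, whereas the surface is an
  abstract quotient; it is therefore replaced by a homeomorphic compact set. The tables are mere
  data. What has to hold for them is that their flags account for all chains of cells, and that the
  sixteen sides of the face disc are paired and separated as in the polygon; both are finite checks
  by rewriting.\<close>

definition AR_cover :: "'i::order set \<Rightarrow> 'a::euclidean_space set \<Rightarrow> ('i \<Rightarrow> 'a set) \<Rightarrow> bool" where
  "AR_cover I X A \<longleftrightarrow> finite I \<and>
     (\<forall>i\<in>I. closedin (top_of_set X) (A i) \<and> AR (A i)) \<and>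
     (\<forall>x\<in>X. \<exists>k\<in>I. \<forall>i\<in>I. x \<in> A i \<longleftrightarrow> k \<le> i)"

lemma AR_cover_subset: "AR_cover I X A \<Longrightarrow> i \<in> I \<Longrightarrow> A i \<subseteq> X"
  unfolding AR_cover_def by (meson closedin_imp_subset)

lemma AR_cover_mono:
  assumes "AR_cover I X A" "i \<in> I" "j \<in> I" "i \<le> j"
  shows "A i \<subseteq> A j"
proof
  fix x assume x: "x \<in> A i"
  then have "x \<in> X"
    using assms unfolding AR_cover_def by (meson closedin_imp_subset subsetD)
  then show "x \<in> A j"
    using assms x unfolding AR_cover_def by (meson order_trans)
qed

text \<open>The map is extended over the sets \<open>A d\<close> in an order compatible with that of
  the indices. On \<open>A d\<close> it is already given on a closed part, with values in
  \<open>C d\<close>, and an absolute retract allows the extension.\<close>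

lemma carrier_extension:
  fixes h :: "'a::euclidean_space \<Rightarrow> 'b::euclidean_space" and A :: "'i::order \<Rightarrow> 'a set"
  assumes fin: "finite I"
    and strat: "\<And>x. x \<in> Z \<Longrightarrow> \<exists>k\<in>I. \<forall>i\<in>I. x \<in> A i \<longleftrightarrow> k \<le> i"
    and clo: "\<And>i. i \<in> I \<Longrightarrow> closedin (top_of_set Z) (A i)"
    and AR: "\<And>i. i \<in> I \<Longrightarrow> AR (C i)"
    and mono: "\<And>i j. i \<in> I \<Longrightarrow> j \<in> I \<Longrightarrow> i \<le> j \<Longrightarrow> C i \<subseteq> C j"
    and B: "closedin (top_of_set Z) B" and h: "continuous_on B h"
    and hC: "\<And>i. i \<in> I \<Longrightarrow> h ` (B \<inter> A i) \<subseteq> C i"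
  obtains g where "continuous_on Z g" "\<And>x. x \<in> B \<Longrightarrow> g x = h x"
    "\<And>i. i \<in> I \<Longrightarrow> g ` A i \<subseteq> C i"
proof -
  define W where "W D = B \<union> \<Union>(A ` D)" for D
  have AZ: "A i \<subseteq> Z" if "i \<in> I" for i
    using clo[OF that] by (rule closedin_imp_subset)
  have BZ: "B \<subseteq> Z"
    using B by (rule closedin_imp_subset)
  have cloW: "closedin (top_of_set Z) (W D)" if "D \<subseteq> I" for D
    unfolding W_def using that fin B clo
    by (intro closedin_Un closedin_Union) (auto intro: finite_subset)
  \<comment> \<open>Induction over the downward closed sets \<open>D\<close> of indices; a maximal
    \<open>d\<close> is removed so that the rest stays downward closed.\<close>
  have key: "\<exists>g. continuous_on (W D) g \<and> (\<forall>x\<in>B. g x = h x) \<and> (\<forall>i\<in>I. g ` (W D \<inter> A i) \<subseteq> C i)"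
    if "finite D" "D \<subseteq> I" "\<forall>d\<in>D. \<forall>i\<in>I. i \<le> d \<longrightarrow> i \<in> D" for D
    using that
  proof (induction D rule: finite_psubset_induct)
    case (psubset D)
    show ?case
    proof (cases "D = {}")
      case True
      then show ?thesis
        using h hC by (intro exI[of _ h]) (auto simp: W_def)
    next
      case False
      then obtain d where d: "d \<in> D" and dmax: "\<And>e. e \<in> D \<Longrightarrow> d \<le> e \<Longrightarrow> e = d"
        using finite_has_maximal[OF psubset.hyps(1) False] by metis
      define D' where "D' = D - {d}"
      have D': "D' \<subset> D" "D' \<subseteq> I" "\<forall>e\<in>D'. \<forall>i\<in>I. i \<le> e \<longrightarrow> i \<in> D'"
        using d dmax psubset.prems unfolding D'_def by auto
      obtain g' where g': "continuous_on (W D') g'" "\<forall>x\<in>B. g' x = h x"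
        "\<forall>i\<in>I. g' ` (W D' \<inter> A i) \<subseteq> C i"
        using psubset.IH[OF D'] by blast
      have dI: "d \<in> I"
        using d psubset.prems by auto
      have WD: "W D = W D' \<union> A d"
        using d by (auto simp: W_def D'_def)
      have WDZ: "W D' \<subseteq> Z" "W D \<subseteq> Z"
        using cloW D'(2) psubset.prems(1) by (auto dest: closedin_imp_subset)
      have "closedin (top_of_set (A d)) (W D' \<inter> A d)"
        by (rule closedin_subset_trans[OF closedin_Int[OF cloW[OF D'(2)] clo[OF dI]]]) (use AZ[OF dI] in auto)
      moreover have "continuous_on (W D' \<inter> A d) g'" "g' ` (W D' \<inter> A d) \<subseteq> C d"
        using continuous_on_subset[OF g'(1)] g'(3) dI by auto
      ultimately obtain k where k: "continuous_on (A d) k" "k ` A d \<subseteq> C d"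
        "\<And>x. x \<in> W D' \<inter> A d \<Longrightarrow> k x = g' x"
        using AR_imp_absolute_extensor[OF AR[OF dI]] by blast
      define g where "g x = (if x \<in> W D' then g' x else k x)" for x
      have "continuous_on (W D' \<union> A d) g"
        unfolding g_def
      proof (rule continuous_on_cases_local)
        show "closedin (top_of_set (W D' \<union> A d)) (W D')"
          by (rule closedin_subset_trans[OF cloW[OF D'(2)]]) (use WDZ WD in auto)
        show "closedin (top_of_set (W D' \<union> A d)) (A d)"
          by (rule closedin_subset_trans[OF clo[OF dI]]) (use WDZ WD in auto)
      qed (use g'(1) k in auto)
      moreover have "g x = h x" if "x \<in> B" for x
        using that g'(2) by (auto simp: g_def W_def)
      moreover have "g x \<in> C i" if i: "i \<in> I" and x: "x \<in> W D" "x \<in> A i" for i x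
      proof (cases "x \<in> W D'")
        case True
        then show ?thesis
          using g'(3) i x by (auto simp: g_def)
      next
        case False
        then have xd: "x \<in> A d"
          using x WD by auto
        obtain m where m: "m \<in> I" "\<forall>i\<in>I. x \<in> A i \<longleftrightarrow> m \<le> i"
          using strat x WDZ by blast
        have "m \<le> d" "m \<le> i" "x \<in> A m"
          using m xd dI i x by auto
        have "m \<in> D"
          using psubset.prems(2) d m(1) \<open>m \<le> d\<close> by blast
        \<comment> \<open>\<open>m\<close> is the least index at \<open>x\<close>. If it belonged to
          \<open>D'\<close>, then \<open>x\<close> would already lie in \<open>W D'\<close>. So all
          sets through a new point have indices above \<open>d\<close>, and monotonicity of
          \<open>C\<close> suffices.\<close>
        then have "m = d"
          using False \<open>x \<in> A m\<close> by (auto simp: W_def D'_def)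
        then show ?thesis
          using k(2) xd mono[OF m(1) i \<open>m \<le> i\<close>] False by (auto simp: g_def)
      qed
      ultimately show ?thesis
        using WD by (intro exI[of _ g]) auto
    qed
  qed
  have "W I = Z"
    using strat BZ AZ by (fastforce simp: W_def)
  then obtain g where "continuous_on Z g" "\<forall>x\<in>B. g x = h x" "\<forall>i\<in>I. g ` (Z \<inter> A i) \<subseteq> C i"
    using key[OF fin] by auto
  then show thesis
    using that[of g] AZ by (metis inf.absorb2)
qed

text \<open>The extension lemma for the cylinder over \<open>X\<close>, covered by the products of
  the unit interval with the \<open>A i\<close>, the map being prescribed on the two ends.\<close>

lemma carrier_homotopic:
  fixes f g :: "'a::euclidean_space \<Rightarrow> 'b::euclidean_space" and A :: "'i::order \<Rightarrow> 'a set"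
  assumes X: "AR_cover I X A" and Y: "AR_cover I Y C"
    and f: "continuous_on X f" "\<And>i. i \<in> I \<Longrightarrow> f ` A i \<subseteq> C i"
    and g: "continuous_on X g" "\<And>i. i \<in> I \<Longrightarrow> g ` A i \<subseteq> C i"
  shows "homotopic_with_canon (\<lambda>_. True) X Y f g"
proof -
  define Z where "Z = {0..1::real} \<times> X"
  define B where "B = {0,1::real} \<times> X"
  define h where "h z = (if fst z = 0 then f (snd z) else g (snd z))" for z :: "real \<times> 'a"
  have AX: "A i \<subseteq> X" and CY: "C i \<subseteq> Y" if "i \<in> I" for i
    using that AR_cover_subset[OF X] AR_cover_subset[OF Y] by blast+
  have strat: "\<exists>k\<in>I. \<forall>i\<in>I. z \<in> {0..1} \<times> A i \<longleftrightarrow> k \<le> i" if "z \<in> Z" for z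
    using X that unfolding Z_def AR_cover_def by (auto simp: mem_Times_iff)
  have clo: "closedin (top_of_set Z) ({0..1} \<times> A i)" if "i \<in> I" for i
    unfolding Z_def using X that by (intro closedin_Times) (auto simp: AR_cover_def)
  have B: "closedin (top_of_set Z) B"
    unfolding Z_def B_def by (intro closedin_Times) (auto intro: closed_subset)
  have ends: "closedin (top_of_set ({0} \<times> X \<union> {1} \<times> X)) ({t} \<times> X)"
    if t: "t \<in> {0, 1}" for t :: real
  proof (rule closedin_subset_trans[where U = Z])
    show "closedin (top_of_set Z) ({t} \<times> X)"
      using t unfolding Z_def by (intro closedin_Times) (auto intro: closed_subset)
    show "{t} \<times> X \<subseteq> {0} \<times> X \<union> {1} \<times> X"
      using t by blast
    show "{0} \<times> X \<union> {1} \<times> X \<subseteq> Z"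
      unfolding Z_def by (intro Un_least Sigma_mono) auto
  qed
  have "continuous_on ({0} \<times> X \<union> {1} \<times> X) h"
    unfolding h_def
  proof (rule continuous_on_cases_local)
    show "continuous_on ({0::real} \<times> X) (\<lambda>z. f (snd z))"
      by (rule continuous_on_compose2[OF f(1)]) (auto intro!: continuous_intros)
    show "continuous_on ({1::real} \<times> X) (\<lambda>z. g (snd z))"
      by (rule continuous_on_compose2[OF g(1)]) (auto intro!: continuous_intros)
    fix z :: "real \<times> 'a"
    assume "z \<in> {0} \<times> X \<and> fst z \<noteq> 0 \<or> z \<in> {1} \<times> X \<and> fst z = 0"
    then show "f (snd z) = g (snd z)"
      by auto
  qed (simp_all add: ends)
  moreover have "{0} \<times> X \<union> {1} \<times> X = B"
    by (auto simp: B_def)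
  ultimately have conth: "continuous_on B h"
    by simp
  have hC: "h ` (B \<inter> {0..1} \<times> A i) \<subseteq> C i" if "i \<in> I" for i
    using f(2)[OF that] g(2)[OF that] by (auto simp: B_def h_def)
  have fin: "finite I"
    using X by (simp add: AR_cover_def)
  have ARC: "AR (C i)" if "i \<in> I" for i
    using Y that by (simp add: AR_cover_def)
  have "\<exists>H. continuous_on Z H \<and> (\<forall>z\<in>B. H z = h z) \<and> (\<forall>i\<in>I. H ` ({0..1} \<times> A i) \<subseteq> C i)"
  proof (rule carrier_extension[where I = I and Z = Z and A = "\<lambda>i. {0..1} \<times> A i" and C = C
        and B = B and h = h, OF fin strat clo ARC AR_cover_mono[OF Y] B conth hC])
    fix H
    assume "continuous_on Z H" "\<And>z. z \<in> B \<Longrightarrow> H z = h z"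
      "\<And>i. i \<in> I \<Longrightarrow> H ` ({0..1} \<times> A i) \<subseteq> C i"
    then show ?thesis
      by (intro exI[of _ H] conjI ballI)
  qed
  then obtain H where H: "continuous_on Z H" "\<forall>z\<in>B. H z = h z"
      "\<forall>i\<in>I. H ` ({0..1} \<times> A i) \<subseteq> C i"
    by (elim exE conjE)
  have "H ` Z \<subseteq> Y"
  proof clarify
    fix t x assume z: "(t, x) \<in> Z"
    then obtain k where k: "k \<in> I" "(t, x) \<in> {0..1} \<times> A k"
      using strat by blast
    then show "H (t, x) \<in> Y"
      using H(3) k CY[OF k(1)] by blast
  qed
  then have "continuous_map (top_of_set Z) (top_of_set Y) H"
    using H(1) by auto
  moreover have "H (0, x) = f x" "H (1, x) = g x" if "x \<in> X" for x
    using H(2) that by (auto simp: B_def h_def)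
  ultimately show ?thesis
    unfolding Z_def by (subst homotopic_with) (auto intro!: exI[of _ H])
qed

text \<open>Maps in both directions exist by extension from the empty set. Each composite respects
  the cover of its space, as does the identity, so the two are homotopic.\<close>

theorem AR_cover_homotopy_eqv:
  assumes X: "AR_cover I X A" and Y: "AR_cover I Y C"
  shows "X homotopy_eqv Y"
proof -
  \<comment> \<open>Stated for fresh types and spaces because it is used in both directions.\<close>
  have ex: "\<exists>f. continuous_on X f \<and> f ` X \<subseteq> Y \<and> (\<forall>i\<in>I. f ` A i \<subseteq> C i)"
    if X: "AR_cover I X A" and Y: "AR_cover I Y C"
    for X :: "'x::euclidean_space set" and Y :: "'y::euclidean_space set" and A C
  proof -
    have fin: "finite I"
      using X by (simp add: AR_cover_def)
    have strat: "\<exists>k\<in>I. \<forall>i\<in>I. z \<in> A i \<longleftrightarrow> k \<le> i" if "z \<in> X" for z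
      using X that by (simp add: AR_cover_def)
    have clo: "closedin (top_of_set X) (A i)" and ARC: "AR (C i)" if "i \<in> I" for i
      using X Y that by (simp_all add: AR_cover_def)
    obtain f where f: "continuous_on X f" "\<And>i. i \<in> I \<Longrightarrow> f ` A i \<subseteq> C i"
      by (rule carrier_extension[where I = I and Z = X and A = A and C = C and B = "{}"
            and h = "\<lambda>_. undefined", OF fin strat clo ARC AR_cover_mono[OF Y]]) auto
    have "f x \<in> Y" if x: "x \<in> X" for x
    proof -
      obtain k where k: "k \<in> I" "\<forall>i\<in>I. x \<in> A i \<longleftrightarrow> k \<le> i"
        using strat[OF x] by blast
      then have "x \<in> A k"
        by simp
      then have "f x \<in> C k"
        using f(2)[OF k(1)] by blast
      then show ?thesis
        using AR_cover_subset[OF Y k(1)] by blast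
    qed
    then show ?thesis
      using f by blast
  qed
  obtain f where f: "continuous_on X f" "f ` X \<subseteq> Y" "\<forall>i\<in>I. f ` A i \<subseteq> C i"
    using ex[OF X Y] by (elim exE conjE)
  obtain g where g: "continuous_on Y g" "g ` Y \<subseteq> X" "\<forall>i\<in>I. g ` C i \<subseteq> A i"
    using ex[OF Y X] by (elim exE conjE)
  have "homotopic_with_canon (\<lambda>_. True) X X (g \<circ> f) id"
  proof (rule carrier_homotopic[OF X X])
    show "continuous_on X (g \<circ> f)"
      by (rule continuous_on_compose[OF f(1) continuous_on_subset[OF g(1) f(2)]])
    show "(g \<circ> f) ` A i \<subseteq> A i" if "i \<in> I" for i
      using f(3) g(3) that by fastforce
  qed auto
  moreover have "homotopic_with_canon (\<lambda>_. True) Y Y (f \<circ> g) id"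
  proof (rule carrier_homotopic[OF Y Y])
    show "continuous_on Y (f \<circ> g)"
      by (rule continuous_on_compose[OF g(1) continuous_on_subset[OF f(1) g(2)]])
    show "(f \<circ> g) ` C i \<subseteq> C i" if "i \<in> I" for i
      using g(3) f(3) that by fastforce
  qed auto
  ultimately show ?thesis
    using f g unfolding homotopy_equivalent_space_def
    by (intro exI[of _ f] exI[of _ g]) auto
qed

section \<open>Order complexes\<close>

definition pairwise_comparable :: "'p::order set \<Rightarrow> bool" where
  "pairwise_comparable S \<longleftrightarrow> (\<forall>p\<in>S. \<forall>q\<in>S. p \<le> q \<or> q \<le> p)"

lemma pairwise_comparable_subset:
  "pairwise_comparable S \<Longrightarrow> T \<subseteq> S \<Longrightarrow> pairwise_comparable T"
  unfolding pairwise_comparable_def by blast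

definition order_complex :: "(real ^ 'p::{finite,order}) set" where
  "order_complex = {y. (\<forall>p. 0 \<le> y $ p) \<and> (\<Sum>p\<in>UNIV. y $ p) = 1 \<and>
     pairwise_comparable {p. y $ p \<noteq> 0}}"

definition simplex_on :: "'p::finite set \<Rightarrow> (real ^ 'p) set" where
  "simplex_on S = {y. (\<forall>p. 0 \<le> y $ p) \<and> (\<Sum>p\<in>UNIV. y $ p) = 1 \<and> (\<forall>p\<in>-S. y $ p = 0)}"

lemma closed_simplex_on: "closed (simplex_on S)"
proof -
  have "simplex_on S = (\<Inter>p. {y. 0 \<le> y $ p}) \<inter> {y. (\<Sum>p\<in>UNIV. y $ p) = 1} \<inter> (\<Inter>p\<in>-S. {y. y $ p = 0})"
    by (auto simp: simplex_on_def)
  also have "closed \<dots>"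
    by (intro closed_Int closed_INT ballI closed_Collect_le closed_Collect_eq continuous_intros)
  finally show ?thesis .
qed

lemma convex_simplex_on: "convex (simplex_on S)"
  unfolding convex_def simplex_on_def
  by (auto simp: sum.distrib simp flip: sum_distrib_left)

lemma order_complex_eq: "order_complex = (\<Union>S\<in>{S. pairwise_comparable S}. simplex_on S)"
  by (auto simp: order_complex_def simplex_on_def intro: pairwise_comparable_subset)

text \<open>The set is star-shaped about \<open>b\<close>: the supports of \<open>y\<close> and
  \<open>b\<close> together form a chain, so the segment between them stays in one simplex. A finite
  union of closed convex sets is a neighbourhood retract, and a contractible one is an absolute
  retract.\<close>

lemma AR_order_complex_Int:
  assumes D: "closed D" "convex D" and b: "b \<in> order_complex \<inter> D"
    and star: "\<And>y. y \<in> order_complex \<inter> D \<Longrightarrow> pairwise_comparable ({p. y $ p \<noteq> 0} \<union> {p. b $ p \<noteq> 0})"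
  shows "AR (order_complex \<inter> D)"
proof -
  have "order_complex \<inter> D = \<Union>((\<lambda>S. simplex_on S \<inter> D) ` {S. pairwise_comparable S})"
    by (auto simp: order_complex_eq)
  moreover have "ANR (\<Union>((\<lambda>S. simplex_on S \<inter> D) ` {S. pairwise_comparable S}))"
    by (rule ANR_finite_Union_convex_closed)
      (auto intro: closed_Int closed_simplex_on D convex_Int convex_simplex_on)
  ultimately have "ANR (order_complex \<inter> D)"
    by simp
  moreover have "starlike (order_complex \<inter> D)"
    unfolding starlike_def
  proof (intro bexI[OF _ b] ballI)
    fix y assume y: "y \<in> order_complex \<inter> D"
    define S where "S = {p. y $ p \<noteq> 0} \<union> {p. b $ p \<noteq> 0}"
    have "y \<in> simplex_on S" "b \<in> simplex_on S"
      using y b by (auto simp: S_def simplex_on_def order_complex_def)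
    then have "closed_segment b y \<subseteq> simplex_on S \<inter> D"
      using y b D by (intro closed_segment_subset convex_Int convex_simplex_on) auto
    moreover have "simplex_on S \<subseteq> order_complex"
      using star[OF y] by (auto simp: order_complex_eq S_def)
    ultimately show "closed_segment b y \<subseteq> order_complex \<inter> D"
      by blast
  qed
  ultimately show ?thesis
    using b starlike_imp_contractible by (auto simp: AR_ANR)
qed

lemma order_complex_supp_nonempty:
  assumes "y \<in> order_complex"
  shows "\<exists>p. y $ p \<noteq> 0"
proof (rule ccontr)
  assume "\<not> ?thesis"
  then have "(\<Sum>p\<in>UNIV. y $ p) = 0"
    by simp
  with assms show False
    by (simp add: order_complex_def)
qed

lemma axis_in_order_complex: "axis p 1 \<in> order_complex"
proof -
  have "(\<Sum>q\<in>UNIV. axis p (1::real) $ q) = 1"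
    by (simp add: axis_def)
  moreover have "{q. axis p (1::real) $ q \<noteq> 0} = {p}"
    by (auto simp: axis_def)
  ultimately show ?thesis
    by (auto simp: order_complex_def pairwise_comparable_def axis_def)
qed

text \<open>The set at \<open>c\<close> is the subcomplex of the chains below \<open>c\<close>, a
  cone with apex \<open>c\<close>. The least index at a point is the greatest element of its
  support.\<close>

theorem AR_cover_order_complex:
  "AR_cover UNIV (order_complex :: (real ^ 'p::{finite,order}) set)
     (\<lambda>c. {y \<in> order_complex. \<forall>p. \<not> p \<le> c \<longrightarrow> y $ p = 0})"
  unfolding AR_cover_def
proof (intro conjI ballI)
  fix c :: 'p
  define D where "D = (\<Inter>p\<in>{p. \<not> p \<le> c}. {y :: (real, 'p) vec. y $ p = 0})"
  have eq: "{y \<in> order_complex. \<forall>p. \<not> p \<le> c \<longrightarrow> y $ p = 0} = order_complex \<inter> D"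
    by (auto simp: D_def)
  have clo: "closed D"
    unfolding D_def by (intro closed_INT ballI closed_Collect_eq continuous_intros)
  have con: "convex D"
    unfolding D_def by (intro convex_INT) (auto simp: convex_def)
  show "closedin (top_of_set order_complex) {y \<in> order_complex. \<forall>p. \<not> p \<le> c \<longrightarrow> y $ p = 0}"
    unfolding eq using clo by (rule closedin_closed_Int)
  have "AR (order_complex \<inter> D)"
  proof (rule AR_order_complex_Int[OF clo con])
    show "axis c 1 \<in> order_complex \<inter> D"
      using axis_in_order_complex[of c] by (auto simp: D_def) (auto simp: axis_def)
    fix y assume "y \<in> order_complex \<inter> D"
    then have "pairwise_comparable {p. y $ p \<noteq> 0}" "\<And>p. y $ p \<noteq> 0 \<Longrightarrow> p \<le> c"
      by (auto simp: D_def order_complex_def)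
    moreover have "{p. axis c (1::real) $ p \<noteq> 0} = {c}"
      by (auto simp: axis_def)
    ultimately show "pairwise_comparable ({p. y $ p \<noteq> 0} \<union> {p. axis c (1::real) $ p \<noteq> 0})"
      by (auto simp: pairwise_comparable_def)
  qed
  then show "AR {y \<in> order_complex. \<forall>p. \<not> p \<le> c \<longrightarrow> y $ p = 0}"
    by (simp only: eq)
next
  fix y :: "(real, 'p) vec"
  assume y: "y \<in> order_complex"
  obtain k where k: "y $ k \<noteq> 0" "\<And>p. y $ p \<noteq> 0 \<Longrightarrow> k \<le> p \<Longrightarrow> k = p"
    using finite_has_maximal[of "{p. y $ p \<noteq> 0}"] order_complex_supp_nonempty[OF y] by auto
  have "p \<le> k" if "y $ p \<noteq> 0" for p
  proof -
    have "p \<le> k \<or> k \<le> p"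
      using y that k(1) by (auto simp: order_complex_def pairwise_comparable_def)
    then show ?thesis
      using k(2)[OF that] by blast
  qed
  then show "\<exists>k\<in>UNIV. \<forall>i\<in>UNIV. (y \<in> {y \<in> order_complex. \<forall>p. \<not> p \<le> i \<longrightarrow> y $ p = 0}) = (k \<le> i)"
    using y k(1) by (intro bexI[of _ k]) (auto intro: order_trans)
qed auto

section \<open>Dual cells in an order complex\<close>

definition argmax :: "real ^ 'p::finite \<Rightarrow> 'p set" where
  "argmax y = {p. \<forall>q. y $ q \<le> y $ p}"

text \<open>For a single element this is its closed star in the barycentric subdivision of the order
  complex; for a chain it is the intersection of these stars, the cell dual to a simplex. Describing
  it by coordinates makes it the trace of a closed convex set, so no subdivision has to be
  formed.\<close>

definition dual_cell :: "'p::{finite,order} set \<Rightarrow> (real ^ 'p::{finite,order}) set" where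
  "dual_cell S = {y \<in> order_complex. S \<subseteq> argmax y}"

lemma dual_cell_Int: "dual_cell S \<inter> dual_cell T = dual_cell (S \<union> T)"
  by (auto simp: dual_cell_def)

lemma argmax_nonempty: "argmax y \<noteq> {}"
proof -
  have "finite (range (\<lambda>p. y $ p))" "range (\<lambda>p. y $ p) \<noteq> {}"
    by auto
  from Max_in[OF this] obtain p where "Max (range (\<lambda>p. y $ p)) = y $ p"
    by blast
  then have "p \<in> argmax y"
    by (auto simp: argmax_def simp flip: \<open>Max (range (\<lambda>p. y $ p)) = y $ p\<close>)
  then show ?thesis
    by blast
qed

lemma argmax_subset_supp:
  assumes "y \<in> order_complex"
  shows "argmax y \<subseteq> {p. y $ p \<noteq> 0}"
proof
  fix p assume p: "p \<in> argmax y"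
  obtain q where "y $ q \<noteq> 0"
    using order_complex_supp_nonempty[OF assms] by blast
  then have "0 < y $ q"
    using assms by (auto simp: order_complex_def less_le)
  also have "y $ q \<le> y $ p"
    using p by (simp add: argmax_def)
  finally show "p \<in> {p. y $ p \<noteq> 0}"
    by simp
qed

lemma pairwise_comparable_argmax: "y \<in> order_complex \<Longrightarrow> pairwise_comparable (argmax y)"
  by (rule pairwise_comparable_subset[OF _ argmax_subset_supp]) (simp add: order_complex_def)

lemma dual_cell_empty: "\<not> pairwise_comparable S \<Longrightarrow> dual_cell S = {}"
  using pairwise_comparable_subset[OF pairwise_comparable_argmax] by (fastforce simp: dual_cell_def)

lemma dual_cell_eq_Int: "dual_cell S = order_complex \<inter> (\<Inter>p\<in>S. \<Inter>q. {y. y $ q \<le> y $ p})"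
  by (auto simp: dual_cell_def argmax_def)

lemma closed_dual_cell_aux: "closed (\<Inter>p\<in>S. \<Inter>q. {y :: real ^ 'p::finite. y $ q \<le> y $ p})"
  by (intro closed_INT ballI closed_Collect_le continuous_intros)

lemma closedin_dual_cell: "closedin (top_of_set order_complex) (dual_cell S)"
  unfolding dual_cell_eq_Int using closed_dual_cell_aux by (rule closedin_closed_Int)

text \<open>The set is star-shaped about the barycentre of the simplex \<open>S\<close>, since every
  point of the dual cell has all of \<open>S\<close> in its support.\<close>

lemma AR_dual_cell:
  fixes S :: "'p::{finite,order} set"
  assumes S: "pairwise_comparable S" "S \<noteq> {}"
  shows "AR (dual_cell S)"
  unfolding dual_cell_eq_Int
proof (rule AR_order_complex_Int[OF closed_dual_cell_aux])
  show "convex (\<Inter>p\<in>S. \<Inter>q. {y :: (real, 'p) vec. y $ q \<le> y $ p})"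
    by (intro convex_INT) (auto simp: convex_def intro!: add_mono mult_left_mono)
  define b :: "(real, 'p) vec" where "b = (\<chi> p. if p \<in> S then 1 / card S else 0)"
  have card: "card S > 0"
    using S by (simp add: card_gt_0_iff)
  have "(\<Sum>p\<in>UNIV. b $ p) = (\<Sum>p\<in>S. 1 / card S)"
    unfolding b_def by (simp add: sum.If_cases)
  also have "\<dots> = 1"
    using S(2) by simp
  finally have sum: "(\<Sum>p\<in>UNIV. b $ p) = 1" .
  have supp: "{p. b $ p \<noteq> 0} = S"
    using card by (auto simp: b_def)
  have "b \<in> order_complex"
    using S sum by (simp add: order_complex_def supp) (simp add: b_def)
  then show "b \<in> order_complex \<inter> (\<Inter>p\<in>S. \<Inter>q. {y. y $ q \<le> y $ p})"
    by (auto simp: b_def)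
  fix y assume "y \<in> order_complex \<inter> (\<Inter>p\<in>S. \<Inter>q. {y. y $ q \<le> y $ p})"
  then have "y \<in> order_complex" "S \<subseteq> argmax y"
    by (auto simp: argmax_def)
  then have "S \<subseteq> {p. y $ p \<noteq> 0}" "pairwise_comparable {p. y $ p \<noteq> 0}"
    using argmax_subset_supp by (auto simp: order_complex_def)
  then show "pairwise_comparable ({p. y $ p \<noteq> 0} \<union> {p. b $ p \<noteq> 0})"
    unfolding supp by (simp add: sup.absorb1)
qed

section \<open>The cells of the configuration space\<close>

text \<open>A type with four elements makes \<open>complex ^ label\<close> a Euclidean space, as the
  covers by absolute retracts demand. The fifth point is the base point and needs no label.\<close>

datatype label = L1 | L2 | L3 | L4

lemma UNIV_label: "UNIV = {L1, L2, L3, L4}"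
  by (auto intro: label.exhaust)

instance label :: finite
  by standard (simp add: UNIV_label)

primrec num :: "label \<Rightarrow> nat" where
  "num L1 = 1" | "num L2 = 2" | "num L3 = 3" | "num L4 = 4"

lemma num_eq_iff [simp]: "num i = num j \<longleftrightarrow> i = j"
  by (cases i; cases j) auto

lemma num_bounds: "1 \<le> num i" "num i \<le> 4"
  by (cases i; simp)+

lemma num_surj: "n \<in> {1..4} \<Longrightarrow> \<exists>i. num i = n"
proof -
  assume "n \<in> {1..4}"
  then have "n = num L1 \<or> n = num L2 \<or> n = num L3 \<or> n = num L4"
    by auto
  then show ?thesis
    by blast
qed

lemma label_exhausted:
  assumes "distinct [a, b, c, d :: label]"
  shows "UNIV = {a, b, c, d}"
proof -
  have "card {a, b, c, d} = 4"
    using assms by auto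
  moreover have "card (UNIV :: label set) = 4"
    by (simp add: UNIV_label)
  ultimately show ?thesis
    by (metis card_subset_eq finite subset_UNIV)
qed

lemma label_cases:
  "distinct [a, b, c, d :: label] \<Longrightarrow> i = a \<or> i = b \<or> i = c \<or> i = d"
  using label_exhausted[of a b c d] UNIV_I[of i] by blast

section \<open>Angles measured from the base point, and coincidences\<close>

definition angle :: "complex \<Rightarrow> complex \<Rightarrow> real" where
  "angle p z = Arg2pi (z / p) / (2 * pi)"

lemma angle_bounds: "0 \<le> angle p z" "angle p z < 1"
  using Arg2pi[of "z / p"] by (auto simp: angle_def)

lemma angle_cis:
  assumes "p \<in> circle" "z \<in> circle"
  shows "z = p * cis (2 * pi * angle p z)"
proof -
  have "norm (z / p) = 1" "p \<noteq> 0"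
    using assms by (auto simp: norm_divide)
  then have "z / p = cis (Arg2pi (z / p))"
    using Arg2pi[of "z / p"] by (simp add: is_Arg_def cis_conv_exp)
  then have "z = p * cis (Arg2pi (z / p))"
    using \<open>p \<noteq> 0\<close> by (metis nonzero_mult_div_cancel_left times_divide_eq_right)
  then show ?thesis
    by (simp add: angle_def)
qed

lemma angle_mult_cis:
  assumes "p \<in> circle" "0 \<le> u" "u < 1"
  shows "angle p (p * cis (2 * pi * u)) = u"
proof -
  have "p \<noteq> 0"
    using assms by auto
  moreover have "Arg2pi (cis (2 * pi * u)) = 2 * pi * u"
    by (rule Arg2pi_unique[of 1]) (use assms in \<open>auto simp: cis_conv_exp mult.commute\<close>)
  ultimately show ?thesis
    by (simp add: angle_def)
qed

lemma angle_mult_cis_le: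
  assumes "p \<in> circle" "0 \<le> u" "u \<le> 1"
  shows "angle p (p * cis (2 * pi * u)) = (if u = 1 then 0 else u)"
  using angle_mult_cis[OF assms(1), of 0] angle_mult_cis[OF assms(1), of u] assms by auto

lemma angle_eq_iff:
  "p \<in> circle \<Longrightarrow> z \<in> circle \<Longrightarrow> w \<in> circle \<Longrightarrow> angle p z = angle p w \<longleftrightarrow> z = w"
  by (metis angle_cis)

lemma angle_eq_0_iff: "p \<in> circle \<Longrightarrow> z \<in> circle \<Longrightarrow> angle p z = 0 \<longleftrightarrow> z = p"
  using angle_eq_iff[of p z p] angle_mult_cis[of p 0] by simp

text \<open>The base point has angle 0, so the first condition excludes the triples that contain the
  fifth point and the second one the others.\<close>

definition no_triple :: "(label \<Rightarrow> real) \<Rightarrow> bool" where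
  "no_triple \<theta> \<longleftrightarrow> (\<forall>i j. i \<noteq> j \<longrightarrow> \<not> (\<theta> i = 0 \<and> \<theta> j = 0)) \<and>
     (\<forall>i j k. distinct [i, j, k] \<longrightarrow> \<not> (\<theta> i = \<theta> j \<and> \<theta> j = \<theta> k))"

lemma no_tripleD:
  assumes "no_triple \<theta>"
  shows "i \<noteq> j \<Longrightarrow> \<theta> i = 0 \<Longrightarrow> \<theta> j \<noteq> 0"
    and "distinct [i, j, k] \<Longrightarrow> \<theta> i = \<theta> j \<Longrightarrow> \<theta> j \<noteq> \<theta> k"
  using assms unfolding no_triple_def by blast+

definition angles :: "complex \<Rightarrow> complex ^ label \<Rightarrow> label \<Rightarrow> real" where
  "angles p x i = angle p (x $ i)"

definition config :: "complex \<Rightarrow> (complex ^ label) set" where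
  "config p = {x. (\<forall>i. x $ i \<in> circle) \<and> no_triple (angles p x)}"

text \<open>In \<open>sorted_from_base \<theta> a b c d\<close> the second disjunct accounts for a point at the base point,
  which may be placed at the end of the cyclic order \<open>\<infinity>, a, b, c, d\<close> as well as at its beginning.\<close>

definition sorted_from_base :: "(label \<Rightarrow> real) \<Rightarrow> label \<Rightarrow> label \<Rightarrow> label \<Rightarrow> label \<Rightarrow> bool" where
  "sorted_from_base \<theta> a b c d \<longleftrightarrow>
     \<theta> a \<le> \<theta> b \<and> \<theta> b \<le> \<theta> c \<and> (\<theta> c \<le> \<theta> d \<or> \<theta> d = 0)"

text \<open>The labels are read as decimal digits: chambers become numerals, and the simplifier can
  compare sets of chambers taken from the tables.\<close>

definition code :: "label \<Rightarrow> label \<Rightarrow> label \<Rightarrow> label \<Rightarrow> nat" where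
  "code a b c d = 1000 * num a + 100 * num b + 10 * num c + num d"

lemma code_eq_iff [simp]:
  "code a b c d = code a' b' c' d' \<longleftrightarrow> a = a' \<and> b = b' \<and> c = c' \<and> d = d'"
proof
  assume *: "code a b c d = code a' b' c' d'"
  note bounds = num_bounds[of a] num_bounds[of b] num_bounds[of c] num_bounds[of d]
    num_bounds[of a'] num_bounds[of b'] num_bounds[of c'] num_bounds[of d']
  have a: "num a = num a'"
    using * bounds unfolding code_def by linarith
  have b: "num b = num b'"
    using * a bounds unfolding code_def by linarith
  have c: "num c = num c'"
    using * a b bounds unfolding code_def by linarith
  have "num d = num d'"
    using * a b c unfolding code_def by linarith
  with a b c show "a = a' \<and> b = b' \<and> c = c' \<and> d = d'"
    by simp
qed simp

text \<open>These are the closed chambers through the configuration: coinciding points may be read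
  in either order.\<close>

definition chambers :: "(label \<Rightarrow> real) \<Rightarrow> nat set" where
  "chambers \<theta> = {code a b c d | a b c d. distinct [a, b, c, d] \<and> sorted_from_base \<theta> a b c d}"

text \<open>Each cell is the set of chambers around it. The clauses list the coincidences that are
  possible without a triple: none; then \<open>a = b\<close>, \<open>b = c\<close>,
  \<open>c = d\<close>, or \<open>a\<close> at the base point; then two of these without a common
  point. A point \<open>d\<close> arriving at the base point from the other side is covered by the
  clauses for the chamber \<open>d a b c\<close>.\<close>

inductive_set cells :: "nat set set" where
  "distinct [a, b, c, d] \<Longrightarrow> {code a b c d} \<in> cells"
| "distinct [a, b, c, d] \<Longrightarrow> {code a b c d, code b a c d} \<in> cells"
| "distinct [a, b, c, d] \<Longrightarrow> {code a b c d, code a c b d} \<in> cells"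
| "distinct [a, b, c, d] \<Longrightarrow> {code a b c d, code a b d c} \<in> cells"
| "distinct [a, b, c, d] \<Longrightarrow> {code a b c d, code b c d a} \<in> cells"
| "distinct [a, b, c, d] \<Longrightarrow> {code a b c d, code b a c d, code a b d c, code b a d c} \<in> cells"
| "distinct [a, b, c, d] \<Longrightarrow> {code a b c d, code a c b d, code b c d a, code c b d a} \<in> cells"
| "distinct [a, b, c, d] \<Longrightarrow> {code a b c d, code a b d c, code b c d a, code b d c a} \<in> cells"

lemma code_in_chambers:
  "distinct [a, b, c, d] \<Longrightarrow> code a b c d \<in> chambers \<theta> \<longleftrightarrow> sorted_from_base \<theta> a b c d"
  by (auto simp: chambers_def)

lemma ex_sorted_labels:
  fixes \<theta> :: "label \<Rightarrow> real"
  shows "\<exists>a b c d. distinct [a, b, c, d] \<and> \<theta> a \<le> \<theta> b \<and> \<theta> b \<le> \<theta> c \<and> \<theta> c \<le> \<theta> d"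
proof -
  define xs where "xs = sort_key \<theta> [L1, L2, L3, L4]"
  have xs: "length xs = 4" "distinct xs" "sorted (map \<theta> xs)"
    by (simp_all add: xs_def)
  then obtain a b c d where "xs = [a, b, c, d]"
    by (auto simp: numeral_eq_Suc length_Suc_conv)
  with xs show ?thesis
    by (intro exI[of _ a] exI[of _ b] exI[of _ c] exI[of _ d]) auto
qed

text \<open>Ties leave the order of the labels open but not the values: both lists sort the same
  multiset.\<close>

lemma sorted_labels_unique:
  fixes \<theta> :: "label \<Rightarrow> real"
  assumes "distinct [a, b, c, d]" "\<theta> a \<le> \<theta> b" "\<theta> b \<le> \<theta> c" "\<theta> c \<le> \<theta> d"
    and "distinct [w, x, y, z]" "\<theta> w \<le> \<theta> x" "\<theta> x \<le> \<theta> y" "\<theta> y \<le> \<theta> z"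
  shows "\<theta> w = \<theta> a \<and> \<theta> x = \<theta> b \<and> \<theta> y = \<theta> c \<and> \<theta> z = \<theta> d"
proof -
  have "set [a, b, c, d] = set [w, x, y, z]"
    using label_exhausted[OF assms(1)] label_exhausted[OF assms(5)] by simp
  then have "mset [a, b, c, d] = mset [w, x, y, z]"
    using assms(1,5) set_eq_iff_mset_eq_distinct by blast
  then have "mset (map \<theta> [a, b, c, d]) = mset (map \<theta> [w, x, y, z])"
    by (simp only: mset_map)
  moreover have "sorted (map \<theta> [a, b, c, d])" "sorted (map \<theta> [w, x, y, z])"
    using assms by auto
  ultimately have "map \<theta> [a, b, c, d] = map \<theta> [w, x, y, z]"
    by (metis properties_for_sort)
  then show ?thesis
    by simp
qed

text \<open>After sorting the labels by angle, coincidences occur only between neighbours, and the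
  absence of triples keeps any two coincidences apart. In each remaining case the possible chambers
  can be listed.\<close>

lemma chambers_in_cells:
  assumes nt: "no_triple \<theta>" and nonneg: "\<And>i. 0 \<le> \<theta> i"
  shows "chambers \<theta> \<in> cells"
proof -
  obtain a b c d where d: "distinct [a, b, c, d]" and s: "\<theta> a \<le> \<theta> b" "\<theta> b \<le> \<theta> c" "\<theta> c \<le> \<theta> d"
    using ex_sorted_labels by metis
  have ne: "a \<noteq> b" "a \<noteq> c" "a \<noteq> d" "b \<noteq> c" "b \<noteq> d" "c \<noteq> d"
    "b \<noteq> a" "c \<noteq> a" "d \<noteq> a" "c \<noteq> b" "d \<noteq> b" "d \<noteq> c"
    using d by auto
  have "\<not> (\<theta> a = 0 \<and> \<theta> b = 0)" "\<not> (\<theta> a = \<theta> b \<and> \<theta> b = \<theta> c)" "\<not> (\<theta> b = \<theta> c \<and> \<theta> c = \<theta> d)"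
    using no_tripleD(1)[OF nt, of a b] no_tripleD(2)[OF nt, of a b c]
      no_tripleD(2)[OF nt, of b c d] ne by auto
  then have strict: "0 \<le> \<theta> a" "0 < \<theta> b" "\<theta> a < \<theta> c" "\<theta> b < \<theta> d"
    using s nonneg[of a] by linarith+
  have eqa: "w = a \<or> w = b \<and> \<theta> a = \<theta> b" if "\<theta> w = \<theta> a" for w
    using label_cases[OF d, of w] that s strict by auto
  have eqb: "w = b \<or> w = a \<and> \<theta> a = \<theta> b \<or> w = c \<and> \<theta> b = \<theta> c" if "\<theta> w = \<theta> b" for w
    using label_cases[OF d, of w] that s strict by auto
  have eqc: "w = c \<or> w = b \<and> \<theta> b = \<theta> c \<or> w = d \<and> \<theta> c = \<theta> d" if "\<theta> w = \<theta> c" for w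
    using label_cases[OF d, of w] that s strict by auto
  have eqd: "w = d \<or> w = c \<and> \<theta> c = \<theta> d" if "\<theta> w = \<theta> d" for w
    using label_cases[OF d, of w] that s strict by auto
  \<comment> \<open>The reorderings of \<open>a b c d\<close> that leave the sorted list of angles
    unchanged. A chamber is such an order, or arises from one by moving its first label, which is
    then at the base point, to the end.\<close>
  define E where "E w x y z \<longleftrightarrow> distinct [w, x, y, z] \<and> (w = a \<or> w = b \<and> \<theta> a = \<theta> b) \<and>
      (x = b \<or> x = a \<and> \<theta> a = \<theta> b \<or> x = c \<and> \<theta> b = \<theta> c) \<and>
      (y = c \<or> y = b \<and> \<theta> b = \<theta> c \<or> y = d \<and> \<theta> c = \<theta> d) \<and>
      (z = d \<or> z = c \<and> \<theta> c = \<theta> d)" for w x y z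
  have chambers: "\<exists>w x y z. n = code w x y z \<and> (E w x y z \<or> E z w x y \<and> \<theta> z = 0)"
    if nc: "n \<in> chambers \<theta>" for n
  proof -
    obtain w x y z where n: "n = code w x y z" and dw: "distinct [w, x, y, z]"
      and sw: "\<theta> w \<le> \<theta> x" "\<theta> x \<le> \<theta> y" "\<theta> y \<le> \<theta> z \<or> \<theta> z = 0"
      using nc unfolding chambers_def sorted_from_base_def by blast
    from sw(3) have "E w x y z \<or> E z w x y \<and> \<theta> z = 0"
    proof
      assume "\<theta> y \<le> \<theta> z"
      from sorted_labels_unique[OF d s dw sw(1,2) this] show ?thesis
        unfolding E_def using eqa[of w] eqb[of x] eqc[of y] eqd[of z] dw by blast
    next
      assume z: "\<theta> z = 0"
      have dz: "distinct [z, w, x, y]" and sz: "\<theta> z \<le> \<theta> w"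
        using dw z nonneg by auto
      from sorted_labels_unique[OF d s dz sz sw(1,2)] show ?thesis
        unfolding E_def using eqa[of z] eqb[of w] eqc[of x] eqd[of y] dz z by blast
    qed
    with n show ?thesis
      by blast
  qed
  have trichotomy: "\<theta> a = 0 \<or> 0 < \<theta> a" "\<theta> a = \<theta> b \<or> \<theta> a < \<theta> b" "\<theta> b = \<theta> c \<or> \<theta> b < \<theta> c"
    "\<theta> c = \<theta> d \<or> \<theta> c < \<theta> d" "\<not> (\<theta> a = 0 \<and> \<theta> a = \<theta> b)" "\<not> (\<theta> a = \<theta> b \<and> \<theta> b = \<theta> c)"
    "\<not> (\<theta> b = \<theta> c \<and> \<theta> c = \<theta> d)"
    using s strict by auto
  note sb = code_in_chambers sorted_from_base_def
  \<comment> \<open>Of the four gaps between the base point and \<open>a\<close>, \<open>b\<close>,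
    \<open>c\<close>, \<open>d\<close>, no two neighbouring ones can be closed; this leaves eight
    patterns.\<close>
  consider "\<theta> a = 0" "\<theta> b < \<theta> c" "\<theta> c < \<theta> d" | "\<theta> a = 0" "\<theta> b = \<theta> c" "\<theta> c < \<theta> d"
    | "\<theta> a = 0" "\<theta> b < \<theta> c" "\<theta> c = \<theta> d"
    | "0 < \<theta> a" "\<theta> a < \<theta> b" "\<theta> b < \<theta> c" "\<theta> c < \<theta> d" | "0 < \<theta> a" "\<theta> a = \<theta> b" "\<theta> b < \<theta> c" "\<theta> c < \<theta> d"
    | "0 < \<theta> a" "\<theta> a < \<theta> b" "\<theta> b = \<theta> c" "\<theta> c < \<theta> d" | "0 < \<theta> a" "\<theta> a < \<theta> b" "\<theta> b < \<theta> c" "\<theta> c = \<theta> d"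
    | "0 < \<theta> a" "\<theta> a = \<theta> b" "\<theta> b < \<theta> c" "\<theta> c = \<theta> d"
    using trichotomy by blast
  then show ?thesis
  proof cases
    case 1
    have E: "(w = a \<and> x = b \<and> y = c \<and> z = d)" if "E w x y z" for w x y z
      using that 1 strict ne by (simp add: E_def) blast?
    have "chambers \<theta> = {code a b c d, code b c d a}"
    proof
      show "chambers \<theta> \<subseteq> {code a b c d, code b c d a}"
      proof
        fix n assume "n \<in> chambers \<theta>"
        from chambers[OF this] show "n \<in> {code a b c d, code b c d a}"
          using 1 strict ne by (auto dest!: E)
      qed
    qed (use 1 s strict ne in \<open>simp add: sb\<close>)
    then show ?thesis
      using cells.intros(5)[OF d] by simp
  next
    case 2
    have E: "(w = a \<and> x = b \<and> y = c \<and> z = d) \<or> (w = a \<and> x = c \<and> y = b \<and> z = d)" if "E w x y z" for w x y z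
      using that 2 strict ne by (simp add: E_def) blast?
    have "chambers \<theta> = {code a b c d, code a c b d, code b c d a, code c b d a}"
    proof
      show "chambers \<theta> \<subseteq> {code a b c d, code a c b d, code b c d a, code c b d a}"
      proof
        fix n assume "n \<in> chambers \<theta>"
        from chambers[OF this] show "n \<in> {code a b c d, code a c b d, code b c d a, code c b d a}"
          using 2 strict ne by (auto dest!: E)
      qed
    qed (use 2 s strict ne in \<open>simp add: sb\<close>)
    then show ?thesis
      using cells.intros(7)[OF d] by simp
  next
    case 3
    have E: "(w = a \<and> x = b \<and> y = c \<and> z = d) \<or> (w = a \<and> x = b \<and> y = d \<and> z = c)" if "E w x y z" for w x y z
      using that 3 strict ne by (simp add: E_def) blast?
    have "chambers \<theta> = {code a b c d, code a b d c, code b c d a, code b d c a}"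
    proof
      show "chambers \<theta> \<subseteq> {code a b c d, code a b d c, code b c d a, code b d c a}"
      proof
        fix n assume "n \<in> chambers \<theta>"
        from chambers[OF this] show "n \<in> {code a b c d, code a b d c, code b c d a, code b d c a}"
          using 3 strict ne by (auto dest!: E)
      qed
    qed (use 3 s strict ne in \<open>simp add: sb\<close>)
    then show ?thesis
      using cells.intros(8)[OF d] by simp
  next
    case 4
    have E: "(w = a \<and> x = b \<and> y = c \<and> z = d)" if "E w x y z" for w x y z
      using that 4 strict ne by (simp add: E_def) blast?
    have "chambers \<theta> = {code a b c d}"
    proof
      show "chambers \<theta> \<subseteq> {code a b c d}"
      proof
        fix n assume "n \<in> chambers \<theta>"
        from chambers[OF this] show "n \<in> {code a b c d}"
          using 4 strict ne by (auto dest!: E)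
      qed
    qed (use 4 s strict ne in \<open>simp add: sb\<close>)
    then show ?thesis
      using cells.intros(1)[OF d] by simp
  next
    case 5
    have E: "(w = a \<and> x = b \<and> y = c \<and> z = d) \<or> (w = b \<and> x = a \<and> y = c \<and> z = d)" if "E w x y z" for w x y z
      using that 5 strict ne by (simp add: E_def) blast?
    have "chambers \<theta> = {code a b c d, code b a c d}"
    proof
      show "chambers \<theta> \<subseteq> {code a b c d, code b a c d}"
      proof
        fix n assume "n \<in> chambers \<theta>"
        from chambers[OF this] show "n \<in> {code a b c d, code b a c d}"
          using 5 strict ne by (auto dest!: E)
      qed
    qed (use 5 s strict ne in \<open>simp add: sb\<close>)
    then show ?thesis
      using cells.intros(2)[OF d] by simp
  next
    case 6
    have E: "(w = a \<and> x = b \<and> y = c \<and> z = d) \<or> (w = a \<and> x = c \<and> y = b \<and> z = d)" if "E w x y z" for w x y z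
      using that 6 strict ne by (simp add: E_def) blast?
    have "chambers \<theta> = {code a b c d, code a c b d}"
    proof
      show "chambers \<theta> \<subseteq> {code a b c d, code a c b d}"
      proof
        fix n assume "n \<in> chambers \<theta>"
        from chambers[OF this] show "n \<in> {code a b c d, code a c b d}"
          using 6 strict ne by (auto dest!: E)
      qed
    qed (use 6 s strict ne in \<open>simp add: sb\<close>)
    then show ?thesis
      using cells.intros(3)[OF d] by simp
  next
    case 7
    have E: "(w = a \<and> x = b \<and> y = c \<and> z = d) \<or> (w = a \<and> x = b \<and> y = d \<and> z = c)" if "E w x y z" for w x y z
      using that 7 strict ne by (simp add: E_def) blast?
    have "chambers \<theta> = {code a b c d, code a b d c}"
    proof
      show "chambers \<theta> \<subseteq> {code a b c d, code a b d c}"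
      proof
        fix n assume "n \<in> chambers \<theta>"
        from chambers[OF this] show "n \<in> {code a b c d, code a b d c}"
          using 7 strict ne by (auto dest!: E)
      qed
    qed (use 7 s strict ne in \<open>simp add: sb\<close>)
    then show ?thesis
      using cells.intros(4)[OF d] by simp
  next
    case 8
    have E: "(w = a \<and> x = b \<and> y = c \<and> z = d) \<or> (w = b \<and> x = a \<and> y = c \<and> z = d) \<or> (w = a \<and> x = b \<and> y = d \<and> z = c) \<or> (w = b \<and> x = a \<and> y = d \<and> z = c)" if "E w x y z" for w x y z
      using that 8 strict ne by (simp add: E_def) blast?
    have "chambers \<theta> = {code a b c d, code b a c d, code a b d c, code b a d c}"
    proof
      show "chambers \<theta> \<subseteq> {code a b c d, code b a c d, code a b d c, code b a d c}"
      proof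
        fix n assume "n \<in> chambers \<theta>"
        from chambers[OF this] show "n \<in> {code a b c d, code b a c d, code a b d c, code b a d c}"
          using 8 strict ne by (auto dest!: E)
      qed
    qed (use 8 s strict ne in \<open>simp add: sb\<close>)
    then show ?thesis
      using cells.intros(6)[OF d] by simp
  qed
qed

section \<open>Closed cells as images of convex sets\<close>

definition lift :: "complex \<Rightarrow> real ^ label \<Rightarrow> complex ^ label" where
  "lift p t = (\<chi> i. p * cis (2 * pi * t $ i))"

definition ordered_simplex :: "label \<Rightarrow> label \<Rightarrow> label \<Rightarrow> label \<Rightarrow> (real ^ label) set" where
  "ordered_simplex a b c d =
     {t. 0 \<le> t $ a \<and> t $ a \<le> t $ b \<and> t $ b \<le> t $ c \<and> t $ c \<le> t $ d \<and> t $ d \<le> 1}"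

text \<open>One strict inequality for each of the five triples of consecutive points in the cyclic
  order of the base point, \<open>a\<close>, \<open>b\<close>, \<open>c\<close>, \<open>d\<close>.
  Being linear, they cut out a convex set.\<close>

definition triple_free :: "label \<Rightarrow> label \<Rightarrow> label \<Rightarrow> label \<Rightarrow> (real ^ label) set" where
  "triple_free a b c d =
     {t. 0 < t $ b \<and> t $ c < 1 \<and> t $ d - t $ a < 1 \<and> t $ a < t $ c \<and> t $ b < t $ d}"

lemma continuous_on_lift: "continuous_on S (lift p)"
  unfolding lift_def by (intro continuous_intros continuous_on_vec_lambda)

lemma ordered_simplex_bounds:
  assumes "distinct [a, b, c, d]" "t \<in> ordered_simplex a b c d"
  shows "0 \<le> t $ i \<and> t $ i \<le> 1"
  using label_cases[OF assms(1), of i] assms(2) by (auto simp: ordered_simplex_def)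

lemma compact_ordered_simplex:
  assumes "distinct [a, b, c, d]"
  shows "compact (ordered_simplex a b c d)"
proof -
  have "closed (ordered_simplex a b c d)"
    unfolding ordered_simplex_def
    by (intro closed_Collect_conj closed_Collect_le continuous_intros)
  moreover have "ordered_simplex a b c d \<subseteq> cbox 0 (\<chi> i. 1)"
    using ordered_simplex_bounds[OF assms] by (auto simp: cbox_def Basis_vec_def inner_axis)
  ultimately show ?thesis
    using bounded_cbox bounded_subset compact_eq_bounded_closed by blast
qed

lemma convex_coordinate:
  fixes i j :: "'n::finite"
  shows "convex {t :: real ^ 'n. t $ i - t $ j \<le> r}" "convex {t :: real ^ 'n. t $ i - t $ j < r}"
    "convex {t :: real ^ 'n. t $ i - t $ j = r}"
    "convex {t :: real ^ 'n. t $ i \<le> r}" "convex {t :: real ^ 'n. t $ i \<ge> r}"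
    "convex {t :: real ^ 'n. t $ i < r}" "convex {t :: real ^ 'n. t $ i > r}"
    "convex {t :: real ^ 'n. t $ i = r}"
    "convex {t :: real ^ 'n. t $ i \<le> t $ j}" "convex {t :: real ^ 'n. t $ i < t $ j}"
    "convex {t :: real ^ 'n. t $ i = t $ j}"
proof -
  have eq: "t $ i - t $ j = inner (axis i 1 - axis j 1) t" "t $ i = inner (axis i 1) t"
    for t :: "real ^ 'n"
    by (simp_all add: inner_diff_left inner_axis')
  show diff: "convex {t :: real ^ 'n. t $ i - t $ j \<le> r}" "convex {t :: real ^ 'n. t $ i - t $ j < r}"
    "convex {t :: real ^ 'n. t $ i - t $ j = r}" for r
    unfolding eq(1) by (rule convex_halfspace_le convex_halfspace_lt convex_hyperplane)+
  show "convex {t :: real ^ 'n. t $ i \<le> t $ j}" "convex {t :: real ^ 'n. t $ i < t $ j}"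
    "convex {t :: real ^ 'n. t $ i = t $ j}"
    using diff[of 0] by simp_all
  show "convex {t :: real ^ 'n. t $ i \<le> r}" "convex {t :: real ^ 'n. t $ i \<ge> r}"
    "convex {t :: real ^ 'n. t $ i < r}" "convex {t :: real ^ 'n. t $ i > r}"
    "convex {t :: real ^ 'n. t $ i = r}"
    unfolding eq(2)
    by (rule convex_halfspace_le convex_halfspace_ge convex_halfspace_lt convex_halfspace_gt
        convex_hyperplane)+
qed

lemma convex_ordered_simplex: "convex (ordered_simplex a b c d)"
proof -
  have "ordered_simplex a b c d = {t. t $ a \<ge> 0} \<inter> {t. t $ a \<le> t $ b}
      \<inter> {t. t $ b \<le> t $ c} \<inter> {t. t $ c \<le> t $ d} \<inter> {t. t $ d \<le> 1}"
    by (auto simp: ordered_simplex_def)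
  then show ?thesis
    by (simp add: convex_Int convex_coordinate)
qed

lemma convex_triple_free: "convex (triple_free a b c d)"
proof -
  have "triple_free a b c d = {t. t $ b > 0} \<inter> {t. t $ c < 1} \<inter> {t. t $ d - t $ a < 1}
      \<inter> {t. t $ a < t $ c} \<inter> {t. t $ b < t $ d}"
    by (auto simp: triple_free_def)
  then show ?thesis
    by (simp add: convex_Int convex_coordinate)
qed

lemma angles_lift:
  assumes "p \<in> circle" "0 \<le> t $ i" "t $ i \<le> 1"
  shows "angles p (lift p t) i = (if t $ i = 1 then 0 else t $ i)"
  using angle_mult_cis_le[OF assms] by (simp add: angles_def lift_def)

text \<open>In a weakly ordered configuration the points between two equal ones are equal to them,
  so a triple coincidence always produces one of three consecutive points. The value 1 has to be
  identified with 0 because the base point sits at both ends of the interval.\<close>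

lemma lift_in_config_iff:
  assumes p: "p \<in> circle" and d: "distinct [a, b, c, d]" and t: "t \<in> ordered_simplex a b c d"
  shows "lift p t \<in> config p \<longleftrightarrow> t \<in> triple_free a b c d"
proof
  define \<theta> where "\<theta> = angles p (lift p t)"
  have \<theta>: "\<theta> i = (if t $ i = 1 then 0 else t $ i)" for i
    using angles_lift[OF p] ordered_simplex_bounds[OF d t] by (simp add: \<theta>_def)
  have ne: "a \<noteq> b" "a \<noteq> c" "a \<noteq> d" "b \<noteq> c" "b \<noteq> d" "c \<noteq> d"
    "b \<noteq> a" "c \<noteq> a" "d \<noteq> a" "c \<noteq> b" "d \<noteq> b" "d \<noteq> c"
    using d by auto
  have ts: "0 \<le> t $ a" "t $ a \<le> t $ b" "t $ b \<le> t $ c" "t $ c \<le> t $ d" "t $ d \<le> 1"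
    using t by (auto simp: ordered_simplex_def)
  {
    assume "lift p t \<in> config p"
    then have nt: "no_triple \<theta>"
      by (simp add: config_def \<theta>_def)
    have "0 < t $ b"
    proof (rule ccontr)
      assume "\<not> 0 < t $ b"
      then have "t $ a = 0" "t $ b = 0"
        using ts by linarith+
      then show False
        using no_tripleD(1)[OF nt ne(1)] ne by (simp add: \<theta>)
    qed
    moreover
    have "t $ c < 1"
    proof (rule ccontr)
      assume "\<not> t $ c < 1"
      then have "t $ c = 1" "t $ d = 1"
        using ts by linarith+
      then show False
        using no_tripleD(1)[OF nt ne(6)] ne by (simp add: \<theta>)
    qed
    moreover
    have "t $ d - t $ a < 1"
    proof (rule ccontr)
      assume "\<not> t $ d - t $ a < 1"
      then have "t $ a = 0" "t $ d = 1"
        using ts by linarith+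
      then show False
        using no_tripleD(1)[OF nt ne(3)] ne by (simp add: \<theta>)
    qed
    moreover
    have "t $ a < t $ c"
    proof (rule ccontr)
      assume "\<not> t $ a < t $ c"
      then have "t $ a = t $ c" "t $ b = t $ c"
        using ts by linarith+
      then have "\<theta> a = \<theta> b" "\<theta> b = \<theta> c"
        by (simp_all add: \<theta>)
      then show False
        using no_tripleD(2)[OF nt, of a b c] ne by simp
    qed
    moreover
    have "t $ b < t $ d"
    proof (rule ccontr)
      assume "\<not> t $ b < t $ d"
      then have "t $ b = t $ d" "t $ c = t $ d"
        using ts by linarith+
      then have "\<theta> b = \<theta> c" "\<theta> c = \<theta> d"
        by (simp_all add: \<theta>)
      then show False
        using no_tripleD(2)[OF nt, of b c d] ne by simp
    qed
    ultimately show "t \<in> triple_free a b c d"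
      by (simp add: triple_free_def)
  next
    assume "t \<in> triple_free a b c d"
    then have strict: "0 < t $ b" "t $ c < 1" "t $ d - t $ a < 1" "t $ a < t $ c" "t $ b < t $ d"
      by (auto simp: triple_free_def)
    have \<theta>0: "i = a \<and> t $ a = 0 \<or> i = d \<and> t $ d = 1" if "\<theta> i = 0" for i
      using label_cases[OF d, of i] that ts strict by (auto simp: \<theta> split: if_splits)
    have 1: "\<not> (\<theta> i = 0 \<and> \<theta> j = 0)" if "i \<noteq> j" for i j
      using \<theta>0[of i] \<theta>0[of j] that strict by auto
    have 2: "\<not> (\<theta> i = \<theta> j \<and> \<theta> j = \<theta> k)" if ijk: "distinct [i, j, k]" for i j k
    proof
      assume *: "\<theta> i = \<theta> j \<and> \<theta> j = \<theta> k"
      then have "\<theta> i \<noteq> 0" "\<theta> j \<noteq> 0" "\<theta> k \<noteq> 0"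
        using 1[of i j] ijk by auto
      with * have eq: "t $ i = t $ j" "t $ j = t $ k"
        by (auto simp: \<theta> split: if_splits)
      have "t $ a \<noteq> t $ c" "t $ b \<noteq> t $ d" "t $ a \<noteq> t $ d"
        using ts strict by linarith+
      \<comment> \<open>Three of the four labels include two that are not neighbours in the order
        \<open>a b c d\<close>, and those have different coordinates.\<close>
      moreover have "{a, c} \<subseteq> {i, j, k} \<or> {b, d} \<subseteq> {i, j, k} \<or> {a, d} \<subseteq> {i, j, k}"
        using label_cases[OF d, of i] label_cases[OF d, of j] label_cases[OF d, of k] ijk
        by (elim disjE; simp)
      moreover have "t $ x = t $ i" if "x \<in> {i, j, k}" for x
        using that eq by auto
      ultimately show False
        by (metis insert_subset)
    qed
    have "no_triple \<theta>"
      using 1 2 unfolding no_triple_def by blast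
    then show "lift p t \<in> config p"
      using p by (simp add: config_def flip: \<theta>_def) (simp add: lift_def norm_mult)
  }
qed

text \<open>A continuous map on a compact set is closed, and it stays closed after restriction to a
  full preimage. This replaces the usual compactness argument, since the cells themselves lack the
  points with triple coincidences and need not be compact.\<close>

lemma closed_map_imp_homeomorphic_saturated:
  fixes f :: "'a::euclidean_space \<Rightarrow> 'b::euclidean_space"
  assumes K: "compact K" and f: "continuous_on K f" and inj: "inj_on f {t \<in> K. f t \<in> Q}"
  shows "{t \<in> K. f t \<in> Q} homeomorphic (f ` K \<inter> Q)"
proof -
  have "\<exists>g. homeomorphism {t \<in> K. f t \<in> Q} (f ` K \<inter> Q) f g"
  proof (rule homeomorphism_injective_closed_map)
    show "continuous_on {t \<in> K. f t \<in> Q} f"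
      using f by (rule continuous_on_subset) auto
    show "f ` {t \<in> K. f t \<in> Q} = f ` K \<inter> Q"
      by auto
    fix U assume "closedin (top_of_set {t \<in> K. f t \<in> Q}) U"
    then obtain C where C: "closed C" "U = {t \<in> K. f t \<in> Q} \<inter> C"
      by (auto simp: closedin_closed)
    have "closed (f ` (K \<inter> C))"
      using K C f by (intro compact_imp_closed compact_continuous_image)
        (auto intro: continuous_on_subset compact_Int_closed)
    moreover have "f ` U = (f ` K \<inter> Q) \<inter> f ` (K \<inter> C)"
      by (auto simp: C(2))
    ultimately show "closedin (top_of_set (f ` K \<inter> Q)) (f ` U)"
      by (auto simp: closedin_closed)
  qed (use inj in blast)+
  then show ?thesis
    by (auto simp: homeomorphic_def)
qed

text \<open>Only the values 0 and 1 of a coordinate have the same image. Without triples the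
  coordinates of \<open>a\<close>, \<open>b\<close>, \<open>c\<close> are never 1 and that of
  \<open>d\<close> is never 0.\<close>

lemma inj_on_lift:
  assumes p: "p \<in> circle" and d: "distinct [a, b, c, d]"
  shows "inj_on (lift p) (ordered_simplex a b c d \<inter> triple_free a b c d)"
proof (rule inj_onI)
  fix t u
  assume t: "t \<in> ordered_simplex a b c d \<inter> triple_free a b c d"
    and u: "u \<in> ordered_simplex a b c d \<inter> triple_free a b c d" and eq: "lift p t = lift p u"
  have "(if t $ i = 1 then 0 else t $ i) = (if u $ i = 1 then 0 else u $ i)" for i
    using angles_lift[OF p, of t i] angles_lift[OF p, of u i] eq
      ordered_simplex_bounds[OF d, of t i] ordered_simplex_bounds[OF d, of u i] t u by simp
  moreover have "t $ i \<noteq> 1 \<and> u $ i \<noteq> 1 \<or> t $ i \<noteq> 0 \<and> u $ i \<noteq> 0" for i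
    using label_cases[OF d, of i] t u by (auto simp: ordered_simplex_def triple_free_def)
  ultimately have "t $ i = u $ i" for i
    by (smt (verit))
  then show "t = u"
    by (simp add: vec_eq_iff)
qed

lemma ex_lift:
  assumes p: "p \<in> circle" and d: "distinct [a, b, c, d]" and x: "x \<in> config p"
    and s: "sorted_from_base (angles p x) a b c d"
  shows "\<exists>t\<in>ordered_simplex a b c d. lift p t = x"
proof
  define \<theta> where "\<theta> = angles p x"
  \<comment> \<open>A last point at the base point has angle 0 but must be lifted to 1 in order to
    stay last.\<close>
  define t :: "real ^ label" where "t = (\<chi> i. if i = d \<and> \<theta> d = 0 then 1 else \<theta> i)"
  have \<theta>: "0 \<le> \<theta> i" "\<theta> i < 1" for i
    by (simp_all add: \<theta>_def angles_def angle_bounds)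
  then have "\<theta> i \<le> 1" for i
    using less_imp_le by blast
  with \<theta> s d show "t \<in> ordered_simplex a b c d"
    by (auto simp: t_def ordered_simplex_def sorted_from_base_def simp flip: \<theta>_def)
  have "p * cis (2 * pi * t $ i) = x $ i" for i
  proof -
    have "cis (2 * pi * t $ i) = cis (2 * pi * \<theta> i)"
      by (auto simp: t_def)
    moreover have "x $ i = p * cis (2 * pi * \<theta> i)"
      using angle_cis[OF p, of "x $ i"] x by (simp add: config_def \<theta>_def angles_def)
    ultimately show ?thesis
      by simp
  qed
  then show "lift p t = x"
    by (simp add: lift_def vec_eq_iff)
qed

definition closed_cell :: "complex \<Rightarrow> nat set \<Rightarrow> (complex ^ label) set" where
  "closed_cell p J = {x \<in> config p. J \<subseteq> chambers (angles p x)}"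

text \<open>A cell is described inside one of its chambers, \<open>a b c d\<close>: there the other
  chambers of \<open>J\<close> amount to the closed convex conditions \<open>E\<close>, and the lift
  maps the resulting convex set homeomorphically onto the cell.\<close>

lemma closed_cell_convex_model:
  assumes p: "p \<in> circle" and d: "distinct [a, b, c, d]" and J: "code a b c d \<in> J"
    and E: "closed E" "convex E"
    and JE: "\<And>t. t \<in> ordered_simplex a b c d \<inter> triple_free a b c d \<Longrightarrow>
      J \<subseteq> chambers (\<lambda>i. if t $ i = 1 then 0 else t $ i) \<longleftrightarrow> t \<in> E"
    and ne: "ordered_simplex a b c d \<inter> triple_free a b c d \<inter> E \<noteq> {}"
  shows "closedin (top_of_set (config p)) (closed_cell p J) \<and> AR (closed_cell p J)"
proof -
  define K where "K = ordered_simplex a b c d \<inter> E"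
  have K: "compact K"
    unfolding K_def using compact_ordered_simplex[OF d] E by (simp add: compact_Int_closed)
  have sat: "{t \<in> K. lift p t \<in> config p} = ordered_simplex a b c d \<inter> triple_free a b c d \<inter> E"
    using lift_in_config_iff[OF p d] by (auto simp: K_def)
  have red: "angles p (lift p t) = (\<lambda>i. if t $ i = 1 then 0 else t $ i)"
    if "t \<in> ordered_simplex a b c d" for t
    using angles_lift[OF p] ordered_simplex_bounds[OF d that] by auto
  have eq: "closed_cell p J = lift p ` K \<inter> config p"
  proof
    show "closed_cell p J \<subseteq> lift p ` K \<inter> config p"
    proof
      fix x assume x: "x \<in> closed_cell p J"
      then have xc: "x \<in> config p" and "sorted_from_base (angles p x) a b c d"
        using J code_in_chambers[OF d] by (auto simp: closed_cell_def)
      then obtain t where t: "t \<in> ordered_simplex a b c d" "lift p t = x"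
        using ex_lift[OF p d] by blast
      then have "t \<in> ordered_simplex a b c d \<inter> triple_free a b c d"
        using lift_in_config_iff[OF p d t(1)] xc by simp
      moreover have "J \<subseteq> chambers (\<lambda>i. if t $ i = 1 then 0 else t $ i)"
        using x red[OF t(1)] t(2) by (simp add: closed_cell_def)
      ultimately have "t \<in> E"
        using JE by simp
      then show "x \<in> lift p ` K \<inter> config p"
        using t xc by (auto simp: K_def)
    qed
    show "lift p ` K \<inter> config p \<subseteq> closed_cell p J"
    proof clarify
      fix t assume t: "t \<in> K" and xc: "lift p t \<in> config p"
      then have t': "t \<in> ordered_simplex a b c d \<inter> triple_free a b c d" "t \<in> E"
        using lift_in_config_iff[OF p d] by (auto simp: K_def)
      then show "lift p t \<in> closed_cell p J"
        using JE[OF t'(1)] red[of t] xc by (simp add: closed_cell_def)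
    qed
  qed
  have "closed (lift p ` K)"
    by (intro compact_imp_closed compact_continuous_image continuous_on_lift K)
  then have "closedin (top_of_set (config p)) (closed_cell p J)"
    unfolding eq Int_commute[of _ "config p"] by (rule closedin_closed_Int)
  moreover have "AR {t \<in> K. lift p t \<in> config p}"
    unfolding sat using ne
    by (intro convex_imp_AR convex_Int convex_ordered_simplex convex_triple_free E)
  moreover have "{t \<in> K. lift p t \<in> config p} homeomorphic (lift p ` K \<inter> config p)"
  proof (rule closed_map_imp_homeomorphic_saturated[OF K continuous_on_lift])
    show "inj_on (lift p) {t \<in> K. lift p t \<in> config p}"
      unfolding sat using inj_on_lift[OF p d] by (rule inj_on_subset) auto
  qed
  ultimately show ?thesis
    unfolding eq using homeomorphic_AR_iff_AR by blast
qed

text \<open>For each kind of cell, \<open>E\<close> is the face of the simplex on which the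
  coincidences of that kind take place.\<close>

lemma closed_cell_closedin_AR:
  assumes p: "p \<in> circle" and J: "J \<in> cells"
  shows "closedin (top_of_set (config p)) (closed_cell p J) \<and> AR (closed_cell p J)"
  using J
proof cases
  case (1 a b c d)
  have ne: "a \<noteq> b" "a \<noteq> c" "a \<noteq> d" "b \<noteq> c" "b \<noteq> d" "c \<noteq> d"
    using 1(2) by auto
  show ?thesis
  proof (rule closed_cell_convex_model[OF p 1(2), where E = "UNIV"])
    show "closed (UNIV :: (real ^ label) set)"
      by (intro closed_UNIV closed_Int closed_Collect_eq continuous_intros)
    show "convex (UNIV :: (real ^ label) set)"
      by (intro convex_UNIV convex_Int convex_coordinate)
    fix t assume "t \<in> ordered_simplex a b c d \<inter> triple_free a b c d"
    then show "J \<subseteq> chambers (\<lambda>i. if t $ i = 1 then 0 else t $ i) \<longleftrightarrow> t \<in> UNIV"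
      using ne unfolding 1(1)
      by (auto simp: code_in_chambers sorted_from_base_def ordered_simplex_def triple_free_def)
  next
    \<comment> \<open>Here and in the other cases the witness spaces the distinct points, the base
      point among them, evenly around the circle.\<close>
    have "(\<chi> i. if i = a then 1/5 else if i = b then 2/5 else if i = c then 3/5 else 4/5)
      \<in> ordered_simplex a b c d \<inter> triple_free a b c d \<inter> (UNIV)"
      using ne by (auto simp: ordered_simplex_def triple_free_def)
    then show "ordered_simplex a b c d \<inter> triple_free a b c d \<inter> (UNIV) \<noteq> {}"
      by blast
  qed (simp add: 1(1))
next
  case (2 a b c d)
  have ne: "a \<noteq> b" "a \<noteq> c" "a \<noteq> d" "b \<noteq> c" "b \<noteq> d" "c \<noteq> d"
    using 2(2) by auto
  show ?thesis
  proof (rule closed_cell_convex_model[OF p 2(2), where E = "{t. t $ a = t $ b}"])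
    show "closed ({t. t $ a = t $ b} :: (real ^ label) set)"
      by (intro closed_UNIV closed_Int closed_Collect_eq continuous_intros)
    show "convex ({t. t $ a = t $ b} :: (real ^ label) set)"
      by (intro convex_UNIV convex_Int convex_coordinate)
    fix t assume "t \<in> ordered_simplex a b c d \<inter> triple_free a b c d"
    then show "J \<subseteq> chambers (\<lambda>i. if t $ i = 1 then 0 else t $ i) \<longleftrightarrow> t \<in> {t. t $ a = t $ b}"
      using ne unfolding 2(1)
      by (auto simp: code_in_chambers sorted_from_base_def ordered_simplex_def triple_free_def)
  next
    have "(\<chi> i. if i = a then 1/4 else if i = b then 1/4 else if i = c then 2/4 else 3/4)
      \<in> ordered_simplex a b c d \<inter> triple_free a b c d \<inter> ({t. t $ a = t $ b})"
      using ne by (auto simp: ordered_simplex_def triple_free_def)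
    then show "ordered_simplex a b c d \<inter> triple_free a b c d \<inter> ({t. t $ a = t $ b}) \<noteq> {}"
      by blast
  qed (simp add: 2(1))
next
  case (3 a b c d)
  have ne: "a \<noteq> b" "a \<noteq> c" "a \<noteq> d" "b \<noteq> c" "b \<noteq> d" "c \<noteq> d"
    using 3(2) by auto
  show ?thesis
  proof (rule closed_cell_convex_model[OF p 3(2), where E = "{t. t $ b = t $ c}"])
    show "closed ({t. t $ b = t $ c} :: (real ^ label) set)"
      by (intro closed_UNIV closed_Int closed_Collect_eq continuous_intros)
    show "convex ({t. t $ b = t $ c} :: (real ^ label) set)"
      by (intro convex_UNIV convex_Int convex_coordinate)
    fix t assume "t \<in> ordered_simplex a b c d \<inter> triple_free a b c d"
    then show "J \<subseteq> chambers (\<lambda>i. if t $ i = 1 then 0 else t $ i) \<longleftrightarrow> t \<in> {t. t $ b = t $ c}"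
      using ne unfolding 3(1)
      by (auto simp: code_in_chambers sorted_from_base_def ordered_simplex_def triple_free_def)
  next
    have "(\<chi> i. if i = a then 1/4 else if i = b then 2/4 else if i = c then 2/4 else 3/4)
      \<in> ordered_simplex a b c d \<inter> triple_free a b c d \<inter> ({t. t $ b = t $ c})"
      using ne by (auto simp: ordered_simplex_def triple_free_def)
    then show "ordered_simplex a b c d \<inter> triple_free a b c d \<inter> ({t. t $ b = t $ c}) \<noteq> {}"
      by blast
  qed (simp add: 3(1))
next
  case (4 a b c d)
  have ne: "a \<noteq> b" "a \<noteq> c" "a \<noteq> d" "b \<noteq> c" "b \<noteq> d" "c \<noteq> d"
    using 4(2) by auto
  show ?thesis
  proof (rule closed_cell_convex_model[OF p 4(2), where E = "{t. t $ c = t $ d}"])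
    show "closed ({t. t $ c = t $ d} :: (real ^ label) set)"
      by (intro closed_UNIV closed_Int closed_Collect_eq continuous_intros)
    show "convex ({t. t $ c = t $ d} :: (real ^ label) set)"
      by (intro convex_UNIV convex_Int convex_coordinate)
    fix t assume "t \<in> ordered_simplex a b c d \<inter> triple_free a b c d"
    then show "J \<subseteq> chambers (\<lambda>i. if t $ i = 1 then 0 else t $ i) \<longleftrightarrow> t \<in> {t. t $ c = t $ d}"
      using ne unfolding 4(1)
      by (auto simp: code_in_chambers sorted_from_base_def ordered_simplex_def triple_free_def)
  next
    have "(\<chi> i. if i = a then 1/4 else if i = b then 2/4 else if i = c then 3/4 else 3/4)
      \<in> ordered_simplex a b c d \<inter> triple_free a b c d \<inter> ({t. t $ c = t $ d})"
      using ne by (auto simp: ordered_simplex_def triple_free_def)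
    then show "ordered_simplex a b c d \<inter> triple_free a b c d \<inter> ({t. t $ c = t $ d}) \<noteq> {}"
      by blast
  qed (simp add: 4(1))
next
  case (5 a b c d)
  have ne: "a \<noteq> b" "a \<noteq> c" "a \<noteq> d" "b \<noteq> c" "b \<noteq> d" "c \<noteq> d"
    using 5(2) by auto
  show ?thesis
  proof (rule closed_cell_convex_model[OF p 5(2), where E = "{t. t $ a = 0}"])
    show "closed ({t. t $ a = 0} :: (real ^ label) set)"
      by (intro closed_UNIV closed_Int closed_Collect_eq continuous_intros)
    show "convex ({t. t $ a = 0} :: (real ^ label) set)"
      by (intro convex_UNIV convex_Int convex_coordinate)
    fix t assume "t \<in> ordered_simplex a b c d \<inter> triple_free a b c d"
    then show "J \<subseteq> chambers (\<lambda>i. if t $ i = 1 then 0 else t $ i) \<longleftrightarrow> t \<in> {t. t $ a = 0}"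
      using ne unfolding 5(1)
      by (auto simp: code_in_chambers sorted_from_base_def ordered_simplex_def triple_free_def)
  next
    have "(\<chi> i. if i = a then 0 else if i = b then 1/4 else if i = c then 2/4 else 3/4)
      \<in> ordered_simplex a b c d \<inter> triple_free a b c d \<inter> ({t. t $ a = 0})"
      using ne by (auto simp: ordered_simplex_def triple_free_def)
    then show "ordered_simplex a b c d \<inter> triple_free a b c d \<inter> ({t. t $ a = 0}) \<noteq> {}"
      by blast
  qed (simp add: 5(1))
next
  case (6 a b c d)
  have ne: "a \<noteq> b" "a \<noteq> c" "a \<noteq> d" "b \<noteq> c" "b \<noteq> d" "c \<noteq> d"
    using 6(2) by auto
  show ?thesis
  proof (rule closed_cell_convex_model[OF p 6(2), where E = "{t. t $ a = t $ b} \<inter> {t. t $ c = t $ d}"])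
    show "closed ({t. t $ a = t $ b} \<inter> {t. t $ c = t $ d} :: (real ^ label) set)"
      by (intro closed_UNIV closed_Int closed_Collect_eq continuous_intros)
    show "convex ({t. t $ a = t $ b} \<inter> {t. t $ c = t $ d} :: (real ^ label) set)"
      by (intro convex_UNIV convex_Int convex_coordinate)
    fix t assume "t \<in> ordered_simplex a b c d \<inter> triple_free a b c d"
    then show "J \<subseteq> chambers (\<lambda>i. if t $ i = 1 then 0 else t $ i) \<longleftrightarrow> t \<in> {t. t $ a = t $ b} \<inter> {t. t $ c = t $ d}"
      using ne unfolding 6(1)
      by (auto simp: code_in_chambers sorted_from_base_def ordered_simplex_def triple_free_def)
  next
    have "(\<chi> i. if i = a then 1/3 else if i = b then 1/3 else if i = c then 2/3 else 2/3)
      \<in> ordered_simplex a b c d \<inter> triple_free a b c d \<inter> ({t. t $ a = t $ b} \<inter> {t. t $ c = t $ d})"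
      using ne by (auto simp: ordered_simplex_def triple_free_def)
    then show "ordered_simplex a b c d \<inter> triple_free a b c d \<inter> ({t. t $ a = t $ b} \<inter> {t. t $ c = t $ d}) \<noteq> {}"
      by blast
  qed (simp add: 6(1))
next
  case (7 a b c d)
  have ne: "a \<noteq> b" "a \<noteq> c" "a \<noteq> d" "b \<noteq> c" "b \<noteq> d" "c \<noteq> d"
    using 7(2) by auto
  show ?thesis
  proof (rule closed_cell_convex_model[OF p 7(2), where E = "{t. t $ a = 0} \<inter> {t. t $ b = t $ c}"])
    show "closed ({t. t $ a = 0} \<inter> {t. t $ b = t $ c} :: (real ^ label) set)"
      by (intro closed_UNIV closed_Int closed_Collect_eq continuous_intros)
    show "convex ({t. t $ a = 0} \<inter> {t. t $ b = t $ c} :: (real ^ label) set)"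
      by (intro convex_UNIV convex_Int convex_coordinate)
    fix t assume "t \<in> ordered_simplex a b c d \<inter> triple_free a b c d"
    then show "J \<subseteq> chambers (\<lambda>i. if t $ i = 1 then 0 else t $ i) \<longleftrightarrow> t \<in> {t. t $ a = 0} \<inter> {t. t $ b = t $ c}"
      using ne unfolding 7(1)
      by (auto simp: code_in_chambers sorted_from_base_def ordered_simplex_def triple_free_def)
  next
    have "(\<chi> i. if i = a then 0 else if i = b then 1/3 else if i = c then 1/3 else 2/3)
      \<in> ordered_simplex a b c d \<inter> triple_free a b c d \<inter> ({t. t $ a = 0} \<inter> {t. t $ b = t $ c})"
      using ne by (auto simp: ordered_simplex_def triple_free_def)
    then show "ordered_simplex a b c d \<inter> triple_free a b c d \<inter> ({t. t $ a = 0} \<inter> {t. t $ b = t $ c}) \<noteq> {}"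
      by blast
  qed (simp add: 7(1))
next
  case (8 a b c d)
  have ne: "a \<noteq> b" "a \<noteq> c" "a \<noteq> d" "b \<noteq> c" "b \<noteq> d" "c \<noteq> d"
    using 8(2) by auto
  show ?thesis
  proof (rule closed_cell_convex_model[OF p 8(2), where E = "{t. t $ a = 0} \<inter> {t. t $ c = t $ d}"])
    show "closed ({t. t $ a = 0} \<inter> {t. t $ c = t $ d} :: (real ^ label) set)"
      by (intro closed_UNIV closed_Int closed_Collect_eq continuous_intros)
    show "convex ({t. t $ a = 0} \<inter> {t. t $ c = t $ d} :: (real ^ label) set)"
      by (intro convex_UNIV convex_Int convex_coordinate)
    fix t assume "t \<in> ordered_simplex a b c d \<inter> triple_free a b c d"
    then show "J \<subseteq> chambers (\<lambda>i. if t $ i = 1 then 0 else t $ i) \<longleftrightarrow> t \<in> {t. t $ a = 0} \<inter> {t. t $ c = t $ d}"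
      using ne unfolding 8(1)
      by (auto simp: code_in_chambers sorted_from_base_def ordered_simplex_def triple_free_def)
  next
    have "(\<chi> i. if i = a then 0 else if i = b then 1/3 else if i = c then 2/3 else 2/3)
      \<in> ordered_simplex a b c d \<inter> triple_free a b c d \<inter> ({t. t $ a = 0} \<inter> {t. t $ c = t $ d})"
      using ne by (auto simp: ordered_simplex_def triple_free_def)
    then show "ordered_simplex a b c d \<inter> triple_free a b c d \<inter> ({t. t $ a = 0} \<inter> {t. t $ c = t $ d}) \<noteq> {}"
      by blast
  qed (simp add: 8(1))
qed

lemma finite_cells: "finite cells"
proof (rule finite_subset)
  have "code a b c d < 10000" for a b c d
    using num_bounds[of a] num_bounds[of b] num_bounds[of c] num_bounds[of d]
    unfolding code_def by linarith
  then show "cells \<subseteq> Pow {..<10000}"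
    by (auto elim!: cells.cases)
qed simp

text \<open>A cell is encoded by the set of closed chambers containing it, so smaller cells are larger
  sets.\<close>

typedef cell = cells
  by (rule exI[of _ "{code L1 L2 L3 L4}"]) (simp add: cells.intros)

instantiation cell :: order
begin

definition less_eq_cell :: "cell \<Rightarrow> cell \<Rightarrow> bool" where
  "less_eq_cell x y \<longleftrightarrow> Rep_cell y \<subseteq> Rep_cell x"

definition less_cell :: "cell \<Rightarrow> cell \<Rightarrow> bool" where
  "less_cell x y \<longleftrightarrow> x \<le> y \<and> \<not> y \<le> (x :: cell)"

instance
  by standard (auto simp: less_eq_cell_def less_cell_def Rep_cell_inject)

end

instance cell :: finite
proof
  have "inj_on Rep_cell UNIV" "Rep_cell ` UNIV \<subseteq> cells"
    using Rep_cell by (auto simp: inj_on_def Rep_cell_inject)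
  then show "finite (UNIV :: cell set)"
    using finite_cells inj_on_finite by blast
qed

text \<open>The least index at a configuration is the cell formed by all closed chambers through
  it.\<close>

theorem AR_cover_config:
  assumes p: "p \<in> circle"
  shows "AR_cover UNIV (config p) (\<lambda>c :: cell. closed_cell p (Rep_cell c))"
  unfolding AR_cover_def
proof (intro conjI ballI)
  fix c :: cell
  show "closedin (top_of_set (config p)) (closed_cell p (Rep_cell c))" "AR (closed_cell p (Rep_cell c))"
    using closed_cell_closedin_AR[OF p Rep_cell] by blast+
next
  fix x assume x: "x \<in> config p"
  then have "chambers (angles p x) \<in> cells"
    by (intro chambers_in_cells) (simp_all add: config_def angles_def angle_bounds)
  then have "Rep_cell (Abs_cell (chambers (angles p x))) = chambers (angles p x)"
    by (rule Abs_cell_inverse)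
  then show "\<exists>k\<in>UNIV. \<forall>c\<in>UNIV. (x \<in> closed_cell p (Rep_cell c)) = (k \<le> c)"
    using x by (intro bexI[of _ "Abs_cell (chambers (angles p x))"])
      (auto simp: closed_cell_def less_eq_cell_def)
qed simp

section \<open>From the torus to vectors indexed by labels\<close>

lemma config_iff:
  assumes p: "p \<in> circle"
  shows "x \<in> config p \<longleftrightarrow> (\<forall>i. x $ i \<in> circle) \<and> (\<forall>i j. i \<noteq> j \<longrightarrow> \<not> (x $ i = p \<and> x $ j = p)) \<and>
     (\<forall>i j k. distinct [i, j, k] \<longrightarrow> \<not> (x $ i = x $ j \<and> x $ j = x $ k))"
proof (cases "\<forall>i. x $ i \<in> circle")
  case True
  then have "angles p x i = 0 \<longleftrightarrow> x $ i = p" "angles p x i = angles p x j \<longleftrightarrow> x $ i = x $ j" for i j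
    using angle_eq_0_iff[OF p] angle_eq_iff[OF p] by (auto simp: angles_def)
  with True show ?thesis
    unfolding config_def no_triple_def by simp
qed (auto simp: config_def)

definition of_index :: "nat \<Rightarrow> label" where
  "of_index n = (THE i. num i = n)"

lemma of_index_num [simp]: "of_index (num i) = i"
  by (auto simp: of_index_def)

lemma num_of_index: "n \<in> {1..4} \<Longrightarrow> num (of_index n) = n"
  using num_surj by (metis of_index_num)

lemma Q_space_homeomorphic_config:
  assumes p: "p \<in> circle"
  shows "Q_space p 5 homeomorphic_space top_of_set (config p)"
proof -
  define f :: "(nat \<Rightarrow> complex) \<Rightarrow> complex ^ label" where "f x = (\<chi> i. x (num i))" for x
  define g :: "complex ^ label \<Rightarrow> nat \<Rightarrow> complex" where "g y = (\<lambda>n\<in>{1..4}. y $ of_index n)" for y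
  have num_mem: "num i \<in> {1..4}" for i
    using num_bounds[of i] by simp
  have torus: "topspace (torus 5) = {1..4} \<rightarrow>\<^sub>E circle"
    by (simp add: torus_def)
  have fg: "f (g y) = y" for y
    using num_mem by (simp add: f_def g_def vec_eq_iff)
  have gf: "g (f x) = x" if "x \<in> topspace (torus 5)" for x
  proof
    fix n
    show "g (f x) n = x n"
      using that num_of_index[of n] by (auto simp: torus f_def g_def PiE_def extensional_def)
  qed
  have wb: "with_base p 5 (g y) n = (if n = 5 then p else if n \<in> {1..4} then y $ of_index n else undefined)" for y n
    by (auto simp: with_base_def g_def)
  have Q: "g y \<in> topspace (Q_space p 5) \<longleftrightarrow> y \<in> config p" for y
  proof -
    have top: "g y \<in> topspace (torus 5) \<longleftrightarrow> (\<forall>i. y $ i \<in> circle)"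
    proof
      assume "g y \<in> topspace (torus 5)"
      then have "f (g y) $ i \<in> circle" for i
        using num_mem[of i] by (auto simp: torus f_def PiE_def Pi_def)
      then show "\<forall>i. y $ i \<in> circle"
        by (simp add: fg)
    qed (auto simp: torus g_def)
    have "g y \<in> triple_arrangement p 5 \<longleftrightarrow> (\<exists>i j k. 1 \<le> i \<and> i < j \<and> j < k \<and> k \<le> 5 \<and>
        with_base p 5 (g y) i = with_base p 5 (g y) j \<and> with_base p 5 (g y) j = with_base p 5 (g y) k)"
      if "g y \<in> topspace (torus 5)"
      using that unfolding triple_arrangement_def triple_diagonal_def by blast
    moreover have "(\<exists>i j k. 1 \<le> i \<and> i < j \<and> j < k \<and> k \<le> 5 \<and>
        with_base p 5 (g y) i = with_base p 5 (g y) j \<and> with_base p 5 (g y) j = with_base p 5 (g y) k)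
      \<longleftrightarrow> (\<exists>i j. i \<noteq> j \<and> y $ i = p \<and> y $ j = p) \<or>
        (\<exists>i j k. distinct [i, j, k] \<and> y $ i = y $ j \<and> y $ j = y $ k)"
      (is "?L \<longleftrightarrow> ?R")
    proof
      assume ?L
      then obtain i j k :: nat where ijk: "1 \<le> i" "i < j" "j < k" "k \<le> 5"
        "with_base p 5 (g y) i = with_base p 5 (g y) j" "with_base p 5 (g y) j = with_base p 5 (g y) k"
        by blast
      have "of_index i \<noteq> of_index j"
        using ijk num_of_index[of i] num_of_index[of j] by auto
      show ?R
      \<comment> \<open>As the indices increase and are at most 5, only the last of them can belong
        to the base point.\<close>
      proof (cases "k = 5")
        case True
        then show ?thesis
          using ijk \<open>of_index i \<noteq> of_index j\<close> by (auto simp: wb)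
      next
        case False
        then have "distinct [of_index i, of_index j, of_index k]"
          using ijk num_of_index[of i] num_of_index[of j] num_of_index[of k] by auto
        moreover have "y $ of_index i = y $ of_index j" "y $ of_index j = y $ of_index k"
          using ijk False by (auto simp: wb)
        ultimately show ?thesis
          by blast
      qed
    next
      assume ?R
      then show ?L
      proof (elim disjE exE conjE)
        fix i j assume ij: "i \<noteq> j" "y $ i = p" "y $ j = p"
        define m n where "m = min (num i) (num j)" and "n = max (num i) (num j)"
        have "1 \<le> m" "m < n" "n < 5" "y $ of_index m = p" "y $ of_index n = p"
          using ij num_bounds[of i] num_bounds[of j] num_eq_iff[of i j]
          by (auto simp: m_def n_def min_def max_def simp del: num_eq_iff)
        then show ?L
          by (intro exI[of _ m] exI[of _ n] exI[of _ 5]) (simp add: wb)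
      next
        fix i j k assume ijk: "distinct [i, j, k]" "y $ i = y $ j" "y $ j = y $ k"
        define xs where "xs = sort [num i, num j, num k]"
        have "length xs = 3" "distinct xs" "sorted xs" and set: "set xs = {num i, num j, num k}"
          using ijk(1) by (auto simp: xs_def)
        then obtain l m n where xs: "xs = [l, m, n]" "l < m" "m < n"
          by (auto simp: numeral_eq_Suc length_Suc_conv)
        have range: "y $ of_index q = y $ i \<and> 1 \<le> q \<and> q < 5" if "q \<in> {l, m, n}" for q
        proof -
          have "{l, m, n} = {num i, num j, num k}"
            using set by (simp add: xs)
          with that have "q \<in> {num i, num j, num k}"
            by (simp only:)
          then show ?thesis
            using ijk num_bounds[of i] num_bounds[of j] num_bounds[of k] by auto
        qed
        show ?L
          using xs range[of l] range[of m] range[of n] by (intro exI[of _ l] exI[of _ m] exI[of _ n]) (auto simp: wb)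
      qed
    qed
    ultimately have "g y \<in> triple_arrangement p 5 \<longleftrightarrow> ((\<exists>i j. i \<noteq> j \<and> y $ i = p \<and> y $ j = p) \<or>
        (\<exists>i j k. distinct [i, j, k] \<and> y $ i = y $ j \<and> y $ j = y $ k))"
      if "g y \<in> topspace (torus 5)"
      using that by (simp only:)
    moreover have "y \<in> config p \<longleftrightarrow> (\<forall>i. y $ i \<in> circle) \<and> \<not> ((\<exists>i j. i \<noteq> j \<and> y $ i = p \<and> y $ j = p) \<or>
        (\<exists>i j k. distinct [i, j, k] \<and> y $ i = y $ j \<and> y $ j = y $ k))"
      unfolding config_iff[OF p] by blast
    moreover have "g y \<in> topspace (Q_space p 5) \<longleftrightarrow> g y \<in> topspace (torus 5) \<and> g y \<notin> triple_arrangement p 5"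
      by (auto simp: Q_space_def)
    ultimately show ?thesis
      using top by (metis (no_types))
  qed
  have contf: "continuous_map (torus 5) euclidean f"
  proof -
    have "f = (\<lambda>x. \<Sum>i\<in>UNIV. axis i (x (num i)))"
      by (simp add: fun_eq_iff f_def vec_eq_iff axis_def if_distrib cong: if_cong)
    moreover have "continuous_map (torus 5) euclidean (\<lambda>x. \<Sum>i\<in>UNIV. axis i (x (num i)))"
    proof (intro continuous_map_sum)
      fix i :: label
      have "continuous_map (torus 5) (top_of_set circle) (\<lambda>x. x (num i))"
        unfolding torus_def using num_mem[of i] by (intro continuous_map_product_projection) simp
      then have 1: "continuous_map (torus 5) euclidean (\<lambda>x. x (num i))"
        by (simp add: continuous_map_in_subtopology)
      have "continuous_on UNIV (\<lambda>z :: complex. axis i z)"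
        unfolding axis_def
      proof (intro continuous_on_vec_lambda)
        show "continuous_on UNIV (\<lambda>z :: complex. if j = i then z else 0)" for j
          by (cases "j = i") simp_all
      qed
      then have "continuous_map euclidean euclidean (\<lambda>z :: complex. axis i z)"
        by simp
      from continuous_map_compose[OF 1 this]
      show "continuous_map (torus 5) euclidean (\<lambda>x. axis i (x (num i)))"
        by (simp add: o_def)
    qed simp
    ultimately show ?thesis
      by simp
  qed
  have cf: "continuous_map (Q_space p 5) (top_of_set (config p)) f"
    unfolding continuous_map_in_subtopology
  proof
    show "f \<in> topspace (Q_space p 5) \<rightarrow> config p"
    proof
      fix x assume x: "x \<in> topspace (Q_space p 5)"
      then have "g (f x) = x"
        by (intro gf) (simp add: Q_space_def)
      with x show "f x \<in> config p"
        using Q[of "f x"] by simp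
    qed
  qed (simp add: contf Q_space_def continuous_map_from_subtopology)
  have cg: "continuous_map (top_of_set (config p)) (Q_space p 5) g"
    unfolding Q_space_def continuous_map_in_subtopology
  proof
    show "continuous_map (top_of_set (config p)) (torus 5) g"
      unfolding torus_def continuous_map_componentwise
    proof (intro conjI ballI)
      show "g ` topspace (top_of_set (config p)) \<subseteq> extensional {1..5 - 1}"
        by (auto simp: g_def)
      fix n :: nat assume "n \<in> {1..5 - 1}"
      then have "g y n = y $ of_index n" for y
        by (simp add: g_def)
      then show "continuous_map (top_of_set (config p)) (top_of_set circle) (\<lambda>y. g y n)"
        by (auto simp: continuous_map_in_subtopology config_def intro!: continuous_intros)
    qed
    show "g \<in> topspace (top_of_set (config p)) \<rightarrow> topspace (torus 5) - triple_arrangement p 5"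
      using Q by (auto simp: Q_space_def)
  qed
  show ?thesis
    unfolding homeomorphic_space_def homeomorphic_maps_def
    using cf cg fg gf by (auto simp: Q_space_def)
qed

section \<open>The 16-gon with glued sides\<close>

text \<open>Two adjacent closed intervals together contain a neighbourhood of each point of the
  half-open right one. Both parametrisations of the boundary are defined side by side and need
  this.\<close>

lemma continuous_on_UNIV_if_unit_intervals:
  fixes f :: "real \<Rightarrow> 'a::topological_space"
  assumes "\<And>k :: int. continuous_on {of_int k..of_int k + 1} f"
  shows "continuous_on UNIV f"
proof -
  have "isCont f s" for s
  proof -
    define k where "k = \<lfloor>s\<rfloor>"
    have "continuous_on ({of_int (k - 1)..of_int k} \<union> {of_int k..of_int k + 1}) f"
      using assms[of "k - 1"] assms[of k] by (intro continuous_on_closed_Un) auto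
    then have "continuous_on {of_int k - 1<..<of_int k + 1} f"
      by (rule continuous_on_subset) auto
    moreover have "s \<in> {of_int k - 1<..<of_int k + 1}"
      using of_int_floor_le[of s] floor_correct[of s] unfolding k_def greaterThanLessThan_iff by linarith
    ultimately show ?thesis
      by (simp add: continuous_on_eq_continuous_at)
  qed
  then show ?thesis
    by (simp add: continuous_at_imp_continuous_on)
qed

text \<open>Sides \<open>k\<close> and \<open>partner k\<close> of the 16-gon carry the letter \<open>letter k\<close>, with opposite
  directions.\<close>

definition letter :: "nat \<Rightarrow> nat" where
  "letter k = 2 * (k div 4) + k mod 2"

definition partner :: "nat \<Rightarrow> nat" where
  "partner k = (if k mod 4 < 2 then k + 2 else k - 2)"

definition direction :: "nat \<Rightarrow> real" where
  "direction k = (if k mod 4 < 2 then 1 else -1)"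

lemma nat_mod4_cases:
  obtains j :: nat where "k = 4 * j" | j where "k = 4 * j + 1" | j where "k = 4 * j + 2" | j where "k = 4 * j + 3"
proof -
  have "k = 4 * (k div 4) + k mod 4"
    by simp
  moreover have "k mod 4 = 0 \<or> k mod 4 = 1 \<or> k mod 4 = 2 \<or> k mod 4 = 3"
    by presburger
  ultimately show thesis
    using that by (metis add.right_neutral)
qed

lemma letter_eq:
  "letter (4 * j) = 2 * j" "letter (4 * j + 1) = 2 * j + 1"
  "letter (4 * j + 2) = 2 * j" "letter (4 * j + 3) = 2 * j + 1"
  unfolding letter_def by presburger+

lemma mod4_eq:
  fixes j :: nat
  shows "4 * j mod 4 = 0" "(4 * j + 1) mod 4 = 1" "(4 * j + 2) mod 4 = 2" "(4 * j + 3) mod 4 = 3"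
  by presburger+

lemma partner_eq:
  "partner (4 * j) = 4 * j + 2" "partner (4 * j + 1) = 4 * j + 3"
  "partner (4 * j + 2) = 4 * j" "partner (4 * j + 3) = 4 * j + 1"
  unfolding partner_def mod4_eq by simp_all

lemma direction_eq:
  "direction (4 * j) = 1" "direction (4 * j + 1) = 1"
  "direction (4 * j + 2) = -1" "direction (4 * j + 3) = -1"
  unfolding direction_def mod4_eq by simp_all

lemma letter_partner [simp]: "letter (partner k) = letter k"
  by (rule nat_mod4_cases[of k]) (simp_all only: partner_eq letter_eq)

lemma partner_partner [simp]: "partner (partner k) = k"
  by (rule nat_mod4_cases[of k]) (simp_all only: partner_eq)

lemma direction_partner [simp]: "direction (partner k) = - direction k"
  by (rule nat_mod4_cases[of k]) (simp_all only: partner_eq direction_eq minus_minus)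

lemma partner_less_16: "k < 16 \<Longrightarrow> partner k < 16"
  by (rule nat_mod4_cases[of k]) (simp_all only: partner_eq; presburger)+

lemma letter_eq_iff: "letter k = letter l \<longleftrightarrow> l = k \<or> l = partner k"
  by (rule nat_mod4_cases[of k]; rule nat_mod4_cases[of l];
      simp only: letter_eq partner_eq; presburger)

lemma direction_cases: "direction k = 1 \<or> direction k = -1"
  by (simp add: direction_def)

lemma direction_neq_partner: "direction k \<noteq> direction (partner k)"
  using direction_cases[of k] by auto

text \<open>The boundary of the 16-gon is parametrised by the real line with period 16, side
  \<open>k\<close> over the interval from \<open>k\<close> to \<open>k + 1\<close>; the integers are
  the corners.\<close>

definition side :: "real \<Rightarrow> nat" where
  "side s = nat (\<lfloor>s\<rfloor> mod 16)"

lemma side_less: "side s < 16"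
  by (simp add: side_def nat_less_iff)

lemma side_periodic: "side (s + 16 * of_int m) = side s"
proof -
  have "\<lfloor>s + 16 * of_int m\<rfloor> = \<lfloor>s\<rfloor> + m * 16"
    using floor_add_int[of s "m * 16"] by (simp add: mult.commute)
  then show ?thesis
    by (simp add: side_def)
qed

lemma ex_side_frac: "\<exists>m :: int. s = real (side s) + frac s + 16 * of_int m"
proof
  have "\<lfloor>s\<rfloor> = int (side s) + 16 * (\<lfloor>s\<rfloor> div 16)"
    by (simp add: side_def)
  then have "of_int \<lfloor>s\<rfloor> = real (side s) + 16 * of_int (\<lfloor>s\<rfloor> div 16)"
    by (metis of_int_add of_int_mult of_int_numeral of_int_of_nat_eq)
  then show "s = real (side s) + frac s + 16 * of_int (\<lfloor>s\<rfloor> div 16)"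
    unfolding frac_def by linarith
qed

text \<open>The boundary of the 16-gon is wrapped around circles of radii \<open>1, \<dots>, 8\<close> that touch at \<open>0\<close>:
  any two of them meet only there, so they form a wedge.\<close>

definition radius :: "nat \<Rightarrow> real" where
  "radius k = real (letter k) + 1"

lemma radius_pos: "0 < radius k"
  by (simp add: radius_def add_nonneg_pos)

lemma radius_neq_0: "radius k \<noteq> 0"
  using radius_pos[of k] by simp

text \<open>The circle with centre \<open>radius k\<close> on the real axis, starting from 0. The
  sign \<open>direction k\<close> lets the two sides with the same letter run through it in opposite
  directions.\<close>

definition wedge_circle :: "nat \<Rightarrow> real \<Rightarrow> complex" where
  "wedge_circle k s = of_real (radius k) * (1 - cis (direction k * (2 * pi * s)))"

definition wedge_path :: "real \<Rightarrow> complex" where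
  "wedge_path s = wedge_circle (side s) s"

lemma cis_two_pi_eq_1_iff: "cis (2 * pi * s) = 1 \<longleftrightarrow> s \<in> \<int>"
proof -
  have "cis (2 * pi * s) = 1 \<longleftrightarrow> cos (2 * pi * s) = 1"
    using cos_one_sin_zero by (auto simp: complex_eq_iff)
  also have "\<dots> \<longleftrightarrow> (\<exists>n::int. 2 * pi * s = of_int n * 2 * pi)"
    by (rule cos_one_2pi_int)
  also have "\<dots> \<longleftrightarrow> s \<in> \<int>"
    by (auto simp: Ints_def)
  finally show ?thesis .
qed

lemma cis_two_pi_eq_iff: "cis (2 * pi * s) = cis (2 * pi * t) \<longleftrightarrow> s - t \<in> \<int>"
proof -
  have "cis (2 * pi * s) = cis (2 * pi * t) \<longleftrightarrow> cis (2 * pi * s) / cis (2 * pi * t) = 1"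
    by simp
  also have "\<dots> \<longleftrightarrow> cis (2 * pi * (s - t)) = 1"
    by (simp add: cis_divide right_diff_distrib)
  finally show ?thesis
    by (simp add: cis_two_pi_eq_1_iff)
qed

lemma wedge_circle_0_iff: "wedge_circle k s = 0 \<longleftrightarrow> s \<in> \<int>"
proof -
  have "wedge_circle k s = 0 \<longleftrightarrow> cis (2 * pi * (direction k * s)) = 1"
    by (auto simp: wedge_circle_def mult.left_commute radius_neq_0)
  also have "\<dots> \<longleftrightarrow> s \<in> \<int>"
    using direction_cases[of k] by (auto simp: cis_two_pi_eq_1_iff)
  finally show ?thesis .
qed

lemma wedge_path_eq:
  assumes "of_int k \<le> s" "s \<le> of_int k + 1"
  shows "wedge_path s = wedge_circle (nat (k mod 16)) s"
proof (cases "s = of_int k + 1")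
  case True
  then have "s \<in> \<int>"
    by simp
  then have "wedge_circle l s = 0" for l
    by (simp add: wedge_circle_0_iff)
  then show ?thesis
    by (simp add: wedge_path_def)
next
  case False
  with assms have "\<lfloor>s\<rfloor> = k"
    by (simp add: floor_eq_iff)
  then show ?thesis
    by (simp add: wedge_path_def side_def)
qed

lemma continuous_on_wedge_path: "continuous_on UNIV wedge_path"
proof (rule continuous_on_UNIV_if_unit_intervals)
  fix k :: int
  have "continuous_on {of_int k..of_int k + 1} (wedge_circle (nat (k mod 16)))"
    unfolding wedge_circle_def by (intro continuous_intros)
  then show "continuous_on {of_int k..of_int k + 1} wedge_path"
    by (rule continuous_on_eq) (auto simp: wedge_path_eq[of k])
qed

lemma norm_one_minus_cis_sq: "(norm (1 - cis x))\<^sup>2 = 2 * Re (1 - cis x)"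
proof -
  have "(norm (1 - cis x))\<^sup>2 = (1 - cos x)\<^sup>2 + (sin x)\<^sup>2"
    by (simp add: cmod_power2)
  also have "\<dots> = 1 - 2 * cos x + ((cos x)\<^sup>2 + (sin x)\<^sup>2)"
    by (simp add: power2_eq_square algebra_simps)
  finally show ?thesis
    by simp
qed

text \<open>A point \<open>z\<close> on the circle of radius \<open>R\<close> about \<open>R\<close>
  satisfies \<open>|z|^2 = 2 R Re z\<close>. For \<open>z\<close> other than 0 this determines
  \<open>R\<close>, and different letters have different radii.\<close>

lemma wedge_circle_radius:
  assumes "wedge_circle k s = wedge_circle l t" "s \<notin> \<int>"
  shows "letter k = letter l"
proof -
  have norm: "(norm (wedge_circle m x))\<^sup>2 = 2 * radius m * Re (wedge_circle m x)" for m x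
  proof -
    have "(norm (wedge_circle m x))\<^sup>2 = (radius m)\<^sup>2 * (norm (1 - cis (direction m * (2 * pi * x))))\<^sup>2"
      unfolding wedge_circle_def norm_mult norm_of_real power_mult_distrib by simp
    then show ?thesis
      unfolding norm_one_minus_cis_sq wedge_circle_def by (simp add: power2_eq_square algebra_simps)
  qed
  have "wedge_circle k s \<noteq> 0"
    using assms(2) by (simp add: wedge_circle_0_iff)
  then have "(norm (wedge_circle k s))\<^sup>2 \<noteq> 0"
    by simp
  then have "Re (wedge_circle k s) \<noteq> 0"
    using norm[of k s] by auto
  moreover have "2 * radius k * Re (wedge_circle k s) = 2 * radius l * Re (wedge_circle k s)"
    using norm[of k s] norm[of l t] assms(1) by (simp only:)
  ultimately show ?thesis
    by (simp add: radius_def)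
qed

text \<open>Away from the corners the radius reveals the letter. On the same side equal angles mean
  an integral difference of parameters, on the partner side an integral sum.\<close>

lemma wedge_path_eq_iff:
  "wedge_path s = wedge_path t \<longleftrightarrow> s \<in> \<int> \<and> t \<in> \<int> \<or>
     side s = side t \<and> s - t \<in> \<int> \<or> side t = partner (side s) \<and> s + t \<in> \<int>"
  (is "?L \<longleftrightarrow> ?R")
proof (cases "s \<in> \<int>")
  case True
  then have "wedge_path s = 0"
    by (simp add: wedge_path_def wedge_circle_0_iff)
  then have "?L \<longleftrightarrow> t \<in> \<int>"
    by (metis wedge_path_def wedge_circle_0_iff)
  moreover have "?R \<longleftrightarrow> t \<in> \<int>"
    using True Ints_diff[of s "s - t"] Ints_diff[of "s + t" s] by auto
  ultimately show ?thesis
    by simp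
next
  case False
  have same: "wedge_circle k s = wedge_circle k t \<longleftrightarrow> s - t \<in> \<int>" for k
  proof -
    have "wedge_circle k s = wedge_circle k t \<longleftrightarrow>
        cis (2 * pi * (direction k * s)) = cis (2 * pi * (direction k * t))"
      by (simp add: wedge_circle_def mult.left_commute radius_neq_0)
    also have "\<dots> \<longleftrightarrow> direction k * s - direction k * t \<in> \<int>"
      by (rule cis_two_pi_eq_iff)
    also have "\<dots> \<longleftrightarrow> s - t \<in> \<int>"
      using direction_cases[of k] minus_in_Ints_iff[of "s - t"] by (auto simp: algebra_simps)
    finally show ?thesis .
  qed
  have opp: "wedge_circle k s = wedge_circle (partner k) t \<longleftrightarrow> s + t \<in> \<int>" for k
  proof -
    have "radius (partner k) = radius k"
      by (simp add: radius_def)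
    then have "wedge_circle k s = wedge_circle (partner k) t \<longleftrightarrow>
        cis (2 * pi * (direction k * s)) = cis (2 * pi * (- direction k * t))"
      by (simp add: wedge_circle_def mult.left_commute radius_neq_0)
    also have "\<dots> \<longleftrightarrow> direction k * s - (- direction k * t) \<in> \<int>"
      by (rule cis_two_pi_eq_iff)
    also have "\<dots> \<longleftrightarrow> s + t \<in> \<int>"
      using direction_cases[of k] minus_in_Ints_iff[of "s + t"] by (auto simp: algebra_simps)
    finally show ?thesis .
  qed
  show ?thesis
  proof
    assume L: ?L
    then have "letter (side s) = letter (side t)"
      using wedge_circle_radius[of "side s" s "side t" t] False by (simp add: wedge_path_def)
    then consider "side t = side s" | "side t = partner (side s)"
      by (auto simp: letter_eq_iff)
    then show ?R
      using L same opp by cases (auto simp: wedge_path_def)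
  next
    assume ?R
    then show ?L
      using False same opp by (auto simp: wedge_path_def)
  qed
qed

lemma frac_eq_iff: "frac x = frac y \<longleftrightarrow> x - y \<in> \<int>" for x y :: real
proof
  assume "frac x = frac y"
  then have "x - y = of_int (\<lfloor>x\<rfloor> - \<lfloor>y\<rfloor>)"
    by (simp add: frac_def)
  then show "x - y \<in> \<int>"
    by (metis Ints_of_int)
next
  assume "x - y \<in> \<int>"
  then obtain n where "x = y + of_int n"
    by (metis Ints_cases add.commute diff_add_cancel)
  then show "frac x = frac y"
    by (simp add: frac_def)
qed

lemma Ints_abs_less_1: "x \<in> \<int> \<Longrightarrow> \<bar>x :: real\<bar> < 1 \<Longrightarrow> x = 0"
  by (metis Ints_nonzero_abs_less1)

text \<open>A realisation of the glued polygon in a Euclidean space, with \<open>r\<close> the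
  distance from the centre and \<open>s\<close> the position on the boundary. The last coordinate
  recovers \<open>r\<close>; the middle one recovers \<open>s\<close> modulo 16 for
  \<open>0 < r < 1\<close> and vanishes at both ends; at \<open>r = 1\<close> only the wedge
  remains, which performs the gluing, and at \<open>r = 0\<close> all points collapse to the
  centre.\<close>

definition model :: "real \<times> real \<Rightarrow> complex \<times> complex \<times> real" where
  "model z = (of_real (fst z) * wedge_path (snd z),
     of_real (fst z * (1 - fst z)) * cis (2 * pi * (snd z / 16)), fst z)"

definition model_surface :: "(complex \<times> complex \<times> real) set" where
  "model_surface = model ` ({0..1} \<times> UNIV)"

lemma continuous_on_model: "continuous_on S model"
  unfolding model_def
  by (intro continuous_intros continuous_on_compose2[OF continuous_on_wedge_path]) auto

lemma wedge_path_periodic: "wedge_path (s + 16 * of_int m) = wedge_path s"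
  by (simp add: wedge_path_eq_iff side_periodic)

lemma model_eq_iff:
  assumes "r \<in> {0..1}" "r' \<in> {0..1}"
  shows "model (r, s) = model (r', s') \<longleftrightarrow>
    r = r' \<and> (r = 0 \<or> r < 1 \<and> (s - s') / 16 \<in> \<int> \<or> r = 1 \<and> wedge_path s = wedge_path s')"
proof (cases "r = r' \<and> r \<noteq> 0 \<and> r \<noteq> 1")
  case True
  then have r: "0 < r" "r < 1"
    using assms by auto
  then have "model (r, s) = model (r', s') \<longleftrightarrow>
      wedge_path s = wedge_path s' \<and> cis (2 * pi * (s / 16)) = cis (2 * pi * (s' / 16))"
    using True by (auto simp: model_def)
  also have "\<dots> \<longleftrightarrow> wedge_path s = wedge_path s' \<and> (s - s') / 16 \<in> \<int>"
    unfolding cis_two_pi_eq_iff by (simp add: diff_divide_distrib)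
  also have "\<dots> \<longleftrightarrow> (s - s') / 16 \<in> \<int>"
  proof -
    have "wedge_path s = wedge_path s'" if diff: "(s - s') / 16 \<in> \<int>"
    proof -
      obtain m where "(s - s') / 16 = of_int m"
        using diff by (rule Ints_cases)
      then have "s = s' + 16 * of_int m"
        by (simp add: field_simps)
      then show ?thesis
        by (simp add: wedge_path_periodic)
    qed
    then show ?thesis
      by blast
  qed
  finally show ?thesis
    using True r by auto
qed (use assms in \<open>auto simp: model_def\<close>)

lemma model_periodic: "model (r, s + 16 * of_int m) = model (r, s)"
proof -
  have "cis (2 * pi * ((s + 16 * of_int m) / 16)) = cis (2 * pi * (s / 16))"
    unfolding cis_two_pi_eq_iff by (simp add: add_divide_distrib)
  then show ?thesis
    by (simp add: model_def wedge_path_periodic)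
qed

section \<open>The pieces of the model and their order\<close>

datatype piece = Vertex | Face | Edge nat | VertexEdge nat | EdgeFace nat | VertexFace nat
  | Corner nat bool

text \<open>\<open>VertexEdge k\<close> and \<open>Corner k b\<close> sit at the start of side \<open>k\<close> (\<open>Corner k True\<close> at its end);
  the end of side \<open>k\<close> is the start of side \<open>partner k\<close>.\<close>

primrec upper_pieces :: "piece \<Rightarrow> piece set" where
  "upper_pieces Vertex = {Vertex}"
| "upper_pieces Face = {Face}"
| "upper_pieces (Edge j) = {Edge j}"
| "upper_pieces (VertexEdge k) = {VertexEdge k, Vertex, Edge (letter k)}"
| "upper_pieces (EdgeFace k) = {EdgeFace k, Edge (letter k), Face}"
| "upper_pieces (VertexFace k) = {VertexFace k, Vertex, Face}"
| "upper_pieces (Corner k b) = {Corner k b, VertexEdge (if b then partner k else k), EdgeFace k,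
     VertexFace (if b then (k + 1) mod 16 else k), Vertex, Edge (letter k), Face}"

instantiation piece :: order
begin

definition less_eq_piece :: "piece \<Rightarrow> piece \<Rightarrow> bool" where
  "less_eq_piece x y \<longleftrightarrow> y \<in> upper_pieces x"

definition less_piece :: "piece \<Rightarrow> piece \<Rightarrow> bool" where
  "less_piece x y \<longleftrightarrow> x \<le> y \<and> \<not> y \<le> (x :: piece)"

instance
proof
  fix x y z :: piece
  show "x \<le> x"
    by (cases x) (simp_all add: less_eq_piece_def)
  show "x \<le> z" if "x \<le> y" "y \<le> z"
    using that by (cases x; cases y) (auto simp: less_eq_piece_def)
  show "x = y" if "x \<le> y" "y \<le> x"
    using that by (cases x; cases y) (auto simp: less_eq_piece_def)
qed (rule less_piece_def)

end

text \<open>Besides the two discs and the eight bands there are sixteen components of each kind of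
  double intersection and 32 triple intersections. Components are separate indices because an
  absolute retract is connected.\<close>

definition pieces :: "piece set" where
  "pieces = {Vertex, Face} \<union> Edge ` {..<8} \<union> VertexEdge ` {..<16} \<union> EdgeFace ` {..<16}
     \<union> VertexFace ` {..<16} \<union> (\<lambda>(k, b). Corner k b) ` ({..<16} \<times> UNIV)"

lemma finite_pieces: "finite pieces"
  by (simp add: pieces_def)

text \<open>The least piece through the point at distance \<open>r\<close> from the centre and
  position \<open>u\<close> on side \<open>k\<close>. The face disc ends at \<open>r = 1/2\<close>;
  beyond it the quarters next to the corners form the vertex disc and the middle halves the
  bands.\<close>

definition local_position :: "real \<Rightarrow> nat \<Rightarrow> real \<Rightarrow> piece" where
  "local_position r k u =
    (if r < 1/2 then Face
     else if r = 1/2 then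
       (if u < 1/4 then VertexFace k else if u = 1/4 then Corner k False
        else if u < 3/4 then EdgeFace k else if u = 3/4 then Corner k True
        else VertexFace ((k + 1) mod 16))
     else
       (if u < 1/4 \<or> u > 3/4 then Vertex else if u = 1/4 then VertexEdge k
        else if u = 3/4 then VertexEdge (partner k) else Edge (letter k)))"

definition position :: "real \<times> real \<Rightarrow> piece" where
  "position z = local_position (fst z) (side (snd z)) (frac (snd z))"

lemma letter_less_8: "k < 16 \<Longrightarrow> letter k < 8"
  unfolding letter_def by presburger

lemma position_in_pieces: "position z \<in> pieces"
  using side_less[of "snd z"] letter_less_8[OF side_less[of "snd z"]]
    partner_less_16[OF side_less[of "snd z"]]
  by (auto simp: position_def local_position_def pieces_def)

text \<open>The decomposition descends to the glued polygon: on the boundary, \<open>u\<close> on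
  one side meets \<open>1 - u\<close> on its partner, and the cuts at 1/4 and 3/4 are exchanged
  along with the two sides.\<close>

lemma position_cong:
  assumes "model (r, s) = model (r', s')" "r \<in> {0..1}" "r' \<in> {0..1}"
  shows "position (r, s) = position (r', s')"
proof -
  have eq: "r = r'" and c: "r = 0 \<or> r < 1 \<and> (s - s') / 16 \<in> \<int> \<or> r = 1 \<and> wedge_path s = wedge_path s'"
    using assms model_eq_iff by auto
  have frac: ?thesis if "side s = side s'" "frac s = frac s'"
    using that eq by (simp add: position_def)
  from c consider "r = 0" | "(s - s') / 16 \<in> \<int>" | "r = 1" "wedge_path s = wedge_path s'"
    by blast
  then show ?thesis
  proof cases
    case 1
    with eq show ?thesis
      by (simp add: position_def local_position_def)
  next
    case 2
    then obtain m where "(s - s') / 16 = of_int m"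
      by (rule Ints_cases)
    then have s: "s = s' + 16 * of_int m"
      by (simp add: field_simps)
    show ?thesis
      by (rule frac) (simp_all add: s side_periodic frac_eq_iff)
  next
    case 3
    consider "s \<in> \<int>" "s' \<in> \<int>" | "side s = side s'" "s - s' \<in> \<int>"
      | "s \<notin> \<int>" "side s' = partner (side s)" "s + s' \<in> \<int>"
    proof (cases "s \<in> \<int>")
      case True
      then have "s' \<in> \<int>" if "s + s' \<in> \<int>"
        using Ints_diff[OF that True] by simp
      with True show thesis
        using 3(2) that unfolding wedge_path_eq_iff by blast
    next
      case False
      with 3(2) show thesis
        using that unfolding wedge_path_eq_iff by blast
    qed
    then show ?thesis
    proof cases
      case 1
      then have "frac s = 0" "frac s' = 0"
        by simp_all
      with 3 eq show ?thesis
        by (simp add: position_def local_position_def del: frac_eq_0_iff)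
    next
      case 2
      then show ?thesis
        by (intro frac) (simp_all add: frac_eq_iff)
    next
      case opposite: 3
      have "frac s' = frac (- s)"
        using opposite(3) by (simp add: frac_eq_iff add.commute)
      then have "frac s' = 1 - frac s"
        using opposite(1) by (simp add: frac_neg)
      then show ?thesis
        using eq 3(1) opposite(2) by (auto simp: position_def local_position_def)
    qed
  qed
qed

definition model_piece :: "piece \<Rightarrow> (complex \<times> complex \<times> real) set" where
  "model_piece i = model ` {z \<in> {0..1} \<times> UNIV. position z \<le> i}"

lemma model_mem_piece_iff:
  assumes "r \<in> {0..1}"
  shows "model (r, s) \<in> model_piece i \<longleftrightarrow> position (r, s) \<le> i"
proof
  assume "model (r, s) \<in> model_piece i"
  then obtain r' s' where "model (r, s) = model (r', s')" "r' \<in> {0..1}" "position (r', s') \<le> i"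
    by (auto simp: model_piece_def)
  then show "position (r, s) \<le> i"
    using position_cong[of r s r' s'] assms by simp
qed (use assms in \<open>auto simp: model_piece_def\<close>)

lemma model_surface_strata:
  assumes "x \<in> model_surface"
  shows "\<exists>k\<in>pieces. \<forall>i\<in>pieces. x \<in> model_piece i \<longleftrightarrow> k \<le> i"
proof -
  obtain r s where "x = model (r, s)" "r \<in> {0..1}"
    using assms by (auto simp: model_surface_def)
  then show ?thesis
    using model_mem_piece_iff[of r s] position_in_pieces[of "(r, s)"] by blast
qed

section \<open>The pieces of the model are absolute retracts\<close>

definition rect :: "real \<Rightarrow> real \<Rightarrow> real \<Rightarrow> real \<Rightarrow> (complex \<times> complex \<times> real) set" where
  "rect a b c d = model ` ({a..b} \<times> {c..d})"

lemma compact_rect: "compact (rect a b c d)"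
  unfolding rect_def by (intro compact_continuous_image continuous_on_model compact_Times) auto

text \<open>Partner sides have numbers differing by two, whereas parameters less than 1 apart lie on
  the same or on neighbouring sides.\<close>

lemma side_diff_less_1:
  assumes "\<bar>s - t\<bar> < 1"
  shows "side t \<noteq> partner (side s)"
proof
  assume eq: "side t = partner (side s)"
  define m n where "m = \<lfloor>t\<rfloor>" and "n = \<lfloor>s\<rfloor>"
  have "n = m \<or> n = m + 1 \<or> n = m - 1"
    using assms unfolding m_def n_def by linarith
  moreover have "int (side t) = m mod 16" "int (side s) = n mod 16"
    by (simp_all add: side_def m_def n_def)
  moreover have "side t = side s + 2 \<or> side s = side t + 2"
  proof (cases "side s mod 4 < 2")
    case False
    moreover from this have "2 \<le> side s"
      by (metis mod_less_eq_dividend not_less order_trans)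
    ultimately have "partner (side s) + 2 = side s"
      by (simp add: partner_def)
    then show ?thesis
      using eq by simp
  qed (use eq in \<open>simp add: partner_def\<close>)
  ultimately have "m mod 16 = n mod 16 + 2 \<or> n mod 16 = m mod 16 + 2"
    by linarith
  with \<open>n = m \<or> n = m + 1 \<or> n = m - 1\<close> show False
    by (elim disjE) presburger+
qed

text \<open>A rectangle that avoids the centre and is narrower than a side cannot contain two points
  that are glued, so it is embedded.\<close>

lemma inj_on_model_rect:
  assumes "0 < a" "b \<le> 1" "d - c < 1"
  shows "inj_on model ({a..b} \<times> {c..d})"
proof (rule inj_onI, clarify)
  fix r s r' s'
  assume eq: "model (r, s) = model (r', s')" and r: "r \<in> {a..b}" "r' \<in> {a..b}"
    and s: "s \<in> {c..d}" "s' \<in> {c..d}"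
  have diff: "\<bar>s - s'\<bar> < 1"
    using s assms by auto
  have r': "r = r'" and "r < 1 \<and> (s - s') / 16 \<in> \<int> \<or> r = 1 \<and> wedge_path s = wedge_path s'"
    using eq r assms model_eq_iff[of r r' s s'] by auto
  then consider "(s - s') / 16 \<in> \<int>" | "s \<in> \<int>" "s' \<in> \<int>" | "s - s' \<in> \<int>"
    using wedge_path_eq_iff[of s s'] side_diff_less_1[OF diff] by auto
  then have "s = s'"
  proof cases
    case 1
    then have "(s - s') / 16 = 0"
      using diff by (intro Ints_abs_less_1) auto
    then show ?thesis
      by simp
  qed (use diff Ints_abs_less_1[of "s - s'"] Ints_diff[of s s'] in auto)
  with r' show "r = r' \<and> s = s'"
    by simp
qed

lemma AR_rect:
  assumes "0 < a" "a \<le> b" "b \<le> 1" "c \<le> d" "d - c < 1"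
  shows "AR (rect a b c d)"
proof -
  have "({a..b} \<times> {c..d}) homeomorphic (rect a b c d)"
    unfolding rect_def
    using assms by (intro homeomorphic_compact[OF _ continuous_on_model refl inj_on_model_rect])
      (auto intro: compact_Times)
  moreover have "AR ({a..b} \<times> {c..d})"
    using assms by (intro convex_imp_AR convex_Times) auto
  ultimately show ?thesis
    using homeomorphic_AR_iff_AR by blast
qed

lemma AR_Un_compact:
  fixes A B :: "'a::euclidean_space set"
  assumes "compact A" "compact B" "AR A" "AR B" "AR (A \<inter> B)"
  shows "AR (A \<union> B)"
  using assms by (intro AR_closed_Un_local) (auto intro!: closed_subset compact_imp_closed)

lemma AR_UN_atMost:
  fixes A :: "nat \<Rightarrow> 'a::euclidean_space set"
  assumes "\<And>i. i \<le> N \<Longrightarrow> compact (A i)" "\<And>i. i \<le> N \<Longrightarrow> AR (A i)"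
    and "\<And>n. n < N \<Longrightarrow> AR ((\<Union>i\<le>n. A i) \<inter> A (Suc n))"
  shows "AR (\<Union>i\<le>N. A i)"
  using assms
proof (induction N)
  case (Suc N)
  have "AR ((\<Union>i\<le>N. A i) \<union> A (Suc N))"
    using Suc by (intro AR_Un_compact compact_UN) auto
  then show ?case
    by (simp add: atMost_Suc Un_commute)
qed simp

lemma local_position_le_iff:
  assumes "0 \<le> u" "u < 1"
  shows "local_position r k u \<le> Face \<longleftrightarrow> r \<le> 1/2"
    "local_position r k u \<le> Vertex \<longleftrightarrow> 1/2 \<le> r \<and> (u \<le> 1/4 \<or> 3/4 \<le> u)"
    "local_position r k u \<le> Edge j \<longleftrightarrow> 1/2 \<le> r \<and> 1/4 \<le> u \<and> u \<le> 3/4 \<and> letter k = j"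
    "local_position r k u \<le> VertexEdge m \<longleftrightarrow> 1/2 \<le> r \<and> (u = 1/4 \<and> k = m \<or> u = 3/4 \<and> partner k = m)"
    "local_position r k u \<le> EdgeFace m \<longleftrightarrow> r = 1/2 \<and> k = m \<and> 1/4 \<le> u \<and> u \<le> 3/4"
    "local_position r k u \<le> VertexFace m \<longleftrightarrow>
       r = 1/2 \<and> (k = m \<and> u \<le> 1/4 \<or> (k + 1) mod 16 = m \<and> 3/4 \<le> u)"
    "local_position r k u \<le> Corner m b \<longleftrightarrow> r = 1/2 \<and> k = m \<and> u = (if b then 3/4 else 1/4)"
  using assms by (auto simp: local_position_def less_eq_piece_def)

lemma side_frac_nonneg:
  assumes "k < 16" "0 \<le> u" "u < 1"
  shows "side (real k + u) = k" "frac (real k + u) = u"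
proof -
  have "\<lfloor>real k + u\<rfloor> = int k"
    using assms by (simp add: floor_eq_iff)
  then show "side (real k + u) = k" "frac (real k + u) = u"
    using assms by (simp_all add: side_def frac_def)
qed

lemma model_piece_eq:
  "model_piece i = {model (r, real k + u) | r k u.
     r \<in> {0..1} \<and> k < 16 \<and> 0 \<le> u \<and> u < 1 \<and> local_position r k u \<le> i}" (is "_ = ?R")
proof
  show "model_piece i \<subseteq> ?R"
  proof
    fix x assume "x \<in> model_piece i"
    then obtain r s where x: "x = model (r, s)" "r \<in> {0..1}" "local_position r (side s) (frac s) \<le> i"
      by (auto simp: model_piece_def position_def)
    obtain m :: int where "s = real (side s) + frac s + 16 * of_int m"
      using ex_side_frac by blast
    then have "x = model (r, real (side s) + frac s)"
      using x(1) model_periodic by metis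
    then show "x \<in> ?R"
      using x side_less[of s] frac_ge_0[of s] frac_lt_1[of s] by blast
  qed
  show "?R \<subseteq> model_piece i"
    by (auto simp: model_mem_piece_iff position_def side_frac_nonneg)
qed

lemma model_corner_wrap:
  assumes "k < 16"
  shows "model (r, real k + u) = model (r, real ((k + 1) mod 16) + (u - 1))"
proof (cases "k = 15")
  case True
  then show ?thesis
    using model_periodic[of r "u - 1" 1] by simp
next
  case False
  with assms show ?thesis
    by (simp add: algebra_simps)
qed

lemma model_corner_image:
  assumes m: "m < 16"
  shows "model ` (S \<times> {real m - 1/4..real m + 1/4}) =
    {model (r, real k + u) | r k u. r \<in> S \<and> k < 16 \<and> 0 \<le> u \<and> u < 1 \<and>
       (k = m \<and> u \<le> 1/4 \<or> (k + 1) mod 16 = m \<and> 3/4 \<le> u)}" (is "?L = ?R")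
proof
  show "?L \<subseteq> ?R"
  proof
    fix x assume "x \<in> ?L"
    then obtain r s where x: "x = model (r, s)" and r: "r \<in> S"
      and s: "s \<in> {real m - 1/4..real m + 1/4}"
      by blast
    show "x \<in> ?R"
    proof (cases "real m \<le> s")
      case True
      have "x = model (r, real m + (s - real m))"
        by (simp add: x)
      moreover have "0 \<le> s - real m" "s - real m < 1" "s - real m \<le> 1/4"
        using True s by auto
      ultimately show ?thesis
        using r m by blast
    next
      case False
      \<comment> \<open>The side before corner \<open>m\<close>, counted cyclically; its last
        quarter belongs to this corner.\<close>
      define k where "k = (m + 15) mod 16"
      have k: "(k + 1) mod 16 = m" "k < 16"
        using m unfolding k_def by presburger+
      have "x = model (r, real k + (s - real m + 1))"
        unfolding x model_corner_wrap[OF k(2)] k(1) by simp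
      moreover have "0 \<le> s - real m + 1" "s - real m + 1 < 1" "3/4 \<le> s - real m + 1"
        using False s by auto
      ultimately show ?thesis
        using r k by blast
    qed
  qed
  show "?R \<subseteq> ?L"
  proof
    fix x assume "x \<in> ?R"
    then obtain r k u where x: "x = model (r, real k + u)" and *: "r \<in> S" "k < 16" "0 \<le> u" "u < 1"
      "k = m \<and> u \<le> 1/4 \<or> (k + 1) mod 16 = m \<and> 3/4 \<le> u"
      by blast
    from *(5) show "x \<in> ?L"
    proof (elim disjE conjE)
      assume k: "k = m" "u \<le> 1/4"
      show ?thesis
        unfolding x k(1) by (rule imageI) (use k(2) *(1,3) in auto)
    next
      assume k: "(k + 1) mod 16 = m" "3/4 \<le> u"
      show ?thesis
        unfolding x model_corner_wrap[OF *(2)] k(1) by (rule imageI) (use k(2) *(1,4) in auto)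
    qed
  qed
qed

lemma model_glue:
  assumes k: "k < 16" and u: "0 \<le> u" "u \<le> 1"
  shows "model (1, real k + u) = model (1, real (partner k) + (1 - u))"
proof -
  have "wedge_path (real k + u) = wedge_path (real (partner k) + (1 - u))"
  proof (cases "u = 0 \<or> u = 1")
    case True
    then show ?thesis
      by (auto simp: wedge_path_eq_iff)
  next
    case False
    then show ?thesis
      using u k partner_less_16[OF k] by (simp add: wedge_path_eq_iff side_frac_nonneg)
  qed
  then show ?thesis
    by (simp add: model_eq_iff)
qed

text \<open>The sector of the vertex disc that lies inside the polygon at corner \<open>m\<close>.
  The sixteen sectors are glued around the vertex along the arcs \<open>edge_start\<close>.\<close>

definition corner_piece :: "nat \<Rightarrow> (complex \<times> complex \<times> real) set" where
  "corner_piece m = rect (1/2) 1 (real m - 1/4) (real m + 1/4)"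

definition edge_start :: "nat \<Rightarrow> (complex \<times> complex \<times> real) set" where
  "edge_start k = rect 1 1 (real k) (real k + 1/4)"

lemma model_piece_Vertex: "model_piece Vertex = (\<Union>m<16. corner_piece m)"
proof -
  have "corner_piece m \<subseteq> model_piece Vertex" if m: "m < 16" for m
  proof
    fix x assume "x \<in> corner_piece m"
    then obtain r k u where x: "x = model (r, real k + u)" "r \<in> {1/2..1}" "k < 16" "0 \<le> u" "u < 1"
      "u \<le> 1/4 \<or> 3/4 \<le> u"
      unfolding corner_piece_def rect_def model_corner_image[OF m] by blast
    then have "local_position r k u \<le> Vertex" "r \<in> {0..1}"
      by (auto simp: local_position_le_iff)
    then show "x \<in> model_piece Vertex"
      unfolding model_piece_eq using x by blast
  qed
  moreover have "model_piece Vertex \<subseteq> (\<Union>m<16. corner_piece m)"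
  proof
    fix x assume "x \<in> model_piece Vertex"
    then obtain r k u where x: "x = model (r, real k + u)" "r \<in> {1/2..1}" "k < 16" "0 \<le> u" "u < 1"
      "u \<le> 1/4 \<or> 3/4 \<le> u"
      unfolding model_piece_eq using local_position_le_iff(2) by fastforce
    define m where "m = (if u \<le> 1/4 then k else (k + 1) mod 16)"
    have m: "m < 16"
      using x by (simp add: m_def)
    have "x \<in> corner_piece m"
      unfolding corner_piece_def rect_def model_corner_image[OF m]
      using x by (intro CollectI exI[of _ r] exI[of _ k] exI[of _ u]) (auto simp: m_def)
    then show "x \<in> (\<Union>m<16. corner_piece m)"
      using m by blast
  qed
  ultimately show ?thesis
    by blast
qed

lemma model_piece_VertexFace:
  assumes m: "m < 16"
  shows "model_piece (VertexFace m) = rect (1/2) (1/2) (real m - 1/4) (real m + 1/4)"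
proof -
  have "r \<in> {0..1} \<and> k < 16 \<and> 0 \<le> u \<and> u < 1 \<and> local_position r k u \<le> VertexFace m \<longleftrightarrow>
      r \<in> {1/2..1/2} \<and> k < 16 \<and> 0 \<le> u \<and> u < 1 \<and>
       (k = m \<and> u \<le> 1/4 \<or> (k + 1) mod 16 = m \<and> 3/4 \<le> u)" for r k u
    using local_position_le_iff(6)[of u r k m] by auto
  then show ?thesis
    unfolding rect_def model_corner_image[OF m] model_piece_eq by (simp only:)
qed

lemma model_side_image:
  assumes "k < 16" "0 \<le> c" "d < 1"
  shows "model ` (S \<times> {real k + c..real k + d}) =
    {model (r, real k' + u) | r k' u. r \<in> S \<and> k' < 16 \<and> 0 \<le> u \<and> u < 1 \<and> k' = k \<and> c \<le> u \<and> u \<le> d}"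
    (is "?L = ?R")
proof
  show "?L \<subseteq> ?R"
  proof
    fix x assume "x \<in> ?L"
    then obtain r s where x: "x = model (r, s)" and r: "r \<in> S" and s: "s \<in> {real k + c..real k + d}"
      by blast
    have "x = model (r, real k + (s - real k))"
      by (simp add: x)
    moreover have "0 \<le> s - real k" "s - real k < 1" "c \<le> s - real k" "s - real k \<le> d"
      using s assms by auto
    ultimately show "x \<in> ?R"
      using r assms(1) by blast
  qed
  show "?R \<subseteq> ?L"
    by (force intro: imageI)
qed

lemma model_piece_EdgeFace:
  assumes k: "k < 16"
  shows "model_piece (EdgeFace k) = rect (1/2) (1/2) (real k + 1/4) (real k + 3/4)"
proof -
  have "r \<in> {0..1} \<and> k' < 16 \<and> 0 \<le> u \<and> u < 1 \<and> local_position r k' u \<le> EdgeFace k \<longleftrightarrow>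
      r \<in> {1/2..1/2} \<and> k' < 16 \<and> 0 \<le> u \<and> u < 1 \<and> k' = k \<and> 1/4 \<le> u \<and> u \<le> 3/4" for r k' u
    using local_position_le_iff(5)[of u r k' k] by auto
  moreover have "model ` ({1/2..1/2} \<times> {real k + 1/4..real k + 3/4}) =
    {model (r, real k' + u) | r k' u. r \<in> {1/2..1/2} \<and> k' < 16 \<and> 0 \<le> u \<and> u < 1 \<and> k' = k \<and> 1/4 \<le> u \<and> u \<le> 3/4}"
    using k by (intro model_side_image) auto
  ultimately show ?thesis
    unfolding rect_def model_piece_eq by (simp only:)
qed

lemma model_piece_Corner:
  assumes k: "k < 16"
  shows "model_piece (Corner k b) = rect (1/2) (1/2) (real k + (if b then 3/4 else 1/4)) (real k + (if b then 3/4 else 1/4))"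
proof -
  define v :: real where "v = (if b then 3/4 else 1/4)"
  have "r \<in> {0..1} \<and> k' < 16 \<and> 0 \<le> u \<and> u < 1 \<and> local_position r k' u \<le> Corner k b \<longleftrightarrow>
      r \<in> {1/2..1/2} \<and> k' < 16 \<and> 0 \<le> u \<and> u < 1 \<and> k' = k \<and> v \<le> u \<and> u \<le> v" for r k' u
    using local_position_le_iff(7)[of u r k' k b] by (auto simp: v_def)
  moreover have "model ` ({1/2..1/2} \<times> {real k + v..real k + v}) =
    {model (r, real k' + u) | r k' u. r \<in> {1/2..1/2} \<and> k' < 16 \<and> 0 \<le> u \<and> u < 1 \<and> k' = k \<and> v \<le> u \<and> u \<le> v}"
    using k by (intro model_side_image) (auto simp: v_def)
  ultimately show ?thesis
    unfolding rect_def model_piece_eq v_def[symmetric] by (simp only:)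
qed

text \<open>The pieces cut out of the two copies of an edge in the polygon by a symmetric range of
  parameters.\<close>

definition band :: "nat \<Rightarrow> real \<Rightarrow> real \<Rightarrow> (complex \<times> complex \<times> real) set" where
  "band k c d = rect (1/2) 1 (real k + c) (real k + d) \<union>
     rect (1/2) 1 (real (partner k) + (1 - d)) (real (partner k) + (1 - c))"

lemma band_eq:
  assumes k: "k < 16" and c: "0 < c" "d < 1"
  shows "band k c d = {model (r, real k' + u) | r k' u. r \<in> {1/2..1} \<and> k' < 16 \<and> 0 \<le> u \<and> u < 1 \<and>
     (k' = k \<and> c \<le> u \<and> u \<le> d \<or> k' = partner k \<and> 1 - d \<le> u \<and> u \<le> 1 - c)}"
proof -
  have 1: "rect (1/2) 1 (real k + c) (real k + d) =
    {model (r, real k' + u) | r k' u. r \<in> {1/2..1} \<and> k' < 16 \<and> 0 \<le> u \<and> u < 1 \<and> k' = k \<and> c \<le> u \<and> u \<le> d}"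
    unfolding rect_def using k c by (intro model_side_image) auto
  have 2: "rect (1/2) 1 (real (partner k) + (1 - d)) (real (partner k) + (1 - c)) =
    {model (r, real k' + u) | r k' u. r \<in> {1/2..1} \<and> k' < 16 \<and> 0 \<le> u \<and> u < 1 \<and> k' = partner k \<and>
       1 - d \<le> u \<and> u \<le> 1 - c}"
    unfolding rect_def using partner_less_16[OF k] c by (intro model_side_image) auto
  show ?thesis
    unfolding band_def 1 2 by blast
qed

lemma compact_band: "compact (band k c d)"
  unfolding band_def by (intro compact_Un compact_rect)

text \<open>The two halves of a band lie at different sides of the polygon, so they meet only on its
  boundary, in the arc along which these sides are glued.\<close>

lemma AR_band:
  assumes k: "k < 16" and c: "0 < c" "c \<le> d" "d < 1"
  shows "AR (band k c d)"
  unfolding band_def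
proof (intro AR_Un_compact compact_rect AR_rect)
  let ?A = "rect (1/2) 1 (real k + c) (real k + d)"
  let ?B = "rect (1/2) 1 (real (partner k) + (1 - d)) (real (partner k) + (1 - c))"
  have "?A \<inter> ?B = rect 1 1 (real k + c) (real k + d)"
  proof
    show "?A \<inter> ?B \<subseteq> rect 1 1 (real k + c) (real k + d)"
    proof
      fix x assume "x \<in> ?A \<inter> ?B"
      then obtain r s r' s' where x: "x = model (r, s)" "x = model (r', s')" "r \<in> {1/2..1}" "r' \<in> {1/2..1}"
        and s: "s \<in> {real k + c..real k + d}" "s' \<in> {real (partner k) + (1 - d)..real (partner k) + (1 - c)}"
        unfolding rect_def by blast
      have r: "r = r'" "r < 1 \<and> (s - s') / 16 \<in> \<int> \<or> r = 1"
        using x model_eq_iff[of r r' s s'] by auto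
      \<comment> \<open>Equal parameters modulo 16 would put both points on the same side, but
        \<open>k\<close> and \<open>partner k\<close> have opposite directions.\<close>
      have "\<not> (s - s') / 16 \<in> \<int>"
      proof
        assume int: "(s - s') / 16 \<in> \<int>"
        have "s - s' < 16" "s' - s < 16"
          using s c k partner_less_16[OF k] by auto
        then have "(s - s') / 16 = 0"
          by (intro Ints_abs_less_1 int) auto
        then have "side s = side s'"
          by simp
        moreover have "side s = k"
          using side_frac_nonneg(1)[OF k, of "s - real k"] s c by auto
        moreover have "side s' = partner k"
          using side_frac_nonneg(1)[OF partner_less_16[OF k], of "s' - real (partner k)"] s c by auto
        ultimately show False
          using direction_neq_partner[of k] by auto
      qed
      with r have "r = 1"
        by blast
      then show "x \<in> rect 1 1 (real k + c) (real k + d)"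
        using x(1) s(1) unfolding rect_def by auto
    qed
    show "rect 1 1 (real k + c) (real k + d) \<subseteq> ?A \<inter> ?B"
    proof
      fix x assume "x \<in> rect 1 1 (real k + c) (real k + d)"
      then obtain s where s: "x = model (1, s)" "s \<in> {real k + c..real k + d}"
        unfolding rect_def by auto
      then have "x = model (1, real (partner k) + (1 - (s - real k)))"
        using model_glue[OF k, of "s - real k"] c by auto
      moreover have "real (partner k) + (1 - (s - real k)) \<in> {real (partner k) + (1 - d)..real (partner k) + (1 - c)}"
        using s(2) by auto
      ultimately have "x \<in> ?B"
        unfolding rect_def by (intro image_eqI[where x = "(1, real (partner k) + (1 - (s - real k)))"]) auto
      moreover have "x \<in> ?A"
        unfolding rect_def using s by (intro image_eqI[where x = "(1, s)"]) auto
      ultimately show "x \<in> ?A \<inter> ?B"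
        by blast
    qed
  qed
  moreover have "AR (rect 1 1 (real k + c) (real k + d))"
    using c by (intro AR_rect) auto
  ultimately show "AR (?A \<inter> ?B)"
    by simp
qed (use c in auto)

lemma model_piece_VertexEdge:
  assumes k: "k < 16"
  shows "model_piece (VertexEdge k) = band k (1/4) (1/4)"
proof -
  have "r \<in> {0..1} \<and> k' < 16 \<and> 0 \<le> u \<and> u < 1 \<and> local_position r k' u \<le> VertexEdge k \<longleftrightarrow>
      r \<in> {1/2..1} \<and> k' < 16 \<and> 0 \<le> u \<and> u < 1 \<and>
      (k' = k \<and> 1/4 \<le> u \<and> u \<le> 1/4 \<or> k' = partner k \<and> 1 - 1/4 \<le> u \<and> u \<le> 1 - 1/4)" for r k' u
    using local_position_le_iff(4)[of u r k' k] partner_partner[of k] partner_partner[of k'] by auto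
  moreover have "band k (1/4) (1/4) = {model (r, real k' + u) | r k' u. r \<in> {1/2..1} \<and> k' < 16 \<and> 0 \<le> u \<and> u < 1 \<and>
     (k' = k \<and> 1/4 \<le> u \<and> u \<le> 1/4 \<or> k' = partner k \<and> 1 - 1/4 \<le> u \<and> u \<le> 1 - 1/4)}"
    using k by (intro band_eq) auto
  ultimately show ?thesis
    unfolding model_piece_eq by (simp only:)
qed

lemma model_piece_Edge:
  assumes k: "k < 16"
  shows "model_piece (Edge (letter k)) = band k (1/4) (3/4)"
proof -
  have "r \<in> {0..1} \<and> k' < 16 \<and> 0 \<le> u \<and> u < 1 \<and> local_position r k' u \<le> Edge (letter k) \<longleftrightarrow>
      r \<in> {1/2..1} \<and> k' < 16 \<and> 0 \<le> u \<and> u < 1 \<and>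
      (k' = k \<and> 1/4 \<le> u \<and> u \<le> 3/4 \<or> k' = partner k \<and> 1 - 3/4 \<le> u \<and> u \<le> 1 - 1/4)" for r k' u
  proof -
    have "letter k' = letter k \<longleftrightarrow> k' = k \<or> k' = partner k"
      using letter_eq_iff[of k k'] by (simp only: eq_commute)
    then have "local_position r k' u \<le> Edge (letter k) \<longleftrightarrow>
        1/2 \<le> r \<and> 1/4 \<le> u \<and> u \<le> 3/4 \<and> (k' = k \<or> k' = partner k)" if "0 \<le> u" "u < 1"
      using local_position_le_iff(3)[OF that, of r k' "letter k"] by (simp only:)
    then show ?thesis
      by auto
  qed
  moreover have "band k (1/4) (3/4) = {model (r, real k' + u) | r k' u. r \<in> {1/2..1} \<and> k' < 16 \<and> 0 \<le> u \<and> u < 1 \<and>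
     (k' = k \<and> 1/4 \<le> u \<and> u \<le> 3/4 \<or> k' = partner k \<and> 1 - 3/4 \<le> u \<and> u \<le> 1 - 1/4)}"
    using k by (intro band_eq) auto
  ultimately show ?thesis
    unfolding model_piece_eq by (simp only:)
qed

definition base :: "complex \<times> complex \<times> real" where
  "base = model (1, 0)"

lemma model_Ints: "s \<in> \<int> \<Longrightarrow> model (1, s) = base"
  unfolding base_def by (simp add: model_eq_iff wedge_path_eq_iff)

lemma Ints_of_nat_add_iff: "real k + u \<in> \<int> \<longleftrightarrow> u \<in> \<int>"
proof
  assume "real k + u \<in> \<int>"
  from Ints_diff[OF this Ints_of_nat[of k]] show "u \<in> \<int>"
    by simp
qed simp

lemma unit_Ints: "u \<in> \<int> \<Longrightarrow> 0 \<le> u \<Longrightarrow> u < 1 \<Longrightarrow> u = (0::real)"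
  using Ints_abs_less_1[of u] by simp

lemma model_boundary_eq:
  assumes k: "k < 16" "l < 16" and u: "0 \<le> u" "u < 1" "0 \<le> v" "v < 1"
    and eq: "model (1, real k + u) = model (1, real l + v)"
  shows "u = 0 \<and> v = 0 \<or> k = l \<and> u = v \<or> l = partner k \<and> v = 1 - u"
proof -
  have "wedge_path (real k + u) = wedge_path (real l + v)"
    using eq by (simp add: model_eq_iff)
  then consider "u \<in> \<int>" "v \<in> \<int>" | "k = l" "u - v \<in> \<int>" | "l = partner k" "u + v \<in> \<int>"
    unfolding wedge_path_eq_iff side_frac_nonneg(1)[OF k(1) u(1,2)] side_frac_nonneg(1)[OF k(2) u(3,4)]
  proof (elim disjE conjE)
    assume "real k + u \<in> \<int>" "real l + v \<in> \<int>"
    then show thesis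
      using that(1) by (simp only: Ints_of_nat_add_iff)
  next
    assume "k = l" "real k + u - (real l + v) \<in> \<int>"
    then show thesis
      using that(2) by simp
  next
    assume l: "l = partner k" and "real k + u + (real l + v) \<in> \<int>"
    then have "real (k + l) + (u + v) \<in> \<int>"
      by (simp add: algebra_simps)
    then show thesis
      using that(3) l by (simp only: Ints_of_nat_add_iff)
  qed
  then show ?thesis
  proof cases
    case 1
    then show ?thesis
      using unit_Ints u by blast
  next
    case 2
    then have "u - v = 0"
      using u by (intro Ints_abs_less_1) auto
    then show ?thesis
      using 2 by simp
  next
    case 3
    show ?thesis
    proof (cases "u + v = 0")
      case False
      have "u + v - 1 \<in> \<int>"
        using 3(2) by simp
      then have "u + v - 1 = 0"
        using u False by (intro Ints_abs_less_1) auto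
      then show ?thesis
        using 3 by auto
    qed (use u in auto)
  qed
qed

lemma model_interior_eq:
  assumes k: "k < 16" "l < 16" and u: "0 \<le> u" "u < 1" "0 \<le> v" "v < 1" and r: "0 < r" "r < 1" "r' \<in> {0..1}"
    and eq: "model (r, real k + u) = model (r', real l + v)"
  shows "k = l \<and> u = v"
proof -
  have "((real k + u) - (real l + v)) / 16 \<in> \<int>"
    using eq r model_eq_iff[of r r'] by auto
  then have "((real k + u) - (real l + v)) / 16 = 0"
    using k u by (intro Ints_abs_less_1) auto
  then have eq: "real k + u = real l + v"
    by simp
  then have "k = l"
    using side_frac_nonneg(1)[OF k(1) u(1,2)] side_frac_nonneg(1)[OF k(2) u(3,4)] by simp
  with eq show ?thesis
    by simp
qed

text \<open>The corner that follows corner \<open>k\<close> on a small loop around the vertex of the surface.\<close>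

definition next_corner :: "nat \<Rightarrow> nat" where
  "next_corner k = (partner k + 1) mod 16"

text \<open>Inside the polygon different sectors are disjoint. On its boundary the first quarter of
  side \<open>k\<close> is glued to the last quarter of the partner side, which belongs to the
  corner following that side, namely \<open>next_corner k\<close>.\<close>

lemma corner_piece_Int_subset:
  assumes k: "k < 16" "m < 16" "k \<noteq> m" and x: "x \<in> corner_piece k" "x \<in> corner_piece m"
  shows "x = base \<or> m = next_corner k \<and> x \<in> edge_start k \<or> k = next_corner m \<and> x \<in> edge_start m"
proof -
  obtain r k1 u where 1: "x = model (r, real k1 + u)" "r \<in> {1/2..1}" "k1 < 16" "0 \<le> u" "u < 1"
    "k1 = k \<and> u \<le> 1/4 \<or> (k1 + 1) mod 16 = k \<and> 3/4 \<le> u"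
    using x(1) unfolding corner_piece_def rect_def model_corner_image[OF k(1)] by blast
  obtain r' k2 v where 2: "x = model (r', real k2 + v)" "r' \<in> {1/2..1}" "k2 < 16" "0 \<le> v" "v < 1"
    "k2 = m \<and> v \<le> 1/4 \<or> (k2 + 1) mod 16 = m \<and> 3/4 \<le> v"
    using x(2) unfolding corner_piece_def rect_def model_corner_image[OF k(2)] by blast
  have neq: "\<not> (k1 = k2 \<and> u = v)"
    using 1(6) 2(6) k(3) by auto
  have "r = 1"
  proof (rule ccontr)
    assume "r \<noteq> 1"
    then have "k1 = k2 \<and> u = v"
      using 1 2 by (intro model_interior_eq[of k1 k2 u v r r']) auto
    with neq show False
      by simp
  qed
  moreover from this have "r' = 1"
    using 1 2 model_eq_iff[of r r' "real k1 + u" "real k2 + v"] by auto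
  ultimately have eq: "model (1, real k1 + u) = model (1, real k2 + v)"
    using 1 2 by simp
  consider "u = 0" | "u \<noteq> 0" "k2 = partner k1" "v = 1 - u"
    using model_boundary_eq[OF 1(3) 2(3) 1(4,5) 2(4,5) eq] neq by blast
  then show ?thesis
  proof cases
    case 1
    then show ?thesis
      using model_Ints[of "real k1"] \<open>x = model (r, real k1 + u)\<close> \<open>r = 1\<close> by simp
  next
    case opposite: 2
    from 1(6) show ?thesis
    proof (elim disjE conjE)
      assume k1: "k1 = k" "u \<le> 1/4"
      then have "m = next_corner k"
        using 2(6) opposite by (auto simp: next_corner_def)
      moreover have "x \<in> edge_start k"
        unfolding edge_start_def rect_def using 1 k1 \<open>r = 1\<close> by auto
      ultimately show ?thesis
        by blast
    next
      assume k1: "(k1 + 1) mod 16 = k" "3/4 \<le> u"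
      then have k2: "k2 = m"
        using 2(6) opposite by auto
      then have "partner m = k1"
        using opposite(2) by auto
      then have "k = next_corner m"
        using k1 by (simp add: next_corner_def)
      moreover have "x \<in> edge_start m"
        unfolding edge_start_def rect_def using 2 k1(2) k2 opposite(3) \<open>r' = 1\<close> by auto
      ultimately show ?thesis
        by blast
    qed
  qed
qed

lemma edge_start_subset:
  assumes "k < 16"
  shows "edge_start k \<subseteq> corner_piece k" "edge_start k \<subseteq> corner_piece (next_corner k)"
proof -
  show "edge_start k \<subseteq> corner_piece k"
    unfolding edge_start_def corner_piece_def rect_def by (intro image_mono) auto
  show "edge_start k \<subseteq> corner_piece (next_corner k)"
  proof
    fix x assume "x \<in> edge_start k"
    then obtain s where s: "x = model (1, s)" "s \<in> {real k..real k + 1/4}"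
      unfolding edge_start_def rect_def by auto
    define u where "u = s - real k"
    have u: "0 \<le> u" "u \<le> 1/4" and x: "x = model (1, real k + u)"
      using s by (auto simp: u_def)
    have "x = model (1, real (partner k) + (1 - u))"
      using x model_glue[OF assms, of u] u by simp
    also have "\<dots> = model (1, real (next_corner k) + (1 - u - 1))"
      unfolding next_corner_def by (rule model_corner_wrap[OF partner_less_16[OF assms]])
    finally show "x \<in> corner_piece (next_corner k)"
      unfolding corner_piece_def rect_def using u by (auto intro!: image_eqI)
  qed
qed

lemma base_in_edge_start: "base \<in> edge_start k"
  unfolding edge_start_def rect_def using model_Ints[of "real k"]
  by (intro image_eqI[where x = "(1, real k)"]) auto

lemma edge_start_Int:
  assumes "k < 16" "l < 16" "k \<noteq> l"
  shows "edge_start k \<inter> edge_start l = {base}"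
proof
  show "edge_start k \<inter> edge_start l \<subseteq> {base}"
  proof
    fix x assume x: "x \<in> edge_start k \<inter> edge_start l"
    have param: "\<exists>s\<in>{real j..real j + 1/4}. x = model (1, s)" if "x \<in> edge_start j" for j
      using that unfolding edge_start_def rect_def by auto
    obtain s where s: "x = model (1, s)" "s \<in> {real k..real k + 1/4}"
      using param[of k] x by blast
    obtain t where t: "x = model (1, t)" "t \<in> {real l..real l + 1/4}"
      using param[of l] x by blast
    define u v where "u = s - real k" and "v = t - real l"
    have u: "0 \<le> u" "u \<le> 1/4" "x = model (1, real k + u)" and v: "0 \<le> v" "v \<le> 1/4" "x = model (1, real l + v)"
      using s t by (auto simp: u_def v_def)
    have "u = 0"
      using model_boundary_eq[OF assms(1,2), of u v] u v assms(3) by auto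
    then show "x \<in> {base}"
      using u(3) model_Ints[of "real k"] by simp
  qed
qed (use base_in_edge_start in auto)

text \<open>The corners in their order around the vertex: 0, 3, 2, 1, 4, 7, 6, 5, and so on, that
  is, each commutator contributes its four corners with the last three reversed. That this is a
  single cycle through all sixteen shows that the polygon has only one vertex after gluing.\<close>

definition corner_order :: "nat \<Rightarrow> nat" where
  "corner_order n = 4 * (n div 4) + (4 - n mod 4) mod 4"

lemma corner_order_facts:
  "\<forall>n\<in>{..<16}. corner_order n < 16 \<and> corner_order (corner_order n) = n \<and>
     next_corner (corner_order n) = corner_order ((n + 1) mod 16)"
  by (simp add: lessThan_nat_numeral lessThan_Suc corner_order_def next_corner_def partner_def)

lemma corner_order_less: "n < 16 \<Longrightarrow> corner_order n < 16"
  and corner_order_invol: "n < 16 \<Longrightarrow> corner_order (corner_order n) = n"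
  and next_corner_order: "n < 16 \<Longrightarrow> next_corner (corner_order n) = corner_order ((n + 1) mod 16)"
  using corner_order_facts by auto

lemma AR_corner_piece: "AR (corner_piece m)" "compact (corner_piece m)"
  unfolding corner_piece_def by (auto intro: AR_rect compact_rect)

lemma AR_edge_start: "AR (edge_start m)" "compact (edge_start m)"
  unfolding edge_start_def by (auto intro: AR_rect compact_rect)

text \<open>The sectors are added in their order around the vertex. A new sector meets the union of
  the earlier ones in the arc it shares with its predecessor; with other sectors it has only the
  vertex itself in common, until the circle closes.\<close>

lemma AR_model_piece_Vertex: "AR (model_piece Vertex)" "compact (model_piece Vertex)"
proof -
  define A where "A n = corner_piece (corner_order n)" for n
  have "corner_order ` {..15} = {..<16}"
  proof
    show "{..<16} \<subseteq> corner_order ` {..15}"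
    proof
      fix n :: nat assume "n \<in> {..<16}"
      then show "n \<in> corner_order ` {..15}"
        using corner_order_invol[of n] corner_order_less[of n] by (intro image_eqI[of _ _ "corner_order n"]) auto
    qed
  qed (use corner_order_less in auto)
  then have eq: "model_piece Vertex = (\<Union>n\<le>15. A n)"
    unfolding model_piece_Vertex A_def by (metis SUP_image comp_apply image_image)
  have "AR (\<Union>n\<le>15. A n)"
  proof (rule AR_UN_atMost)
    fix n :: nat assume n: "n < 15"
    have inj: "i = j" if "corner_order i = corner_order j" "i < 16" "j < 16" for i j
      using that corner_order_invol by metis
    have sub: "edge_start (corner_order n) \<subseteq> (\<Union>i\<le>n. A i) \<inter> A (Suc n)"
      using edge_start_subset[OF corner_order_less[of n]] next_corner_order[of n] n
      by (auto simp: A_def)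
    have cases: "i = n \<and> x \<in> edge_start (corner_order n) \<or> x = base \<or>
        i = 0 \<and> n = 14 \<and> x \<in> edge_start (corner_order 15)"
      if x: "i \<le> n" "x \<in> A i" "x \<in> A (Suc n)" for i x
    proof -
      have lt: "i < 16" "Suc n < 16"
        using x(1) n by auto
      have "corner_order i \<noteq> corner_order (Suc n)"
        using inj[of i "Suc n"] lt x(1) by auto
      then have "x = base \<or> corner_order (Suc n) = next_corner (corner_order i) \<and> x \<in> edge_start (corner_order i)
         \<or> corner_order i = next_corner (corner_order (Suc n)) \<and> x \<in> edge_start (corner_order (Suc n))"
        using x(2,3) corner_order_less lt by (intro corner_piece_Int_subset) (auto simp: A_def)
      then show ?thesis
      proof (elim disjE conjE)
        assume "corner_order (Suc n) = next_corner (corner_order i)" and xe: "x \<in> edge_start (corner_order i)"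
        then have "Suc n = (i + 1) mod 16"
          using inj[of "Suc n" "(i + 1) mod 16"] next_corner_order[of i] lt by simp
        then have "i = n"
          using x(1) n by simp
        with xe show ?thesis
          by simp
      next
        assume "corner_order i = next_corner (corner_order (Suc n))" and xe: "x \<in> edge_start (corner_order (Suc n))"
        then have i: "i = (Suc n + 1) mod 16"
          using inj[of i "(Suc n + 1) mod 16"] next_corner_order[of "Suc n"] lt by simp
        have "n = 14"
        proof (rule ccontr)
          assume "n \<noteq> 14"
          then have "i = Suc n + 1"
            using i n by simp
          with x(1) show False
            by simp
        qed
        with i xe show ?thesis
          by simp
      qed simp
    qed
    show "AR ((\<Union>i\<le>n. A i) \<inter> A (Suc n))"
    \<comment> \<open>The last sector also borders on the first one, and the intersection consists
      of two arcs joined at the vertex.\<close>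
    proof (cases "n = 14")
      case True
      have "edge_start (corner_order 15) \<subseteq> A 0 \<inter> A 15"
        using edge_start_subset[OF corner_order_less[of 15]] next_corner_order[of 15] by (auto simp: A_def)
      then have "edge_start (corner_order 15) \<subseteq> (\<Union>i\<le>n. A i) \<inter> A (Suc n)"
        using True by auto
      moreover have "x \<in> edge_start (corner_order 14) \<union> edge_start (corner_order 15)"
        if x: "x \<in> (\<Union>i\<le>n. A i) \<inter> A (Suc n)" for x
      proof -
        obtain i where "i \<le> n" "x \<in> A i" "x \<in> A (Suc n)"
          using x by blast
        from cases[OF this] show ?thesis
          using base_in_edge_start True by blast
      qed
      ultimately have "(\<Union>i\<le>n. A i) \<inter> A (Suc n) = edge_start (corner_order 14) \<union> edge_start (corner_order 15)"
        using sub True by blast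
      moreover have "AR (edge_start (corner_order 14) \<union> edge_start (corner_order 15))"
      proof (intro AR_Un_compact AR_edge_start)
        have "edge_start (corner_order 14) \<inter> edge_start (corner_order 15) = {base}"
          using inj[of 14 15] by (intro edge_start_Int corner_order_less) auto
        then show "AR (edge_start (corner_order 14) \<inter> edge_start (corner_order 15))"
          by (simp add: convex_imp_AR)
      qed
      ultimately show ?thesis
        by simp
    next
      case False
      have "x \<in> edge_start (corner_order n)" if x: "x \<in> (\<Union>i\<le>n. A i) \<inter> A (Suc n)" for x
      proof -
        obtain i where "i \<le> n" "x \<in> A i" "x \<in> A (Suc n)"
          using x by blast
        from cases[OF this] show ?thesis
          using base_in_edge_start False by blast
      qed
      then have "(\<Union>i\<le>n. A i) \<inter> A (Suc n) = edge_start (corner_order n)"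
        using sub by blast
      then show ?thesis
        by (simp add: AR_edge_start)
    qed
  qed (auto simp: A_def AR_corner_piece)
  then show "AR (model_piece Vertex)"
    by (simp only: eq)
  show "compact (model_piece Vertex)"
    unfolding model_piece_Vertex by (intro compact_UN AR_corner_piece) auto
qed

lemma model_piece_Face: "model_piece Face = model ` ({0..1/2} \<times> {0..16})"
proof
  show "model_piece Face \<subseteq> model ` ({0..1/2} \<times> {0..16})"
  proof
    fix x assume "x \<in> model_piece Face"
    then obtain r k u where "x = model (r, real k + u)" "r \<in> {0..1/2}" "k < 16" "0 \<le> u" "u < 1"
      unfolding model_piece_eq using local_position_le_iff(1) by fastforce
    then show "x \<in> model ` ({0..1/2} \<times> {0..16})"
      by (intro image_eqI[where x = "(r, real k + u)"]) auto
  qed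
  show "model ` ({0..1/2} \<times> {0..16}) \<subseteq> model_piece Face"
  proof
    fix x assume "x \<in> model ` ({0..1/2} \<times> {0..16})"
    then obtain r s where x: "x = model (r, s)" "r \<in> {0..1/2}"
      by blast
    then have "position (r, s) \<le> Face"
      using local_position_le_iff(1)[OF frac_ge_0 frac_lt_1, of r "side s" s]
      unfolding position_def fst_conv snd_conv atLeastAtMost_iff by blast
    then show "x \<in> model_piece Face"
      using x model_mem_piece_iff[of r s Face] by auto
  qed
qed

text \<open>The middle coordinate maps the face disc homeomorphically onto the round disc of radius
  1/4, because \<open>r * (1 - r)\<close> increases from 0 to 1/4 as \<open>r\<close> runs from 0 to
  1/2.\<close>

lemma AR_model_piece_Face: "AR (model_piece Face)" "compact (model_piece Face)"
proof -
  show comp: "compact (model_piece Face)"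
    unfolding model_piece_Face by (intro compact_continuous_image continuous_on_model compact_Times) auto
  define f :: "complex \<times> complex \<times> real \<Rightarrow> complex" where "f x = fst (snd x)" for x
  have f: "f (model (r, s)) = of_real (r * (1 - r)) * cis (2 * pi * (s / 16))" for r s
    by (simp add: f_def model_def)
  have mono: "r = r'" if "r * (1 - r) = r' * (1 - r')" "r \<in> {0..1/2}" "r' \<in> {0..1/2}" for r r' :: real
  proof -
    have "(r - r') * (1 - r - r') = 0"
      using that(1) by (simp add: algebra_simps)
    then show ?thesis
      using that(2,3) by auto
  qed
  have bound: "0 \<le> r * (1 - r)" "r * (1 - r) \<le> 1/4" if "r \<in> {0..1/2}" for r :: real
  proof -
    show "0 \<le> r * (1 - r)"
      using that by auto
    have "0 \<le> (r - 1/2)\<^sup>2"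
      by simp
    then show "r * (1 - r) \<le> 1/4"
      by (simp add: power2_eq_square algebra_simps)
  qed
  have "f ` model_piece Face = cball 0 (1/4)"
  proof
    show "f ` model_piece Face \<subseteq> cball 0 (1/4)"
      unfolding model_piece_Face
    proof
      fix w assume "w \<in> f ` model ` ({0..1/2} \<times> {0..16})"
      then obtain r s where "w = f (model (r, s))" "r \<in> {0..1/2}"
        by blast
      then show "w \<in> cball 0 (1/4)"
        using bound[of r] unfolding f by (simp add: norm_mult del: of_real_mult)
    qed
    show "cball 0 (1/4) \<subseteq> f ` model_piece Face"
    proof
      fix w :: complex assume "w \<in> cball 0 (1/4)"
      then have w: "norm w \<le> 1/4"
        by simp
      \<comment> \<open>The smaller root of the equation \<open>r * (1 - r) = norm w\<close> is
        \<open>(1 - q) / 2\<close>.\<close>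
      define q where "q = sqrt (1 - 4 * norm w)"
      define r where "r = (1 - q) / 2"
      have q: "q\<^sup>2 = 1 - 4 * norm w" "0 \<le> q" "q \<le> 1"
        using w by (auto simp: q_def)
      then have r: "r * (1 - r) = norm w" "r \<in> {0..1/2}"
        by (auto simp: r_def power2_eq_square field_simps)
      define s where "s = 16 * (Arg2pi w / (2 * pi))"
      have "cis (2 * pi * (s / 16)) = cis (Arg2pi w)"
        by (simp add: s_def)
      then have "f (model (r, s)) = w"
        unfolding f r(1) using Arg2pi[of w] by (simp add: is_Arg_def cis_conv_exp)
      moreover have "s \<in> {0..16}"
        using Arg2pi[of w] by (auto simp: s_def field_simps)
      ultimately show "w \<in> f ` model_piece Face"
        unfolding model_piece_Face using r(2)
        by (intro image_eqI[where x = "model (r, s)"]) auto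
    qed
  qed
  moreover have "inj_on f (model_piece Face)"
  proof (rule inj_onI)
    fix x y assume "x \<in> model_piece Face" "y \<in> model_piece Face" and eq: "f x = f y"
    then obtain r s r' s' where x: "x = model (r, s)" "r \<in> {0..1/2}" and y: "y = model (r', s')" "r' \<in> {0..1/2}"
      unfolding model_piece_Face by auto
    have "norm (f x) = r * (1 - r)" "norm (f y) = r' * (1 - r')"
      unfolding x(1) y(1) f using bound[of r] bound[of r'] x(2) y(2) by (simp_all add: norm_mult del: of_real_mult)
    then have r: "r = r'"
      using eq mono[OF _ x(2) y(2)] by simp
    show "x = y"
    proof (cases "r = 0")
      case True
      then show ?thesis
        using r x y by (simp add: model_eq_iff)
    next
      case False
      then have "r * (1 - r) \<noteq> 0"
        using x(2) by auto
      then have "cis (2 * pi * (s / 16)) = cis (2 * pi * (s' / 16))"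
        using eq unfolding x(1) y(1) f r by (simp del: of_real_mult)
      then have "(s - s') / 16 \<in> \<int>"
        unfolding cis_two_pi_eq_iff by (simp add: diff_divide_distrib)
      then show ?thesis
        using r x y by (auto simp: model_eq_iff)
    qed
  qed
  moreover have "continuous_on (model_piece Face) f"
    unfolding f_def by (intro continuous_intros)
  ultimately have "model_piece Face homeomorphic cball (0 :: complex) (1/4)"
    using comp by (intro homeomorphic_compact)
  moreover have "AR (cball (0 :: complex) (1/4))"
    by (intro convex_imp_AR) auto
  ultimately show "AR (model_piece Face)"
    using homeomorphic_AR_iff_AR by blast
qed

lemma model_piece_compact_AR:
  assumes "i \<in> pieces"
  shows "compact (model_piece i) \<and> AR (model_piece i)"
proof -
  have letter: "\<exists>k<16. j = letter k" if "j < 8" for j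
  proof (cases "even j")
    case True
    then obtain q where "j = 2 * q" ..
    then show ?thesis
      using that letter_eq(1)[of q] by (intro exI[of _ "4 * q"]) simp
  next
    case False
    then obtain q where "j = 2 * q + 1"
      by (rule oddE)
    then show ?thesis
      using that letter_eq(2)[of q] by (intro exI[of _ "4 * q + 1"]) simp
  qed
  show ?thesis
  proof (cases i)
    case (Edge j)
    then have "j < 8"
      using assms by (auto simp: pieces_def)
    then obtain k where "k < 16" "j = letter k"
      using letter by blast
    then show ?thesis
      by (simp add: Edge model_piece_Edge compact_band AR_band)
  next
    case (VertexEdge k)
    then have "k < 16"
      using assms by (auto simp: pieces_def)
    then show ?thesis
      by (simp add: VertexEdge model_piece_VertexEdge compact_band AR_band)
  next
    case (EdgeFace k)
    then have "k < 16"
      using assms by (auto simp: pieces_def)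
    then show ?thesis
      by (simp add: EdgeFace model_piece_EdgeFace compact_rect AR_rect)
  next
    case (VertexFace k)
    then have "k < 16"
      using assms by (auto simp: pieces_def)
    then show ?thesis
      by (simp add: VertexFace model_piece_VertexFace compact_rect AR_rect)
  next
    case (Corner k b)
    then have "k < 16"
      using assms by (auto simp: pieces_def)
    then show ?thesis
      by (simp add: Corner model_piece_Corner compact_rect AR_rect)
  qed (simp_all add: AR_model_piece_Vertex AR_model_piece_Face)
qed

theorem AR_cover_model_surface: "AR_cover pieces model_surface model_piece"
  unfolding AR_cover_def
proof (intro conjI ballI)
  fix i assume i: "i \<in> pieces"
  have "model_piece i \<subseteq> model_surface"
    unfolding model_piece_def model_surface_def by blast
  then show "closedin (top_of_set model_surface) (model_piece i)" "AR (model_piece i)"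
    using model_piece_compact_AR[OF i] by (auto intro!: closed_subset compact_imp_closed)
qed (use finite_pieces model_surface_strata in auto)

section \<open>The 16-gon in polar coordinates\<close>

definition vert :: "int \<Rightarrow> complex" where
  "vert k = cis (2 * pi * (of_int k / 16))"

definition boundary :: "real \<Rightarrow> complex" where
  "boundary s = linepath (vert \<lfloor>s\<rfloor>) (vert (\<lfloor>s\<rfloor> + 1)) (frac s)"

definition polar_map :: "real \<times> real \<Rightarrow> complex" where
  "polar_map z = fst z *\<^sub>R boundary (snd z)"

lemma vert_periodic: "vert (k + 16 * m) = vert k"
  unfolding vert_def cis_two_pi_eq_iff by (simp add: add_divide_distrib)

lemma vert_mod: "vert (k mod 16) = vert k"
proof -
  have "vert (k mod 16 + 16 * (k div 16)) = vert (k mod 16)"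
    by (rule vert_periodic)
  then show ?thesis
    by simp
qed

lemma polygon_vertex_eq: "polygon_vertex 4 m = vert (int m)"
  by (simp add: polygon_vertex_def vert_def)

lemma vert_neq_Suc: "vert k \<noteq> vert (k + 1)"
proof
  assume "vert k = vert (k + 1)"
  then have "of_int k / 16 - of_int (k + 1) / 16 \<in> (\<int> :: real set)"
    unfolding vert_def cis_two_pi_eq_iff .
  then have "of_int k / 16 - of_int (k + 1) / 16 = (0 :: real)"
    by (rule Ints_abs_less_1) (simp add: add_divide_distrib)
  then show False
    by (simp add: add_divide_distrib)
qed

lemma boundary_eq:
  assumes "of_int k \<le> s" "s \<le> of_int k + 1"
  shows "boundary s = linepath (vert k) (vert (k + 1)) (s - of_int k)"
proof (cases "s = of_int k + 1")
  case True
  then have "s = of_int (k + 1)"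
    by simp
  then have "\<lfloor>s\<rfloor> = k + 1" "frac s = 0"
    by (simp_all only: floor_of_int frac_of_int)
  then show ?thesis
    using True by (simp add: boundary_def linepath_def)
next
  case False
  with assms have "\<lfloor>s\<rfloor> = k"
    by (simp add: floor_eq_iff)
  then show ?thesis
    by (simp add: boundary_def frac_def)
qed

lemma continuous_on_boundary: "continuous_on UNIV boundary"
proof (rule continuous_on_UNIV_if_unit_intervals)
  fix k :: int
  have "continuous_on {of_int k..of_int k + 1} (\<lambda>s. linepath (vert k) (vert (k + 1)) (s - of_int k))"
    unfolding linepath_def by (intro continuous_intros)
  then show "continuous_on {of_int k..of_int k + 1} boundary"
    by (rule continuous_on_eq) (auto simp: boundary_eq[of k])
qed

lemma continuous_on_polar_map: "continuous_on S polar_map"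
  unfolding polar_map_def
  by (intro continuous_intros continuous_on_compose2[OF continuous_on_boundary]) auto

lemma boundary_periodic: "boundary (s + 16 * of_int m) = boundary s"
proof -
  have "\<lfloor>s + 16 * of_int m\<rfloor> = \<lfloor>s\<rfloor> + 16 * m"
    using floor_add_int[of s "16 * m"] by simp
  moreover have "\<lfloor>s\<rfloor> + 16 * m + 1 = (\<lfloor>s\<rfloor> + 1) + 16 * m"
    by simp
  moreover have "frac (s + 16 * of_int m) = frac s"
    by (simp add: frac_eq_iff)
  ultimately show ?thesis
    unfolding boundary_def by (simp only: vert_periodic)
qed

lemma polar_map_periodic: "polar_map (r, s + 16 * of_int m) = polar_map (r, s)"
  by (simp add: polar_map_def boundary_periodic)

lemma polygon_side_eq:
  assumes "0 \<le> t" "t \<le> 1"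
  shows "polygon_side 4 m t = boundary (real m + t)"
proof -
  have "boundary (real m + t) = linepath (vert (int m)) (vert (int m + 1)) (real m + t - of_int (int m))"
    using assms by (intro boundary_eq) auto
  then show ?thesis
    by (simp add: polygon_side_def polygon_vertex_eq add.commute)
qed

text \<open>\<open>height k\<close> is the linear functional that is \<open>1\<close> on side \<open>k\<close> of the polygon.\<close>

definition height :: "int \<Rightarrow> complex \<Rightarrow> real" where
  "height k z = inner (cis (pi / 8 * (of_int k + 1/2))) z / cos (pi / 16)"

lemma cos_pi_16_pos: "0 < cos (pi / 16)"
  by (intro cos_gt_zero_pi) (use pi_gt_zero in linarith)+

lemma height_linear: "height k (x + y) = height k x + height k y" "height k (a *\<^sub>R x) = a * height k x"
  by (simp_all add: height_def inner_add_right add_divide_distrib)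

text \<open>These are the angles from the midpoint direction of a side to the vertices. Modulo a
  full turn they are plus or minus \<open>pi / 16\<close> for its two ends and between
  \<open>3 * pi / 16\<close> and \<open>29 * pi / 16\<close> for the rest.\<close>

lemma cos_odd_multiple:
  fixes d :: int
  shows "cos (pi / 8 * (of_int d - 1/2)) \<le> cos (pi / 16)"
    and "cos (pi / 8 * (of_int d - 1/2)) = cos (pi / 16) \<longleftrightarrow> d mod 16 \<in> {0, 1}"
proof -
  define e where "e = d mod 16"
  have e: "0 \<le> e" "e < 16"
    by (simp_all add: e_def)
  have "of_int d = (of_int e + 16 * of_int (d div 16) :: real)"
    unfolding e_def by (metis mod_mult_div_eq of_int_add of_int_mult of_int_numeral)
  then have "pi / 8 * (of_int d - 1/2) = pi / 8 * (of_int e - 1/2) + (2 * pi) * of_int (d div 16)"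
    by (simp add: field_simps)
  then have red: "cos (pi / 8 * (of_int d - 1/2)) = cos (pi / 8 * (of_int e - 1/2))"
    by (simp add: cos_add cos_int_2pin sin_int_2pin del: times_divide_eq_left)
  have eq: "cos (pi / 8 * (of_int e - 1/2)) = cos (pi / 16)" if "e \<in> {0, 1}"
  proof -
    have "pi / 8 * (of_int e - 1/2) = - (pi / 16) \<or> pi / 8 * (of_int e - 1/2) = pi / 16"
      using that by auto
    then show ?thesis
      by (elim disjE) (simp_all only: cos_minus)
  qed
  have less: "cos (pi / 8 * (of_int e - 1/2)) < cos (pi / 16)" if "e \<notin> {0, 1}"
  proof -
    define x where "x = pi / 8 * (of_int e - 1/2)"
    have "2 \<le> e" "e \<le> 15"
      using that e by auto
    then have "(2 :: real) \<le> of_int e" "(of_int e :: real) \<le> 15"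
      by simp_all
    then have "pi / 8 * (2 - 1/2) \<le> x" "x \<le> pi / 8 * (15 - 1/2)"
      unfolding x_def by (intro mult_left_mono; simp)+
    then have "3 * pi / 16 \<le> x" "x \<le> 29 * pi / 16"
      by simp_all
    then have x: "pi / 16 < x" "x < 2 * pi - pi / 16"
      using pi_gt_zero by linarith+
    have "cos x < cos (pi / 16)"
    proof (cases "x \<le> pi")
      case True
      then show ?thesis
        using x pi_gt_zero by (intro cos_monotone_0_pi) auto
    next
      case False
      then have "cos (2 * pi - x) < cos (pi / 16)"
        using x pi_gt_zero by (intro cos_monotone_0_pi) auto
      then show ?thesis
        by (simp add: cos_diff)
    qed
    then show ?thesis
      by (simp add: x_def)
  qed
  show "cos (pi / 8 * (of_int d - 1/2)) \<le> cos (pi / 16)"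
    unfolding red using eq less by (cases "e \<in> {0, 1}") auto
  show "cos (pi / 8 * (of_int d - 1/2)) = cos (pi / 16) \<longleftrightarrow> d mod 16 \<in> {0, 1}"
    unfolding red e_def[symmetric] using eq less by (cases "e \<in> {0, 1}") auto
qed

lemma height_vert_eq: "height k (vert m) = cos (pi / 8 * (of_int (m - k) - 1/2)) / cos (pi / 16)"
proof -
  have "inner (cis a) (cis b) = cos (b - a)" for a b
    by (simp add: inner_complex_def cos_diff algebra_simps)
  moreover have "2 * pi * (of_int m / 16) - pi / 8 * (of_int k + 1/2) = pi / 8 * (of_int (m - k) - 1/2)"
    by (simp add: field_simps)
  ultimately show ?thesis
    by (simp only: height_def vert_def)
qed

lemma height_vert_le: "height k (vert m) \<le> 1"
  unfolding height_vert_eq using cos_odd_multiple(1)[of "m - k"] cos_pi_16_pos by simp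

lemma height_vert_eq_1_iff: "height k (vert m) = 1 \<longleftrightarrow> (m - k) mod 16 \<in> {0, 1}"
proof -
  have "x / cos (pi / 16) = 1 \<longleftrightarrow> x = cos (pi / 16)" for x
    using cos_pi_16_pos by auto
  then show ?thesis
    unfolding height_vert_eq by (simp only: cos_odd_multiple(2))
qed

lemma height_boundary:
  "height k (boundary s) =
     (1 - frac s) * height k (vert \<lfloor>s\<rfloor>) + frac s * height k (vert (\<lfloor>s\<rfloor> + 1))"
  by (simp add: boundary_def linepath_def height_linear)

lemma height_boundary_le: "height k (boundary s) \<le> 1"
proof -
  have "(1 - frac s) * height k (vert \<lfloor>s\<rfloor>) \<le> (1 - frac s) * 1"
    using height_vert_le frac_lt_1[of s] by (intro mult_left_mono) auto
  moreover have "frac s * height k (vert (\<lfloor>s\<rfloor> + 1)) \<le> frac s * 1"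
    using height_vert_le by (intro mult_left_mono) auto
  ultimately show ?thesis
    unfolding height_boundary using add_mono by fastforce
qed

lemma height_boundary_own: "height \<lfloor>s\<rfloor> (boundary s) = 1"
proof -
  have "height \<lfloor>s\<rfloor> (vert \<lfloor>s\<rfloor>) = 1" "height \<lfloor>s\<rfloor> (vert (\<lfloor>s\<rfloor> + 1)) = 1"
    by (simp_all add: height_vert_eq_1_iff)
  then show ?thesis
    unfolding height_boundary by simp
qed

text \<open>A weighted mean of two heights that are at most 1 equals 1 only if each height with
  positive weight does, and a vertex has height 1 only at the two ends of side
  \<open>k\<close>.\<close>

lemma height_boundary_1:
  assumes "height k (boundary s) = 1"
  shows "(\<lfloor>s\<rfloor> - k) mod 16 = 0 \<or> frac s = 0 \<and> (\<lfloor>s\<rfloor> - k) mod 16 = 1"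
proof -
  have "(1 - frac s) * (1 - height k (vert \<lfloor>s\<rfloor>)) + frac s * (1 - height k (vert (\<lfloor>s\<rfloor> + 1))) = 0"
    using assms unfolding height_boundary by (simp add: algebra_simps)
  moreover have "0 \<le> (1 - frac s) * (1 - height k (vert \<lfloor>s\<rfloor>))"
    using height_vert_le[of k "\<lfloor>s\<rfloor>"] frac_lt_1[of s] by (intro mult_nonneg_nonneg) auto
  moreover have "0 \<le> frac s * (1 - height k (vert (\<lfloor>s\<rfloor> + 1)))"
    using height_vert_le[of k "\<lfloor>s\<rfloor> + 1"] by (intro mult_nonneg_nonneg) auto
  ultimately have "(1 - frac s) * (1 - height k (vert \<lfloor>s\<rfloor>)) = 0"
    "frac s * (1 - height k (vert (\<lfloor>s\<rfloor> + 1))) = 0"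
    by linarith+
  then have 1: "height k (vert \<lfloor>s\<rfloor>) = 1" and 2: "frac s = 0 \<or> height k (vert (\<lfloor>s\<rfloor> + 1)) = 1"
    using frac_lt_1[of s] by auto
  from 1 have "(\<lfloor>s\<rfloor> - k) mod 16 \<in> {0, 1}"
    by (simp only: height_vert_eq_1_iff)
  moreover have "frac s = 0" if "(\<lfloor>s\<rfloor> - k) mod 16 = 1"
  proof -
    have "(\<lfloor>s\<rfloor> + 1 - k) mod 16 = 2"
      using that by presburger
    then show ?thesis
      using 2 unfolding height_vert_eq_1_iff by auto
  qed
  ultimately show ?thesis
    by blast
qed

text \<open>Each of the two parameters describes a point on the side of the other one, so both have
  height 1 there. This forces equal sides modulo 16, and on a side the parametrisation is affine and
  injective.\<close>

lemma boundary_inj: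
  assumes eq: "boundary s = boundary t"
  shows "(s - t) / 16 \<in> \<int>"
proof -
  have st: "(\<lfloor>t\<rfloor> - \<lfloor>s\<rfloor>) mod 16 = 0 \<or> frac t = 0 \<and> (\<lfloor>t\<rfloor> - \<lfloor>s\<rfloor>) mod 16 = 1"
    using height_boundary_1[of "\<lfloor>s\<rfloor>" t] height_boundary_own[of s] eq by simp
  have ts: "(\<lfloor>s\<rfloor> - \<lfloor>t\<rfloor>) mod 16 = 0 \<or> frac s = 0 \<and> (\<lfloor>s\<rfloor> - \<lfloor>t\<rfloor>) mod 16 = 1"
    using height_boundary_1[of "\<lfloor>t\<rfloor>" s] height_boundary_own[of t] eq by simp
  \<comment> \<open>A difference of 1 in one direction is 15 in the other, so membership in
    \<open>{0, 1}\<close> both ways leaves only 0.\<close>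
  have *: "(a - b) mod 16 = 0" if "(b - a) mod 16 = 0 \<or> (b - a) mod 16 = 1"
    "(a - b) mod 16 = 0 \<or> (a - b) mod 16 = 1" for a b :: int
    using that by presburger
  have "(\<lfloor>s\<rfloor> - \<lfloor>t\<rfloor>) mod 16 = 0"
    by (rule *) (use st ts in blast)+
  then obtain m where m: "\<lfloor>s\<rfloor> = \<lfloor>t\<rfloor> + 16 * m"
    by (metis add.commute diff_add_cancel mod_eq_0_iff_dvd dvd_def)
  have "vert \<lfloor>s\<rfloor> = vert \<lfloor>t\<rfloor>" "vert (\<lfloor>s\<rfloor> + 1) = vert (\<lfloor>t\<rfloor> + 1)"
    using vert_periodic[of "\<lfloor>t\<rfloor>" m] vert_periodic[of "\<lfloor>t\<rfloor> + 1" m] by (simp_all add: m algebra_simps)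
  then have "(frac s - frac t) *\<^sub>R (vert (\<lfloor>t\<rfloor> + 1) - vert \<lfloor>t\<rfloor>) = 0"
    using eq by (simp add: boundary_def linepath_def algebra_simps)
  then have "frac s = frac t"
    using vert_neq_Suc[of "\<lfloor>t\<rfloor>"] by auto
  then have "s - t = 16 * of_int m"
    using m by (simp add: frac_def)
  then show ?thesis
    by simp
qed

text \<open>The radius is the greatest height of a point: it is attained for the point's own side,
  and every boundary point has height at most 1 for any side. Away from the centre
  \<open>boundary_inj\<close> then determines the parameter.\<close>

lemma polar_map_eq_imp_model_eq:
  assumes r: "r \<in> {0..1}" "r' \<in> {0..1}" and eq: "polar_map (r, s) = polar_map (r', s')"
  shows "model (r, s) = model (r', s')"
proof -
  have le: "q \<le> q'" if "polar_map (q, t) = polar_map (q', t')" "q' \<in> {0..1}" for q q' t t'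
  proof -
    have "q = height \<lfloor>t\<rfloor> (polar_map (q, t))"
      by (simp add: polar_map_def height_linear height_boundary_own)
    also have "\<dots> = q' * height \<lfloor>t\<rfloor> (boundary t')"
      unfolding that(1) by (simp add: polar_map_def height_linear)
    also have "\<dots> \<le> q' * 1"
      using that(2) height_boundary_le by (intro mult_left_mono) auto
    finally show ?thesis
      by simp
  qed
  have rr: "r = r'"
    using le[OF eq r(2)] le[OF eq[symmetric] r(1)] by simp
  show ?thesis
  proof (cases "r = 0")
    case True
    then show ?thesis
      using rr by (simp add: model_eq_iff)
  next
    case False
    then have "boundary s = boundary s'"
      using eq rr by (simp add: polar_map_def)
    then obtain m where "(s - s') / 16 = of_int m"
      using boundary_inj Ints_cases by blast
    then have "s = s' + 16 * of_int m"
      by (simp add: field_simps)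
    then show ?thesis
      using rr by (simp add: model_periodic)
  qed
qed

lemma vert_in_polygon: "vert k \<in> polygon 4"
proof -
  have "vert k = polygon_vertex 4 (nat (k mod 16))"
    by (simp add: polygon_vertex_eq vert_mod)
  moreover have "nat (k mod 16) \<in> {..<4 * 4}"
    by (simp add: nat_less_iff)
  ultimately show ?thesis
    unfolding polygon_def by (intro hull_inc) blast
qed

lemma convex_polygon: "convex (polygon 4)"
  by (simp add: polygon_def)

lemma zero_in_polygon: "0 \<in> polygon 4"
proof -
  have "vert 0 = 1" "vert 8 = -1"
    by (simp_all add: vert_def)
  then have "1 \<in> polygon 4" "-1 \<in> polygon 4"
    using vert_in_polygon[of 0] vert_in_polygon[of 8] by simp_all
  from convexD[OF convex_polygon this, of "1/2" "1/2"] show ?thesis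
    by simp
qed

lemma polar_map_in_polygon:
  assumes "r \<in> {0..1}"
  shows "polar_map (r, s) \<in> polygon 4"
proof -
  have "boundary s \<in> polygon 4"
    unfolding boundary_def linepath_def using vert_in_polygon frac_lt_1[of s]
    by (intro convexD[OF convex_polygon]) auto
  from convexD[OF convex_polygon zero_in_polygon this, of "1 - r" r] assms show ?thesis
    by (simp add: polar_map_def)
qed

lemma height_polygon_le: "z \<in> polygon 4 \<Longrightarrow> height k z \<le> 1"
proof -
  have "height k z \<le> 1 \<longleftrightarrow> inner (cis (pi / 8 * (of_int k + 1/2))) z \<le> cos (pi / 16)" for z
    using cos_pi_16_pos by (simp add: height_def)
  then have "convex {z. height k z \<le> 1}"
    by (simp add: convex_halfspace_le)
  moreover have "polygon_vertex 4 ` {..<4 * 4} \<subseteq> {z. height k z \<le> 1}"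
    by (auto simp: polygon_vertex_eq height_vert_le)
  ultimately have "polygon 4 \<subseteq> {z. height k z \<le> 1}"
    unfolding polygon_def by (intro hull_minimal)
  then show "z \<in> polygon 4 \<Longrightarrow> height k z \<le> 1"
    by blast
qed

text \<open>The identity \<open>sin B * cis A = sin (B - A) + sin A * cis B\<close>, rotated by
  \<open>vert k\<close>. It writes a direction between two neighbouring vertices as a combination of
  them.\<close>

lemma sector_decomposition:
  "sin (pi / 8) *\<^sub>R cis (2 * pi * ((of_int k + u) / 16)) =
     sin (pi / 8 * (1 - u)) *\<^sub>R vert k + sin (pi / 8 * u) *\<^sub>R vert (k + 1)"
proof -
  define A B where "A = pi / 8 * u" and "B = pi / 8"
  have "sin B *\<^sub>R cis A = of_real (sin (B - A)) + sin A *\<^sub>R cis B"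
    by (simp add: complex_eq_iff sin_diff algebra_simps)
  then have "vert k * (sin B *\<^sub>R cis A) = vert k * (of_real (sin (B - A)) + sin A *\<^sub>R cis B)"
    by simp
  then have eq: "sin B *\<^sub>R (vert k * cis A) = sin (B - A) *\<^sub>R vert k + sin A *\<^sub>R (vert k * cis B)"
    by (simp add: scaleR_conv_of_real algebra_simps)
  have "2 * pi * (of_int k / 16) + A = 2 * pi * ((of_int k + u) / 16)"
    "2 * pi * (of_int k / 16) + B = 2 * pi * (of_int (k + 1) / 16)"
    by (simp_all add: A_def B_def field_simps)
  then have vA: "vert k * cis A = cis (2 * pi * ((of_int k + u) / 16))" and vB: "vert k * cis B = vert (k + 1)"
    by (simp_all only: vert_def cis_mult)
  have BA: "B - A = pi / 8 * (1 - u)"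
    by (simp add: A_def B_def algebra_simps)
  show ?thesis
    using eq unfolding vA vB BA unfolding A_def B_def .
qed

text \<open>In its sector a point is a combination of two neighbouring vertices with nonnegative
  coefficients. Their sum is its height over that side, which is at most 1 on the polygon, and so
  serves as the radius.\<close>

lemma polygon_subset_polar_map: "polygon 4 \<subseteq> polar_map ` ({0..1} \<times> {0..16})"
proof
  fix z assume z: "z \<in> polygon 4"
  show "z \<in> polar_map ` ({0..1} \<times> {0..16})"
  proof (cases "z = 0")
    case True
    then show ?thesis
      by (intro image_eqI[where x = "(0, 0)"]) (auto simp: polar_map_def)
  next
    case False
    define x where "x = 16 * (Arg2pi z / (2 * pi))"
    define k where "k = \<lfloor>x\<rfloor>"
    define u where "u = frac x"
    have x: "0 \<le> x" "x < 16"
      using Arg2pi[of z] by (auto simp: x_def field_simps)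
    then have k: "0 \<le> k" "k < 16"
      unfolding k_def by linarith+
    have u: "0 \<le> u" "u < 1" and xk: "x = of_int k + u"
      unfolding u_def k_def by (rule frac_ge_0 frac_lt_1 | simp add: frac_def)+
    have sinB: "0 < sin (pi / 8)"
      by (intro sin_gt_zero) (use pi_gt_zero in linarith)+
    define \<alpha> \<beta> where "\<alpha> = norm z * sin (pi / 8 * (1 - u)) / sin (pi / 8)"
      and "\<beta> = norm z * sin (pi / 8 * u) / sin (pi / 8)"
    have "0 < sin (pi / 8 * (1 - u))"
    proof (rule sin_gt_zero)
      have "pi / 8 * (1 - u) \<le> pi / 8 * 1"
        using u by (intro mult_left_mono) auto
      then show "pi / 8 * (1 - u) < pi"
        using pi_gt_zero by linarith
    qed (use u in auto)
    moreover have "0 \<le> sin (pi / 8 * u)"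
    proof (rule sin_ge_zero)
      have "pi / 8 * u \<le> pi / 8 * 1"
        using u by (intro mult_left_mono) auto
      then show "pi / 8 * u \<le> pi"
        using pi_gt_zero by linarith
    qed (use u in auto)
    ultimately have pos: "0 < \<alpha>" "0 \<le> \<beta>"
      using sinB False by (simp_all add: \<alpha>_def \<beta>_def)
    have "z = of_real (norm z) * cis (Arg2pi z)"
      using Arg2pi[of z] by (simp add: is_Arg_def cis_conv_exp)
    also have "cis (Arg2pi z) = cis (2 * pi * ((of_int k + u) / 16))"
      unfolding xk[symmetric] by (simp add: x_def)
    finally have "z = norm z *\<^sub>R cis (2 * pi * ((of_int k + u) / 16))"
      by (simp add: scaleR_conv_of_real)
    moreover have "cis (2 * pi * ((of_int k + u) / 16)) =
        (1 / sin (pi / 8)) *\<^sub>R (sin (pi / 8) *\<^sub>R cis (2 * pi * ((of_int k + u) / 16)))"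
      using sinB by simp
    ultimately have z_eq: "z = \<alpha> *\<^sub>R vert k + \<beta> *\<^sub>R vert (k + 1)"
      unfolding sector_decomposition by (simp add: \<alpha>_def \<beta>_def scaleR_right_distrib)
    define r t where "r = \<alpha> + \<beta>" and "t = \<beta> / (\<alpha> + \<beta>)"
    have t: "0 \<le> t" "t \<le> 1"
      using pos by (simp_all add: t_def)
    have "height k z = r"
    proof -
      have "height k (vert k) = 1" "height k (vert (k + 1)) = 1"
        by (simp_all add: height_vert_eq_1_iff)
      then show ?thesis
        by (simp add: z_eq height_linear r_def)
    qed
    then have "r \<le> 1"
      using height_polygon_le[OF z, of k] by simp
    have rt: "r * (1 - t) = \<alpha>" "r * t = \<beta>"
      using pos by (simp_all add: r_def t_def field_simps)
    have "boundary (of_int k + t) = linepath (vert k) (vert (k + 1)) t"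
      using boundary_eq[of k "of_int k + t"] t by simp
    then have "polar_map (r, of_int k + t) = (r * (1 - t)) *\<^sub>R vert k + (r * t) *\<^sub>R vert (k + 1)"
      by (simp add: polar_map_def linepath_def scaleR_right_distrib)
    then have "z = polar_map (r, of_int k + t)"
      by (simp add: z_eq rt)
    moreover have "of_int k + t \<in> {0..16}"
    proof -
      have "(of_int k :: real) \<le> 15" "(0 :: real) \<le> of_int k"
        using k by auto
      then show ?thesis
        using t by auto
    qed
    ultimately show ?thesis
      using \<open>r \<le> 1\<close> pos by (intro image_eqI[where x = "(r, of_int k + t)"]) (auto simp: r_def)
  qed
qed

lemma polar_map_image: "polar_map ` ({0..1} \<times> {0..16}) = polygon 4"
  using polygon_subset_polar_map polar_map_in_polygon by auto

section \<open>The glued polygon is homeomorphic to the model\<close>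

abbreviation glued :: "complex \<Rightarrow> complex \<Rightarrow> bool" where
  "glued \<equiv> equivclp (side_pairing 4)"

lemma glued_sides:
  assumes "k < 16" "0 \<le> u" "u \<le> 1"
  shows "glued (boundary (real k + u)) (boundary (real (partner k) + (1 - u)))"
proof -
  have *: "side_pairing 4 (boundary (real l + v)) (boundary (real (partner l) + (1 - v)))"
    if l: "l < 16" "l mod 4 < 2" and v: "0 \<le> v" "v \<le> 1" for l v
    unfolding side_pairing_def
  proof (intro exI conjI bexI)
    have "l mod 4 = 0 \<or> l mod 4 = 1"
      using l(2) by linarith
    then show "l mod 4 \<in> {0, 1}"
      by simp
    have "4 * (l div 4) + l mod 4 = l"
      by simp
    then show "boundary (real l + v) = polygon_side 4 (4 * (l div 4) + l mod 4) v"
      "boundary (real (partner l) + (1 - v)) = polygon_side 4 (4 * (l div 4) + l mod 4 + 2) (1 - v)"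
      using v l by (simp_all add: polygon_side_eq partner_def)
  qed (use v l in auto)
  show ?thesis
  proof (cases "k mod 4 < 2")
    case True
    then show ?thesis
      using *[of k u] assms by (intro r_into_equivclp) auto
  next
    case False
    have "partner k mod 4 < 2"
    proof (rule ccontr)
      assume "\<not> partner k mod 4 < 2"
      then have "direction (partner k) = direction k"
        using False by (simp add: direction_def)
      then show False
        using direction_neq_partner[of k] by simp
    qed
    then have "side_pairing 4 (boundary (real (partner k) + (1 - u))) (boundary (real k + u))"
      using *[of "partner k" "1 - u"] assms partner_less_16 by simp
    then show ?thesis
      by (rule converse_r_into_equivclp)
  qed
qed

lemma glued_refl: "glued z z"
  by (rule reflpD[OF reflp_equivclp])

lemma boundary_of_nat_wrap: "k < 16 \<Longrightarrow> boundary (real ((k + 1) mod 16)) = boundary (real k + 1)"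
proof (cases "k = 15")
  case True
  then show ?thesis
    using boundary_periodic[of 0 1] by simp
next
  case False
  moreover assume "k < 16"
  ultimately show ?thesis
    by (simp add: add.commute)
qed

lemma glued_next_corner:
  assumes "k < 16"
  shows "glued (boundary (real k)) (boundary (real (next_corner k)))"
  using glued_sides[OF assms, of 0] boundary_of_nat_wrap[OF partner_less_16[OF assms]]
  by (simp add: next_corner_def)

text \<open>The walk around the vertex reaches every corner, and each step is a gluing of
  sides.\<close>

lemma glued_vertices:
  assumes "k < 16"
  shows "glued (boundary 0) (boundary (real k))"
proof -
  have "glued (boundary 0) (boundary (real (corner_order n)))" if "n < 16" for n
    using that
  proof (induction n)
    case 0
    then show ?case
      by (simp add: corner_order_def glued_refl)
  next
    case (Suc n)
    then have "glued (boundary (real (corner_order n))) (boundary (real (next_corner (corner_order n))))"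
      by (intro glued_next_corner corner_order_less) simp
    then show ?case
      using Suc next_corner_order[of n] by (auto intro: equivclp_trans)
  qed
  from this[of "corner_order k"] show ?thesis
    using assms corner_order_less corner_order_invol by simp
qed

lemma model_eq_imp_glued:
  assumes r: "r \<in> {0..1}" "r' \<in> {0..1}" and eq: "model (r, s) = model (r', s')"
  shows "glued (polar_map (r, s)) (polar_map (r', s'))"
proof -
  have red: "\<exists>k u. k < 16 \<and> 0 \<le> u \<and> u < 1 \<and> model (q, t) = model (q, real k + u) \<and> polar_map (q, t) = polar_map (q, real k + u)"
    for q t
  proof -
    obtain m :: int where m: "t = real (side t) + frac t + 16 * of_int m"
      using ex_side_frac by blast
    then have "model (q, t) = model (q, real (side t) + frac t)" "polar_map (q, t) = polar_map (q, real (side t) + frac t)"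
      using model_periodic polar_map_periodic by metis+
    then show ?thesis
      using side_less frac_ge_0 frac_lt_1 by blast
  qed
  obtain k u where k: "k < 16" "0 \<le> u" "u < 1" "model (r, s) = model (r, real k + u)" "polar_map (r, s) = polar_map (r, real k + u)"
    using red by blast
  obtain l v where l: "l < 16" "0 \<le> v" "v < 1" "model (r', s') = model (r', real l + v)" "polar_map (r', s') = polar_map (r', real l + v)"
    using red by blast
  have rr: "r = r'"
    using eq r model_eq_iff by blast
  consider "r = 0" | "0 < r" "r < 1" | "r = 1"
    using r(1) by force
  then show ?thesis
  proof cases
    case 1
    then show ?thesis
      using rr by (simp add: polar_map_def glued_refl)
  next
    case 2
    then have "k = l \<and> u = v"
      using eq k l r by (intro model_interior_eq[of k l u v r r']) auto
    then show ?thesis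
      using k l rr by (simp add: glued_refl)
  next
    case 3
    have eq': "model (1, real k + u) = model (1, real l + v)"
      using eq k l rr 3 by simp
    have "glued (boundary (real k + u)) (boundary (real l + v))"
      using model_boundary_eq[OF k(1) l(1) k(2,3) l(2,3) eq']
    proof (elim disjE conjE)
      assume "u = 0" "v = 0"
      then show ?thesis
        using glued_vertices[OF k(1)] glued_vertices[OF l(1)] by (auto intro: equivclp_trans equivclp_sym)
    next
      assume "l = partner k" "v = 1 - u"
      then show ?thesis
        using glued_sides[OF k(1)] k by simp
    qed (simp add: glued_refl)
    then show ?thesis
      using k l rr 3 by (simp add: polar_map_def)
  qed
qed

text \<open>\<open>model\<close> factors through the polygon, because points with equal polar image
  have equal model image. The resulting function is constant on paired points and hence on the
  classes they generate.\<close>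

lemma glued_imp_model_eq:
  assumes r: "r \<in> {0..1}" "r' \<in> {0..1}" and "glued (polar_map (r, s)) (polar_map (r', s'))"
  shows "model (r, s) = model (r', s')"
proof -
  define \<mu> where "\<mu> z = model (SOME w. w \<in> {0..1} \<times> UNIV \<and> polar_map w = z)" for z
  have \<mu>: "\<mu> (polar_map (q, t)) = model (q, t)" if "q \<in> {0..1}" for q t
  proof -
    define w where "w = (SOME w. w \<in> {0..1} \<times> UNIV \<and> polar_map w = polar_map (q, t))"
    have w: "w \<in> {0..1} \<times> UNIV \<and> polar_map w = polar_map (q, t)"
      unfolding w_def by (rule someI[of _ "(q, t)"]) (use that in auto)
    then have "model (fst w, snd w) = model (q, t)"
      using that by (intro polar_map_eq_imp_model_eq) (auto simp: mem_Times_iff)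
    then show ?thesis
      by (simp add: \<mu>_def w_def)
  qed
  have step: "\<mu> z = \<mu> w" if zw: "side_pairing 4 z w" for z w
  proof -
    obtain j i t where *: "j < 4" "i \<in> {0, 1}" "t \<in> {0..1}" "z = polygon_side 4 (4 * j + i) t"
      "w = polygon_side 4 (4 * j + i + 2) (1 - t)"
      using zw unfolding side_pairing_def by blast
    have lt: "4 * j + i < 16" and p: "partner (4 * j + i) = 4 * j + i + 2"
      using * by (auto simp: partner_def)
    have "z = polar_map (1, real (4 * j + i) + t)" "w = polar_map (1, real (partner (4 * j + i)) + (1 - t))"
      unfolding p using * by (simp_all add: polar_map_def polygon_side_eq del: of_nat_add)
    then show ?thesis
      using \<mu>[of 1] model_glue[OF lt, of t] *(3) by simp
  qed
  from assms(3) have "\<mu> (polar_map (r, s)) = \<mu> (polar_map (r', s'))"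
  proof (induction rule: equivclp_induct)
    case (step y z)
    from step(2) have "\<mu> y = \<mu> z"
      using \<open>\<And>z w. side_pairing 4 z w \<Longrightarrow> \<mu> z = \<mu> w\<close> by metis
    with step(3) show ?case
      by simp
  qed simp
  then show ?thesis
    using \<mu> r by simp
qed

text \<open>Both spaces are quotients of one compact rectangle: maps from it onto Hausdorff spaces
  are quotient maps, and the polygon is then divided by the gluing. The two quotient maps identify
  the same points, so each factors through the other.\<close>

theorem closed_orientable_surface_homeomorphic_model:
  "closed_orientable_surface 4 homeomorphic_space top_of_set model_surface"
proof -
  define R where "R = ({0..1} \<times> {0..16} :: (real \<times> real) set)"
  define q where "q z = gluing_rel 4 `` {polar_map z}" for z
  have compR: "compact_space (top_of_set R)"
    unfolding R_def by (simp add: compact_space_subtopology compact_Times)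
  have "quotient_map (top_of_set R) (top_of_set (polygon 4)) polar_map"
    using polar_map_image compR
    by (intro T1_Spaces.continuous_imp_quotient_map) (auto simp: R_def continuous_on_polar_map Hausdorff_space_subtopology)
  then have q: "quotient_map (top_of_set R) (closed_orientable_surface 4) q"
    using quotient_map_compose[OF _ quotient_map_quotient_topology]
    unfolding closed_orientable_surface_def q_def o_def by blast
  have "model ` R = model_surface"
  proof
    show "model_surface \<subseteq> model ` R"
    proof
      fix x assume "x \<in> model_surface"
      then obtain r s where x: "x = model (r, s)" "r \<in> {0..1}"
        by (auto simp: model_surface_def)
      obtain m :: int where "s = real (side s) + frac s + 16 * of_int m"
        using ex_side_frac by blast
      then have "x = model (r, real (side s) + frac s)"
        using x(1) model_periodic by metis
      moreover have "real (side s) + frac s \<in> {0..16}"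
      proof -
        have "real (side s) \<le> 15"
          using side_less[of s] by linarith
        then show ?thesis
          using frac_lt_1[of s] by simp
      qed
      ultimately show "x \<in> model ` R"
        using x(2) unfolding R_def by blast
    qed
  qed (auto simp: model_surface_def R_def)
  then have m: "quotient_map (top_of_set R) (top_of_set model_surface) model"
    using compR
    by (intro T1_Spaces.continuous_imp_quotient_map) (auto simp: continuous_on_model Hausdorff_space_subtopology)
  have kernel: "q z = q w \<longleftrightarrow> model z = model w" if "z \<in> R" "w \<in> R" for z w
  proof -
    have pol: "polar_map z \<in> polygon 4" "polar_map w \<in> polygon 4"
      using that polar_map_image by (auto simp: R_def)
    have "q z = q w \<longleftrightarrow> (polar_map z, polar_map w) \<in> gluing_rel 4"
      unfolding q_def by (rule eq_equiv_class_iff[OF equiv_gluing_rel pol])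
    also have "\<dots> \<longleftrightarrow> glued (polar_map z) (polar_map w)"
      using pol by (simp add: gluing_rel_def)
    also have "\<dots> \<longleftrightarrow> model z = model w"
    proof -
      have "fst z \<in> {0..1}" "fst w \<in> {0..1}"
        using that by (auto simp: R_def)
      from glued_imp_model_eq[OF this, of "snd z" "snd w"] model_eq_imp_glued[OF this, of "snd z" "snd w"]
      show ?thesis
        by auto
    qed
    finally show ?thesis .
  qed
  have "\<exists>f. continuous_map (closed_orientable_surface 4) (top_of_set model_surface) f \<and> (\<forall>z\<in>R. f (q z) = model z)"
  proof (rule quotient_map_lift_exists[OF q quotient_imp_continuous_map[OF m]])
    show "model x = model y" if "x \<in> topspace (top_of_set R)" "y \<in> topspace (top_of_set R)" "q x = q y" for x y
      using kernel[of x y] that by simp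
  qed auto
  then obtain f where f: "continuous_map (closed_orientable_surface 4) (top_of_set model_surface) f"
    "\<forall>z\<in>R. f (q z) = model z"
    by blast
  have "\<exists>g. continuous_map (top_of_set model_surface) (closed_orientable_surface 4) g \<and> (\<forall>z\<in>R. g (model z) = q z)"
  proof (rule quotient_map_lift_exists[OF m quotient_imp_continuous_map[OF q]])
    show "q x = q y" if "x \<in> topspace (top_of_set R)" "y \<in> topspace (top_of_set R)" "model x = model y" for x y
      using kernel[of x y] that by simp
  qed auto
  then obtain g where g: "continuous_map (top_of_set model_surface) (closed_orientable_surface 4) g"
    "\<forall>z\<in>R. g (model z) = q z"
    by blast
  have "topspace (closed_orientable_surface 4) = q ` R" "model_surface = model ` R"
    using quotient_imp_surjective_map[OF q] quotient_imp_surjective_map[OF m] by simp_all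
  then have "g (f x) = x" if "x \<in> topspace (closed_orientable_surface 4)" for x
    using that f(2) g(2) by auto
  moreover have "f (g y) = y" if y: "y \<in> model_surface" for y
  proof -
    obtain z where "z \<in> R" "y = model z"
      using y unfolding \<open>model_surface = model ` R\<close> by blast
    then show ?thesis
      using f(2) g(2) by simp
  qed
  ultimately show ?thesis
    unfolding homeomorphic_space_def homeomorphic_maps_def using f(1) g(1)
    by (intro exI[of _ f] exI[of _ g] conjI ballI) auto
qed

section \<open>Tables of cells\<close>

text \<open>Lexicographic order, the same as that of \<open>face_table\<close> and of the rows of
  \<open>chamber_table\<close>, so that entries correspond by position.\<close>

definition label_orders :: "(label \<times> label \<times> label \<times> label) list" where
  "label_orders =
     [(L1, L2, L3, L4), (L1, L2, L4, L3), (L1, L3, L2, L4), (L1, L3, L4, L2), (L1, L4, L2, L3), (L1,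
     L4, L3, L2), (L2, L1, L3, L4), (L2, L1, L4, L3), (L2, L3, L1, L4), (L2, L3, L4, L1), (L2, L4,
     L1, L3), (L2, L4, L3, L1), (L3, L1, L2, L4), (L3, L1, L4, L2), (L3, L2, L1, L4), (L3, L2, L4,
     L1), (L3, L4, L1, L2), (L3, L4, L2, L1), (L4, L1, L2, L3), (L4, L1, L3, L2), (L4, L2, L1, L3),
     (L4, L2, L3, L1), (L4, L3, L1, L2), (L4, L3, L2, L1)]"

text \<open>Cells are numbered by their positions in these tables. A row of \<open>chamber_table\<close> lists the face, the
  edges and the vertices of the polygon dual to a chamber.\<close>

definition face_table :: "nat list" where
  "face_table =
     [1234, 1243, 1324, 1342, 1423, 1432, 2134, 2143, 2314, 2341, 2413, 2431, 3124, 3142, 3214, 3241,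
     3412, 3421, 4123, 4132, 4213, 4231, 4312, 4321]"

definition edge_table :: "nat list list" where
  "edge_table =
     [[1234, 2341], [1234, 2134], [1234, 1324], [1234, 1243], [1234, 4123], [1243, 2431], [1243,
     2143], [1243, 1423], [1243, 3124], [1324, 3241], [1324, 3124], [1324, 1342], [1324, 4132],
     [1342, 3421], [1342, 3142], [1342, 1432], [1342, 2134], [1423, 4231], [1423, 4123], [1423,
     1432], [1423, 3142], [1432, 4321], [1432, 4132], [1432, 2143], [2134, 2314], [2134, 2143],
     [2134, 4213], [2143, 2413], [2143, 3214], [2314, 3142], [2314, 3214], [2314, 2341], [2314,
     4231], [2341, 3412], [2341, 3241], [2341, 2431], [2413, 4132], [2413, 4213], [2413, 2431],
     [2413, 3241], [2431, 4312], [2431, 4231], [3124, 3214], [3124, 3142], [3124, 4312], [3142,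
     3412], [3214, 3241], [3214, 4321], [3241, 3421], [3412, 4123], [3412, 4312], [3412, 3421],
     [3421, 4213], [3421, 4321], [4123, 4213], [4123, 4132], [4132, 4312], [4213, 4231], [4231,
     4321], [4312, 4321]]"

definition vertex_table :: "nat list list" where
  "vertex_table =
     [[1234, 1324, 2341, 3241], [1234, 1243, 2134, 2143], [1234, 1324, 4123, 4132], [1234, 1243,
     2341, 2431], [1234, 2134, 4123, 4213], [1243, 1423, 2431, 4231], [1243, 1423, 3124, 3142],
     [1243, 2143, 3124, 3214], [1324, 1342, 3124, 3142], [1324, 1342, 3241, 3421], [1324, 3124, 4132,
     4312], [1342, 1432, 3421, 4321], [1342, 1432, 2134, 2143], [1342, 2134, 2314, 3142], [1423,
     1432, 4123, 4132], [1423, 1432, 4231, 4321], [1423, 3142, 3412, 4123], [1432, 2143, 2413, 4132],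
     [2134, 2314, 4213, 4231], [2143, 2413, 3214, 3241], [2314, 2341, 3214, 3241], [2314, 2341, 3142,
     3412], [2314, 3214, 4231, 4321], [2341, 2431, 3412, 4312], [2413, 2431, 4213, 4231], [2413,
     2431, 4132, 4312], [2413, 3241, 3421, 4213], [3124, 3214, 4312, 4321], [3412, 3421, 4312, 4321],
     [3412, 3421, 4123, 4213]]"

definition chamber_table :: "(nat \<times> nat \<times> nat list \<times> nat list) list" where
  "chamber_table =
     [(1234, (0, [0, 1, 2, 3, 4], [1, 0, 3, 4, 2])), (1243, (1, [5, 6, 7, 3, 8], [1, 5, 3, 7, 6])),
     (1324, (2, [9, 10, 2, 11, 12], [8, 0, 9, 10, 2])), (1342, (3, [13, 14, 15, 11, 16], [8, 11, 9,
     13, 12])), (1423, (4, [17, 18, 7, 19, 20], [14, 5, 15, 16, 6])), (1432, (5, [21, 22, 15, 19,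
     23], [14, 11, 15, 17, 12])), (2134, (6, [16, 1, 24, 25, 26], [1, 13, 12, 4, 18])), (2143, (7,
     [23, 6, 27, 25, 28], [1, 17, 12, 7, 19])), (2314, (8, [29, 30, 24, 31, 32], [20, 13, 21, 22,
     18])), (2341, (9, [33, 34, 35, 31, 0], [20, 23, 21, 0, 3])), (2413, (10, [36, 37, 27, 38, 39],
     [24, 17, 25, 26, 19])), (2431, (11, [40, 41, 35, 38, 5], [24, 23, 25, 5, 3])), (3124, (12, [8,
     10, 42, 43, 44], [8, 7, 6, 10, 27])), (3142, (13, [20, 14, 45, 43, 29], [8, 16, 6, 13, 21])),
     (3214, (14, [28, 30, 42, 46, 47], [20, 7, 19, 22, 27])), (3241, (15, [39, 34, 48, 46, 9], [20,
     26, 19, 0, 9])), (3412, (16, [49, 50, 45, 51, 33], [28, 16, 29, 23, 21])), (3421, (17, [52, 53,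
     48, 51, 13], [28, 26, 29, 11, 9])), (4123, (18, [4, 18, 54, 55, 49], [14, 4, 2, 16, 29])),
     (4132, (19, [12, 22, 56, 55, 36], [14, 10, 2, 17, 25])), (4213, (20, [26, 37, 54, 57, 52], [24,
     4, 18, 26, 29])), (4231, (21, [32, 41, 58, 57, 17], [24, 22, 18, 5, 15])), (4312, (22, [44, 50,
     56, 59, 40], [28, 10, 27, 23, 25])), (4321, (23, [47, 53, 58, 59, 21], [28, 22, 27, 11, 15]))]"

text \<open>Entry \<open>k\<close> of \<open>sides\<close> is \<open>(v, e, f, w)\<close>: along side \<open>k\<close> the boundary of the face disc follows, inside the
  face \<open>f\<close>, the remaining edge \<open>e\<close> from \<open>v\<close> to \<open>w\<close>. Entry \<open>k\<close> of \<open>paths\<close> lists the corners \<open>(v, f, e)\<close>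
  which this boundary passes before side \<open>k\<close>, the corner at \<open>v\<close> in \<open>f\<close> being left across or along \<open>e\<close>.\<close>

definition paths :: "(nat \<times> nat \<times> nat) list list" where
  "paths =
     [[(29, 18, 54)], [(4, 18, 4), (4, 0, 1), (1, 0, 3), (3, 0, 0), (3, 9, 35), (23, 9, 33), (23, 16,
     50), (23, 22, 40), (23, 11, 35), (3, 11, 5), (3, 1, 3), (1, 1, 6), (7, 1, 8), (6, 1, 7), (5, 1,
     5), (5, 11, 41), (24, 11, 38), (24, 10, 37)], [(26, 10, 39), (19, 10, 27), (19, 7, 28), (7, 7,
     6), (1, 7, 25), (12, 7, 23), (12, 5, 15), (12, 3, 16), (12, 6, 25), (1, 6, 1), (4, 6, 26), (4,
     20, 54)], [(29, 20, 52), (26, 20, 37)], [(24, 20, 57)], [(18, 20, 26), (18, 6, 24), (18, 8, 32),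
     (22, 8, 30), (22, 14, 47), (27, 14, 42)], [(7, 14, 28), (19, 14, 46), (20, 14, 30), (20, 8, 31),
     (21, 8, 29), (13, 8, 24), (13, 6, 16), (13, 3, 14), (13, 13, 29), (21, 13, 45), (16, 13, 20),
     (16, 4, 18), (14, 4, 19), (15, 4, 17), (15, 21, 58), (22, 21, 32), (18, 21, 57)], [(24, 21, 41),
     (5, 21, 17), (5, 4, 7), (6, 4, 20), (6, 13, 43), (8, 13, 14), (8, 3, 11), (8, 2, 10), (8, 12,
     43), (6, 12, 8), (7, 12, 42)], [(27, 12, 44)], [(10, 12, 10), (10, 2, 12), (2, 2, 2), (0, 2, 9),
     (9, 2, 11), (9, 3, 13), (11, 3, 15), (11, 5, 21), (11, 23, 53), (28, 23, 59)], [(27, 23, 47),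
     (22, 23, 58), (15, 23, 21), (15, 5, 19), (14, 5, 22), (17, 5, 23), (17, 7, 27), (17, 10, 36),
     (17, 19, 22), (14, 19, 55), (2, 19, 12), (10, 19, 56), (25, 19, 36), (25, 10, 38), (25, 11, 40),
     (25, 22, 56), (10, 22, 44)], [(27, 22, 59)], [(28, 22, 50), (28, 16, 51)], [(29, 16, 49)], [(16,
     16, 45), (21, 16, 33), (21, 9, 31), (20, 9, 34), (20, 15, 46), (19, 15, 39), (26, 15, 48), (26,
     17, 52), (29, 17, 51)], [(28, 17, 53), (11, 17, 13), (9, 17, 48), (9, 15, 9), (0, 15, 34), (0,
     9, 0), (0, 0, 2), (2, 0, 4), (2, 18, 55), (14, 18, 18), (16, 18, 49)]]"

text \<open>Rooted at vertex 0; an entry \<open>(u, e, w)\<close> attaches the new vertex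
  \<open>w\<close> by the edge \<open>e\<close> to a vertex \<open>u\<close> reached before.\<close>

definition vertex_tree :: "(nat \<times> nat \<times> nat) list" where
  "vertex_tree =
     [(0, 2, 2), (0, 9, 9), (2, 12, 10), (9, 13, 11), (11, 53, 28), (2, 55, 14), (14, 18, 16), (14,
     19, 15), (14, 22, 17), (16, 45, 21), (21, 29, 13), (21, 31, 20), (20, 46, 19), (19, 28, 7), (7,
     6, 1), (1, 1, 4), (1, 3, 3), (7, 8, 6), (6, 7, 5), (1, 25, 12), (3, 35, 23), (19, 39, 26), (5,
     41, 24), (6, 43, 8), (26, 52, 29), (10, 56, 25), (15, 58, 22), (22, 32, 18), (22, 47, 27)]"

text \<open>A tree in the dual graph, rooted at face 0: an entry \<open>(f, e, g)\<close> reaches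
  the new face \<open>g\<close> from \<open>f\<close> across the edge \<open>e\<close>.\<close>

definition face_tree :: "(nat \<times> nat \<times> nat) list" where
  "face_tree =
     [(0, 0, 9), (0, 4, 18), (9, 33, 16), (9, 34, 15), (15, 48, 17), (16, 50, 22), (22, 40, 11), (11,
     5, 1), (11, 38, 10), (10, 27, 7), (7, 23, 5), (5, 15, 3), (3, 11, 2), (2, 10, 12), (3, 14, 13),
     (3, 16, 6), (13, 20, 4), (4, 17, 21), (5, 21, 23), (6, 24, 8), (6, 26, 20), (8, 30, 14), (10,
     36, 19)]"

definition sides :: "(nat \<times> nat \<times> nat \<times> nat) list" where
  "sides =
     [(29, 54, 18, 4), (24, 37, 10, 26), (4, 54, 20, 29), (26, 37, 20, 24), (24, 57, 20, 18), (27,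
     42, 14, 7), (18, 57, 21, 24), (7, 42, 12, 27), (27, 44, 12, 10), (28, 59, 23, 27), (10, 44, 22,
     27), (27, 59, 22, 28), (28, 51, 16, 29), (29, 49, 16, 16), (29, 51, 17, 28), (16, 49, 18, 29)]"

definition edge_ends :: "(nat \<times> nat) list" where
  "edge_ends =
     [(0, 3), (1, 4), (0, 2), (1, 3), (2, 4), (3, 5), (1, 7), (5, 6), (6, 7), (0, 9), (8, 10), (8,
     9), (2, 10), (9, 11), (8, 13), (11, 12), (12, 13), (5, 15), (14, 16), (14, 15), (6, 16), (11,
     15), (14, 17), (12, 17), (13, 18), (1, 12), (4, 18), (17, 19), (7, 19), (13, 21), (20, 22), (20,
     21), (18, 22), (21, 23), (0, 20), (3, 23), (17, 25), (24, 26), (24, 25), (19, 26), (23, 25), (5,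
     24), (7, 27), (6, 8), (10, 27), (16, 21), (19, 20), (22, 27), (9, 26), (16, 29), (23, 28), (28,
     29), (26, 29), (11, 28), (4, 29), (2, 14), (10, 25), (18, 24), (15, 22), (27, 28)]"

definition edge_faces :: "(nat \<times> nat) list" where
  "edge_faces =
     [(0, 9), (0, 6), (0, 2), (0, 1), (0, 18), (1, 11), (1, 7), (1, 4), (1, 12), (2, 15), (2, 12),
     (2, 3), (2, 19), (3, 17), (3, 13), (3, 5), (3, 6), (4, 21), (4, 18), (4, 5), (4, 13), (5, 23),
     (5, 19), (5, 7), (6, 8), (6, 7), (6, 20), (7, 10), (7, 14), (8, 13), (8, 14), (8, 9), (8, 21),
     (9, 16), (9, 15), (9, 11), (10, 19), (10, 20), (10, 11), (10, 15), (11, 22), (11, 21), (12, 14),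
     (12, 13), (12, 22), (13, 16), (14, 15), (14, 23), (15, 17), (16, 18), (16, 22), (16, 17), (17,
     20), (17, 23), (18, 20), (18, 19), (19, 22), (20, 21), (21, 23), (22, 23)]"

section \<open>Correctness of the tables\<close>

lemma distinct_labels_in_orders: "distinct [a, b, c, d] \<Longrightarrow> (a, b, c, d) \<in> set label_orders"
  by (cases a; cases b; cases c; cases d) (simp_all add: label_orders_def)

lemma label_orders_distinct: "(a, b, c, d) \<in> set label_orders \<Longrightarrow> distinct [a, b, c, d]"
proof -
  have "\<forall>(a, b, c, d)\<in>set label_orders. distinct [a, b, c, d]"
    by (simp add: label_orders_def)
  then show "(a, b, c, d) \<in> set label_orders \<Longrightarrow> distinct [a, b, c, d]"
    by blast
qed

lemma chamber_table_keys:
  "map fst chamber_table = map (\<lambda>(a, b, c, d). code a b c d) label_orders"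
  "distinct (map fst chamber_table)"
  by (simp_all add: chamber_table_def label_orders_def code_def)

definition same_set :: "nat list \<Rightarrow> nat list \<Rightarrow> bool" where
  "same_set xs ys \<longleftrightarrow> list_all (\<lambda>x. x \<in> set ys) xs \<and> list_all (\<lambda>y. y \<in> set xs) ys"

lemma same_set_iff: "same_set xs ys \<longleftrightarrow> set xs = set ys"
  by (auto simp: same_set_def list_all_iff)

text \<open>In a row of \<open>chamber_table\<close> the edges correspond to the gaps \<open>0, \<dots>, 4\<close> of the cyclic order
  \<open>\<infinity>, a, b, c, d\<close> and the vertices to the pairs of gaps 13, 02, 03, 14, 24.\<close>

definition row_correct :: "label \<Rightarrow> label \<Rightarrow> label \<Rightarrow> label \<Rightarrow> nat \<times> nat list \<times> nat list \<Rightarrow> bool" where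
  "row_correct a b c d = (\<lambda>(f, es, vs). face_table ! f = code a b c d \<and>
     same_set (edge_table ! (es ! 0)) [code a b c d, code b c d a] \<and>
     same_set (edge_table ! (es ! 1)) [code a b c d, code b a c d] \<and>
     same_set (edge_table ! (es ! 2)) [code a b c d, code a c b d] \<and>
     same_set (edge_table ! (es ! 3)) [code a b c d, code a b d c] \<and>
     same_set (edge_table ! (es ! 4)) [code a b c d, code d a b c] \<and>
     same_set (vertex_table ! (vs ! 0)) [code a b c d, code b a c d, code a b d c, code b a d c] \<and>
     same_set (vertex_table ! (vs ! 1)) [code a b c d, code a c b d, code b c d a, code c b d a] \<and>
     same_set (vertex_table ! (vs ! 2)) [code a b c d, code a b d c, code b c d a, code b d c a] \<and>
     same_set (vertex_table ! (vs ! 3)) [code a b c d, code b a c d, code d a b c, code d b a c] \<and>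
     same_set (vertex_table ! (vs ! 4)) [code a b c d, code a c b d, code d a b c, code d a c b])"

text \<open>Evaluating \<open>table ! n\<close> by unfolding the table is slow; these rewrite rules make it a single
  step.\<close>

lemma nth_eqs: "xs = ys \<Longrightarrow> map ((!) xs) [0..<length ys] = ys"
  by (simp add: map_nth)

lemmas face_table_nth = nth_eqs[OF face_table_def, simplified,
  unfolded numeral_2_eq_2[symmetric] Suc_numeral add_num_simps]
lemmas edge_table_nth = nth_eqs[OF edge_table_def, simplified,
  unfolded numeral_2_eq_2[symmetric] Suc_numeral add_num_simps]
lemmas vertex_table_nth = nth_eqs[OF vertex_table_def, simplified,
  unfolded numeral_2_eq_2[symmetric] Suc_numeral add_num_simps]

lemma chamber_table_correct:
  "list_all (\<lambda>((a, b, c, d), r). row_correct a b c d (snd r)) (zip label_orders chamber_table)"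
  by (simp add: label_orders_def chamber_table_def row_correct_def same_set_def code_def
      face_table_nth edge_table_nth vertex_table_nth)

text \<open>A face is a pentagon: its edges are the gaps and its vertices the pairs of gaps that are
  not adjacent. Each vertex is on the two edges named by its pair, which gives ten flags.\<close>

definition flags_of_row :: "nat \<times> nat list \<times> nat list \<Rightarrow> (nat \<times> nat \<times> nat) list" where
  "flags_of_row = (\<lambda>(f, es, vs).
     [(vs ! 0, es ! 1, f), (vs ! 0, es ! 3, f), (vs ! 1, es ! 0, f), (vs ! 1, es ! 2, f),
      (vs ! 2, es ! 0, f), (vs ! 2, es ! 3, f), (vs ! 3, es ! 1, f), (vs ! 3, es ! 4, f),
      (vs ! 4, es ! 2, f), (vs ! 4, es ! 4, f)])"

definition flags :: "(nat \<times> nat \<times> nat) list" where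
  "flags = concat (map (flags_of_row \<circ> snd) chamber_table)"

lemma chamber_row:
  assumes "distinct [a, b, c, d]"
  obtains r where "r \<in> set chamber_table" "row_correct a b c d (snd r)"
proof -
  have "(a, b, c, d) \<in> set label_orders"
    using assms by (rule distinct_labels_in_orders)
  then obtain i where i: "i < length label_orders" "label_orders ! i = (a, b, c, d)"
    by (auto simp: in_set_conv_nth)
  have len: "length chamber_table = length label_orders"
    using arg_cong[OF chamber_table_keys(1), of length] by simp
  have "((a, b, c, d), chamber_table ! i) \<in> set (zip label_orders chamber_table)"
    unfolding in_set_zip using i len by (intro exI[of _ i]) simp
  then show thesis
    using that[of "chamber_table ! i"] chamber_table_correct i len by (auto simp: list_all_iff)
qed

lemma chamber_row_converse:
  assumes "r \<in> set chamber_table"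
  obtains a b c d where "distinct [a, b, c, d]" "row_correct a b c d (snd r)"
proof -
  obtain i where i: "i < length chamber_table" "chamber_table ! i = r"
    using assms by (auto simp: in_set_conv_nth)
  have len: "length chamber_table = length label_orders"
    using arg_cong[OF chamber_table_keys(1), of length] by simp
  obtain a b c d where abcd: "label_orders ! i = (a, b, c, d)"
    by (metis prod_cases4)
  then have "((a, b, c, d), r) \<in> set (zip label_orders chamber_table)"
    unfolding in_set_zip using i len by (intro exI[of _ i]) simp
  then have "row_correct a b c d (snd r)"
    using chamber_table_correct by (auto simp: list_all_iff)
  moreover have "distinct [a, b, c, d]"
    using i len abcd by (intro label_orders_distinct) (metis nth_mem)
  ultimately show thesis
    using that by blast
qed

section \<open>Chains of cells and flags\<close>

definition edge_star :: "label \<Rightarrow> label \<Rightarrow> label \<Rightarrow> label \<Rightarrow> nat set set" where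
  "edge_star a b c d = {{code a b c d, code b c d a}, {code a b c d, code b a c d},
     {code a b c d, code a c b d}, {code a b c d, code a b d c}, {code a b c d, code d a b c}}"

definition vertex_star :: "label \<Rightarrow> label \<Rightarrow> label \<Rightarrow> label \<Rightarrow> nat set set" where
  "vertex_star a b c d = {{code a b c d, code b a c d, code a b d c, code b a d c},
     {code a b c d, code a c b d, code b c d a, code c b d a},
     {code a b c d, code a b d c, code b c d a, code b d c a},
     {code a b c d, code b a c d, code d a b c, code d b a c},
     {code a b c d, code a c b d, code d a b c, code d a c b}}"

text \<open>The cells at the gap between \<open>d\<close> and the base point occur in
  \<open>cells\<close> under the chamber \<open>d a b c\<close>, which explains the reordering of
  the sets.\<close>

lemma star_subset_cells:
  assumes "distinct [a, b, c, d]"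
  shows "edge_star a b c d \<subseteq> cells" "vertex_star a b c d \<subseteq> cells"
proof -
  have d: "distinct [d, a, b, c]"
    using assms by auto
  have "{code a b c d, code d a b c} = {code d a b c, code a b c d}"
    "{code a b c d, code b a c d, code d a b c, code d b a c} = {code d a b c, code d b a c, code a b c d, code b a c d}"
    "{code a b c d, code a c b d, code d a b c, code d a c b} = {code d a b c, code d a c b, code a b c d, code a c b d}"
    by auto
  then show "edge_star a b c d \<subseteq> cells" "vertex_star a b c d \<subseteq> cells"
    unfolding edge_star_def vertex_star_def using cells.intros[OF assms] cells.intros[OF d] by simp_all
qed

lemma cell_at_chamber:
  assumes "p \<in> cells" "code a b c d \<in> p" "distinct [a, b, c, d]"
  shows "p = {code a b c d} \<or> p \<in> edge_star a b c d \<or> p \<in> vertex_star a b c d"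
  using assms(1)
proof (cases rule: cells.cases)
  case (1 w x y z)
  then show ?thesis
    using assms(2) unfolding edge_star_def vertex_star_def by (simp add: insert_commute)
next
  case (2 w x y z)
  then show ?thesis
    using assms(2) unfolding edge_star_def vertex_star_def by (simp only: insert_iff empty_iff simp_thms, elim disjE; simp add: insert_commute)
next
  case (3 w x y z)
  then show ?thesis
    using assms(2) unfolding edge_star_def vertex_star_def by (simp only: insert_iff empty_iff simp_thms, elim disjE; simp add: insert_commute)
next
  case (4 w x y z)
  then show ?thesis
    using assms(2) unfolding edge_star_def vertex_star_def by (simp only: insert_iff empty_iff simp_thms, elim disjE; simp add: insert_commute)
next
  case (5 w x y z)
  then show ?thesis
    using assms(2) unfolding edge_star_def vertex_star_def by (simp only: insert_iff empty_iff simp_thms, elim disjE; simp add: insert_commute)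
next
  case (6 w x y z)
  then show ?thesis
    using assms(2) unfolding edge_star_def vertex_star_def by (simp only: insert_iff empty_iff simp_thms, elim disjE; simp add: insert_commute)
next
  case (7 w x y z)
  then show ?thesis
    using assms(2) unfolding edge_star_def vertex_star_def by (simp only: insert_iff empty_iff simp_thms, elim disjE; simp add: insert_commute)
next
  case (8 w x y z)
  then show ?thesis
    using assms(2) unfolding edge_star_def vertex_star_def by (simp only: insert_iff empty_iff simp_thms, elim disjE; simp add: insert_commute)
qed

lemma cell_card:
  assumes "distinct [a, b, c, d]"
  shows "p \<in> edge_star a b c d \<Longrightarrow> card p = 2" "p \<in> vertex_star a b c d \<Longrightarrow> card p = 4"
  using assms unfolding edge_star_def vertex_star_def by auto

lemmas edge_ends_nth = nth_eqs[OF edge_ends_def, simplified,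
  unfolded numeral_2_eq_2[symmetric] Suc_numeral add_num_simps]
lemmas edge_faces_nth = nth_eqs[OF edge_faces_def, simplified,
  unfolded numeral_2_eq_2[symmetric] Suc_numeral add_num_simps]

definition Vx :: "nat \<Rightarrow> cell" where "Vx n = Abs_cell (set (vertex_table ! n))"
definition Ed :: "nat \<Rightarrow> cell" where "Ed n = Abs_cell (set (edge_table ! n))"
definition Fc :: "nat \<Rightarrow> cell" where "Fc n = Abs_cell {face_table ! n}"

lemma flag_realized:
  assumes "(v, e, f) \<in> set flags"
  obtains a b c d where "distinct [a, b, c, d]" "face_table ! f = code a b c d"
    "set (edge_table ! e) \<in> edge_star a b c d" "set (vertex_table ! v) \<in> vertex_star a b c d"
    "set (edge_table ! e) \<subseteq> set (vertex_table ! v)"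
proof -
  obtain r where r: "r \<in> set chamber_table" "(v, e, f) \<in> set (flags_of_row (snd r))"
    using assms by (auto simp: flags_def)
  obtain a b c d where d: "distinct [a, b, c, d]" "row_correct a b c d (snd r)"
    using chamber_row_converse[OF r(1)] by blast
  obtain f' es vs where "snd r = (f', es, vs)"
    by (metis prod_cases3)
  with d(2) r(2) have "face_table ! f = code a b c d \<and> set (edge_table ! e) \<in> edge_star a b c d \<and>
      set (vertex_table ! v) \<in> vertex_star a b c d \<and> set (edge_table ! e) \<subseteq> set (vertex_table ! v)"
    unfolding row_correct_def same_set_iff flags_of_row_def edge_star_def vertex_star_def
    by (simp only: prod.case list.set insert_iff empty_iff prod.inject simp_thms) (elim disjE conjE; simp)
  then show thesis
    using that d(1) by blast
qed

text \<open>The row of the chamber lists all its edges and vertices, so it remains to see which of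
  them can be contained in one another.\<close>

lemma chain_in_star:
  assumes d: "distinct [a, b, c, d]" and E: "p \<in> edge_star a b c d" and V: "q \<in> vertex_star a b c d"
    and sub: "p \<subseteq> q"
  shows "\<exists>(v, e, f)\<in>set flags. face_table ! f = code a b c d \<and> set (edge_table ! e) = p \<and> set (vertex_table ! v) = q"
proof -
  obtain r where r: "r \<in> set chamber_table" "row_correct a b c d (snd r)"
    using chamber_row[OF d] by blast
  obtain f es vs where s: "snd r = (f, es, vs)"
    by (metis prod_cases3)
  have sub: "set (flags_of_row (f, es, vs)) \<subseteq> set flags"
    using r(1) s unfolding flags_def by (auto intro!: bexI[of _ r])
  have row: "face_table ! f = code a b c d"
    "set (edge_table ! (es ! 0)) = {code a b c d, code b c d a}"
    "set (edge_table ! (es ! 1)) = {code a b c d, code b a c d}"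
    "set (edge_table ! (es ! 2)) = {code a b c d, code a c b d}"
    "set (edge_table ! (es ! 3)) = {code a b c d, code a b d c}"
    "set (edge_table ! (es ! 4)) = {code a b c d, code d a b c}"
    "set (vertex_table ! (vs ! 0)) = {code a b c d, code b a c d, code a b d c, code b a d c}"
    "set (vertex_table ! (vs ! 1)) = {code a b c d, code a c b d, code b c d a, code c b d a}"
    "set (vertex_table ! (vs ! 2)) = {code a b c d, code a b d c, code b c d a, code b d c a}"
    "set (vertex_table ! (vs ! 3)) = {code a b c d, code b a c d, code d a b c, code d b a c}"
    "set (vertex_table ! (vs ! 4)) = {code a b c d, code a c b d, code d a b c, code d a c b}"
    using r(2) unfolding s row_correct_def same_set_iff by simp_all
  \<comment> \<open>Of the 25 pairs of a vertex and an edge of the pentagon, ten are incident. Each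
    of these fifteen facts refutes another pair: the second chamber of the edge is missing at the
    vertex.\<close>
  have non_incident:
    "code b c d a \<notin> set (vertex_table ! (vs ! 0))" "code a c b d \<notin> set (vertex_table ! (vs ! 0))" "code d a b c \<notin> set (vertex_table ! (vs ! 0))"
    "code b a c d \<notin> set (vertex_table ! (vs ! 1))" "code a b d c \<notin> set (vertex_table ! (vs ! 1))" "code d a b c \<notin> set (vertex_table ! (vs ! 1))"
    "code b a c d \<notin> set (vertex_table ! (vs ! 2))" "code a c b d \<notin> set (vertex_table ! (vs ! 2))" "code d a b c \<notin> set (vertex_table ! (vs ! 2))"
    "code b c d a \<notin> set (vertex_table ! (vs ! 3))" "code a c b d \<notin> set (vertex_table ! (vs ! 3))" "code a b d c \<notin> set (vertex_table ! (vs ! 3))"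
    "code b c d a \<notin> set (vertex_table ! (vs ! 4))" "code b a c d \<notin> set (vertex_table ! (vs ! 4))" "code a b d c \<notin> set (vertex_table ! (vs ! 4))"
    unfolding row using d by simp_all
  have "p \<in> (\<lambda>n. set (edge_table ! (es ! n))) ` {0, 1, 2, 3, 4}"
    "q \<in> (\<lambda>n. set (vertex_table ! (vs ! n))) ` {0, 1, 2, 3, 4}"
    using E V unfolding edge_star_def vertex_star_def image_insert image_empty row by simp_all
  then obtain m n where mn: "p = set (edge_table ! (es ! m))" "q = set (vertex_table ! (vs ! n))"
    "m \<in> {0, 1, 2, 3, 4}" "n \<in> {0, 1, 2, 3, 4}"
    by blast
  have edge_mem: "code b c d a \<in> set (edge_table ! (es ! 0))" "code b a c d \<in> set (edge_table ! (es ! 1))"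
    "code a c b d \<in> set (edge_table ! (es ! 2))" "code a b d c \<in> set (edge_table ! (es ! 3))"
    "code d a b c \<in> set (edge_table ! (es ! 4))"
    unfolding row by simp_all
  have "(n, m) \<in> {(0, 1), (0, 3), (1, 0), (1, 2), (2, 0), (2, 3), (3, 1), (3, 4), (4, 2), (4, 4)}"
    using mn(3,4) \<open>p \<subseteq> q\<close> non_incident edge_mem unfolding mn(1,2)
    by (elim insertE emptyE; hypsubst) (blast | simp)+
  then have "(vs ! n, es ! m, f) \<in> set (flags_of_row (f, es, vs))"
    unfolding flags_of_row_def by auto
  then show ?thesis
    using sub row(1) mn(1,2) by blast
qed

lemma ex_chain_in_star:
  assumes "distinct [a, b, c, d]"
  shows "p \<in> edge_star a b c d \<Longrightarrow> \<exists>q\<in>vertex_star a b c d. p \<subseteq> q"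
    and "q \<in> vertex_star a b c d \<Longrightarrow> \<exists>p\<in>edge_star a b c d. p \<subseteq> q"
  unfolding edge_star_def vertex_star_def by (simp only: insert_iff empty_iff simp_thms, elim disjE;
    hypsubst, simp only: bex_simps insert_subset insert_iff empty_subsetI simp_thms)+

text \<open>A chamber in the greatest cell of the chain belongs to all its members. In the star of
  this chamber, comparable cells of equal cardinality are equal, so at most one edge and one vertex
  occur; a missing one can be supplied, which completes the chain to a flag.\<close>

lemma chain_subset_flag_sets:
  assumes S: "pairwise_comparable S" "S \<noteq> {}"
  shows "\<exists>(v, e, f)\<in>set flags. Rep_cell ` S \<subseteq> {set (vertex_table ! v), set (edge_table ! e), {face_table ! f}}"
proof -
  have "finite S"
    by simp
  from finite_has_maximal[OF this S(2)] obtain m where m: "m \<in> S" "\<And>p. p \<in> S \<Longrightarrow> m \<le> p \<Longrightarrow> m = p"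
    by metis
  have le: "p \<le> m" if "p \<in> S" for p
    using S(1) m that unfolding pairwise_comparable_def by blast
  have "\<exists>a b c d. distinct [a, b, c, d] \<and> code a b c d \<in> Rep_cell m"
    using Rep_cell[of m] by (cases rule: cells.cases) blast+
  then obtain a b c d where d: "distinct [a, b, c, d]" and "code a b c d \<in> Rep_cell m"
    by blast
  then have mem: "code a b c d \<in> Rep_cell p" if "p \<in> S" for p
    using le[OF that] by (auto simp: less_eq_cell_def)
  have star: "p \<in> {{code a b c d}} \<union> edge_star a b c d \<union> vertex_star a b c d" if "p \<in> Rep_cell ` S" for p
    using that cell_at_chamber[OF Rep_cell mem d] by blast
  have comp: "p \<subseteq> q \<or> q \<subseteq> p" if "p \<in> Rep_cell ` S" "q \<in> Rep_cell ` S" for p q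
    using that S(1) unfolding pairwise_comparable_def less_eq_cell_def by blast
  have fin: "finite p" if "p \<in> Rep_cell ` S" for p
    using star[OF that] by (auto simp: edge_star_def vertex_star_def)
  have uniq: "p = q" if pq: "p \<in> Rep_cell ` S" "q \<in> Rep_cell ` S" "card p = card q" for p q
    using comp[OF pq(1,2)] fin[OF pq(1)] fin[OF pq(2)] pq(3) card_subset_eq[of p q] card_subset_eq[of q p] by auto
  have not_sub: "\<not> V \<subseteq> E" if "E \<in> edge_star a b c d" "V \<in> vertex_star a b c d" for E V
  proof
    assume "V \<subseteq> E"
    moreover have "finite E"
      using that(1) by (auto simp: edge_star_def)
    ultimately have "card V \<le> card E"
      by (intro card_mono)
    then show False
      using cell_card[OF d] that by simp
  qed
  obtain E V where EV: "E \<in> edge_star a b c d" "V \<in> vertex_star a b c d" "E \<subseteq> V"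
    "Rep_cell ` S \<subseteq> {V, E, {code a b c d}}"
  proof (cases "Rep_cell ` S \<inter> edge_star a b c d = {}")
    case noE: True
    show thesis
    proof (cases "Rep_cell ` S \<inter> vertex_star a b c d = {}")
      case noV: True
      have sub: "Rep_cell ` S \<subseteq> {{code a b c d}}"
        using star noE noV by blast
      have E: "{code a b c d, code b c d a} \<in> edge_star a b c d"
        by (simp add: edge_star_def)
      obtain V where "V \<in> vertex_star a b c d" "{code a b c d, code b c d a} \<subseteq> V"
        using ex_chain_in_star(1)[OF d E] by (elim bexE)
      from that[OF E this] sub show thesis
        by (meson order_trans subset_insertI)
    next
      case False
      then obtain V where V: "V \<in> Rep_cell ` S" "V \<in> vertex_star a b c d"
        by blast
      have "p = V" if "p \<in> Rep_cell ` S" "p \<in> vertex_star a b c d" for p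
        using uniq[OF that(1) V(1)] cell_card(2)[OF d] that(2) V(2) by simp
      then have sub: "Rep_cell ` S \<subseteq> {V, {code a b c d}}"
        using star noE by blast
      obtain E where "E \<in> edge_star a b c d" "E \<subseteq> V"
        using ex_chain_in_star(2)[OF d V(2)] by (elim bexE)
      from that[OF this(1) V(2) this(2)] sub show thesis
        by blast
    qed
  next
    case False
    then obtain E where E: "E \<in> Rep_cell ` S" "E \<in> edge_star a b c d"
      by blast
    have E_uniq: "p = E" if "p \<in> Rep_cell ` S" "p \<in> edge_star a b c d" for p
      using uniq[OF that(1) E(1)] cell_card(1)[OF d] that(2) E(2) by simp
    show thesis
    proof (cases "Rep_cell ` S \<inter> vertex_star a b c d = {}")
      case True
      then have sub: "Rep_cell ` S \<subseteq> {E, {code a b c d}}"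
        using star E_uniq by blast
      obtain V where "V \<in> vertex_star a b c d" "E \<subseteq> V"
        using ex_chain_in_star(1)[OF d E(2)] by (elim bexE)
      from that[OF E(2) this] sub show thesis
        by blast
    next
      case False
      then obtain V where V: "V \<in> Rep_cell ` S" "V \<in> vertex_star a b c d"
        by blast
      have "p = V" if "p \<in> Rep_cell ` S" "p \<in> vertex_star a b c d" for p
        using uniq[OF that(1) V(1)] cell_card(2)[OF d] that(2) V(2) by simp
      then have sub: "Rep_cell ` S \<subseteq> {V, E, {code a b c d}}"
        using star E_uniq by blast
      have "E \<subseteq> V"
        using comp[OF E(1) V(1)] not_sub[OF E(2) V(2)] by blast
      from that[OF E(2) V(2) this sub] show thesis .
    qed
  qed
  from chain_in_star[OF d EV(1-3)] EV(4) show ?thesis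
    by (elim bexE; intro bexI; auto)
qed

lemma flags_bounds: "list_all (\<lambda>(v, e, f). v < 30 \<and> e < 60 \<and> f < 24) flags"
  by (simp add: flags_def chamber_table_def flags_of_row_def)

lemma flags_cover:
  "{..<30} \<subseteq> set (map (\<lambda>(v, e, f). v) flags)"
  "{..<60} \<subseteq> set (map (\<lambda>(v, e, f). e) flags)"
  "{..<24} \<subseteq> set (map (\<lambda>(v, e, f). f) flags)"
  by (simp_all add: flags_def chamber_table_def flags_of_row_def lessThan_nat_numeral lessThan_Suc)

text \<open>Since rows are increasing lists, different rows are also different as sets; their
  lengths tell the three kinds of cells apart.\<close>

lemma tables_sorted:
  "list_all (\<lambda>xs. sorted xs \<and> distinct xs \<and> length xs = 4) vertex_table" "distinct vertex_table"
  "list_all (\<lambda>xs. sorted xs \<and> distinct xs \<and> length xs = 2) edge_table" "distinct edge_table"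
  "distinct face_table" "length vertex_table = 30" "length edge_table = 60" "length face_table = 24"
  by (simp_all add: vertex_table_def edge_table_def face_table_def)

lemma Rep_Vx: "v < 30 \<Longrightarrow> Rep_cell (Vx v) = set (vertex_table ! v)"
proof -
  assume "v < 30"
  then obtain e f where "(v, e, f) \<in> set flags"
    using flags_cover(1) by auto
  from flag_realized[OF this] show ?thesis
    unfolding Vx_def using star_subset_cells(2) by (metis Abs_cell_inverse subsetD)
qed

lemma Rep_Ed: "e < 60 \<Longrightarrow> Rep_cell (Ed e) = set (edge_table ! e)"
proof -
  assume "e < 60"
  then obtain v f where "(v, e, f) \<in> set flags"
    using flags_cover(2) by auto
  from flag_realized[OF this] show ?thesis
    unfolding Ed_def using star_subset_cells(1) by (metis Abs_cell_inverse subsetD)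
qed

lemma Rep_Fc: "f < 24 \<Longrightarrow> Rep_cell (Fc f) = {face_table ! f}"
proof -
  assume "f < 24"
  then obtain v e where "(v, e, f) \<in> set flags"
    using flags_cover(3) by auto
  then obtain a b c d where "distinct [a, b, c, d]" "face_table ! f = code a b c d"
    by (rule flag_realized)
  then have "{face_table ! f} \<in> cells"
    by (simp add: cells.intros)
  then show ?thesis
    unfolding Fc_def by (rule Abs_cell_inverse)
qed

lemma card_Rep:
  "v < 30 \<Longrightarrow> card (Rep_cell (Vx v)) = 4" "e < 60 \<Longrightarrow> card (Rep_cell (Ed e)) = 2"
  "f < 24 \<Longrightarrow> card (Rep_cell (Fc f)) = 1"
  using tables_sorted by (auto simp: Rep_Vx Rep_Ed Rep_Fc list_all_iff distinct_card)

lemma cell_distinct: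
  "v < 30 \<Longrightarrow> e < 60 \<Longrightarrow> Vx v \<noteq> Ed e" "v < 30 \<Longrightarrow> f < 24 \<Longrightarrow> Vx v \<noteq> Fc f"
  "e < 60 \<Longrightarrow> f < 24 \<Longrightarrow> Ed e \<noteq> Fc f"
  "v < 30 \<Longrightarrow> e < 60 \<Longrightarrow> Ed e \<noteq> Vx v" "v < 30 \<Longrightarrow> f < 24 \<Longrightarrow> Fc f \<noteq> Vx v"
  "e < 60 \<Longrightarrow> f < 24 \<Longrightarrow> Fc f \<noteq> Ed e"
  by (rule notI, drule arg_cong[of _ _ "\<lambda>p. card (Rep_cell p)"], simp add: card_Rep)+

lemma Vx_eq_iff: "v < 30 \<Longrightarrow> v' < 30 \<Longrightarrow> Vx v = Vx v' \<longleftrightarrow> v = v'"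
proof
  assume v: "v < 30" "v' < 30" and "Vx v = Vx v'"
  then have "set (vertex_table ! v) = set (vertex_table ! v')"
    by (metis Rep_Vx)
  moreover have "vertex_table ! v \<in> set vertex_table" "vertex_table ! v' \<in> set vertex_table"
    using v by (simp_all add: tables_sorted)
  ultimately have "vertex_table ! v = vertex_table ! v'"
    using tables_sorted(1) by (intro sorted_distinct_set_unique) (auto simp: list_all_iff)
  then show "v = v'"
    using v tables_sorted(2,6) by (simp add: nth_eq_iff_index_eq)
qed simp

lemma Ed_eq_iff: "e < 60 \<Longrightarrow> e' < 60 \<Longrightarrow> Ed e = Ed e' \<longleftrightarrow> e = e'"
proof
  assume e: "e < 60" "e' < 60" and "Ed e = Ed e'"
  then have "set (edge_table ! e) = set (edge_table ! e')"
    by (metis Rep_Ed)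
  moreover have "edge_table ! e \<in> set edge_table" "edge_table ! e' \<in> set edge_table"
    using e by (simp_all add: tables_sorted)
  ultimately have "edge_table ! e = edge_table ! e'"
    using tables_sorted(3) by (intro sorted_distinct_set_unique) (auto simp: list_all_iff)
  then show "e = e'"
    using e tables_sorted(4,7) by (simp add: nth_eq_iff_index_eq)
qed simp

lemma Fc_eq_iff: "f < 24 \<Longrightarrow> f' < 24 \<Longrightarrow> Fc f = Fc f' \<longleftrightarrow> f = f'"
proof
  assume f: "f < 24" "f' < 24" and "Fc f = Fc f'"
  then have "face_table ! f = face_table ! f'"
    by (metis Rep_Fc singleton_inject)
  then show "f = f'"
    using f tables_sorted(5,8) by (simp add: nth_eq_iff_index_eq)
qed simp

lemmas cell_eq_iff = Vx_eq_iff Ed_eq_iff Fc_eq_iff cell_distinct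

lemma flag_bounds: "(v, e, f) \<in> set flags \<Longrightarrow> v < 30 \<and> e < 60 \<and> f < 24"
  using flags_bounds by (auto simp: list_all_iff)

definition flag_cells :: "nat \<Rightarrow> nat \<Rightarrow> nat \<Rightarrow> cell set" where
  "flag_cells v e f = {Vx v, Ed e, Fc f}"

lemma comparable_subset_flag:
  assumes "pairwise_comparable S" "S \<noteq> {}"
  obtains v e f where "(v, e, f) \<in> set flags" "S \<subseteq> flag_cells v e f"
proof -
  obtain v e f where vef: "(v, e, f) \<in> set flags"
    and sub: "Rep_cell ` S \<subseteq> {set (vertex_table ! v), set (edge_table ! e), {face_table ! f}}"
    using chain_subset_flag_sets[OF assms] by blast
  have "p \<in> flag_cells v e f" if "p \<in> S" for p
  proof -
    have "Rep_cell p \<in> {Rep_cell (Vx v), Rep_cell (Ed e), Rep_cell (Fc f)}"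
      using sub that flag_bounds[OF vef] by (auto simp: Rep_Vx Rep_Ed Rep_Fc)
    then show ?thesis
      by (auto simp: flag_cells_def Rep_cell_inject)
  qed
  then show thesis
    using that[OF vef] by blast
qed

text \<open>A chain lies in a single flag, and the flag contains only one cell of each kind.\<close>

lemma comparable_pairD:
  assumes "pairwise_comparable S"
  shows "v < 30 \<Longrightarrow> e < 60 \<Longrightarrow> Vx v \<in> S \<Longrightarrow> Ed e \<in> S \<Longrightarrow> \<exists>f. (v, e, f) \<in> set flags"
    and "e < 60 \<Longrightarrow> f < 24 \<Longrightarrow> Ed e \<in> S \<Longrightarrow> Fc f \<in> S \<Longrightarrow> \<exists>v. (v, e, f) \<in> set flags"
    and "v < 30 \<Longrightarrow> v' < 30 \<Longrightarrow> Vx v \<in> S \<Longrightarrow> Vx v' \<in> S \<Longrightarrow> v = v'"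
    and "e < 60 \<Longrightarrow> e' < 60 \<Longrightarrow> Ed e \<in> S \<Longrightarrow> Ed e' \<in> S \<Longrightarrow> e = e'"
    and "f < 24 \<Longrightarrow> f' < 24 \<Longrightarrow> Fc f \<in> S \<Longrightarrow> Fc f' \<in> S \<Longrightarrow> f = f'"
    and "v < 30 \<Longrightarrow> e < 60 \<Longrightarrow> f < 24 \<Longrightarrow> Vx v \<in> S \<Longrightarrow> Ed e \<in> S \<Longrightarrow> Fc f \<in> S \<Longrightarrow> (v, e, f) \<in> set flags"
proof -
  have flag: "\<exists>v0 e0 f0. (v0, e0, f0) \<in> set flags \<and> (\<forall>v<30. Vx v \<in> S \<longrightarrow> v = v0) \<and>
      (\<forall>e<60. Ed e \<in> S \<longrightarrow> e = e0) \<and> (\<forall>f<24. Fc f \<in> S \<longrightarrow> f = f0)" if x: "x \<in> S" for x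
  proof -
    have "S \<noteq> {}"
      using x by blast
    then obtain v0 e0 f0 where vef: "(v0, e0, f0) \<in> set flags" and sub: "S \<subseteq> flag_cells v0 e0 f0"
      by (rule comparable_subset_flag[OF assms])
    have b: "v0 < 30" "e0 < 60" "f0 < 24"
      using flag_bounds[OF vef] by auto
    have "v = v0" if "v < 30" "Vx v \<in> S" for v
      using subsetD[OF sub that(2)] that(1) b by (simp add: flag_cells_def cell_eq_iff)
    moreover have "e = e0" if "e < 60" "Ed e \<in> S" for e
      using subsetD[OF sub that(2)] that(1) b by (simp add: flag_cells_def cell_eq_iff)
    moreover have "f = f0" if "f < 24" "Fc f \<in> S" for f
      using subsetD[OF sub that(2)] that(1) b by (simp add: flag_cells_def cell_eq_iff)
    ultimately show ?thesis
      using vef by blast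
  qed
  show "\<exists>f. (v, e, f) \<in> set flags" if "v < 30" "e < 60" "Vx v \<in> S" "Ed e \<in> S"
    using flag[OF that(3)] that by blast
  show "\<exists>v. (v, e, f) \<in> set flags" if "e < 60" "f < 24" "Ed e \<in> S" "Fc f \<in> S"
    using flag[OF that(3)] that by blast
  show "v = v'" if "v < 30" "v' < 30" "Vx v \<in> S" "Vx v' \<in> S"
    using flag[OF that(3)] that by blast
  show "e = e'" if "e < 60" "e' < 60" "Ed e \<in> S" "Ed e' \<in> S"
    using flag[OF that(3)] that by blast
  show "f = f'" if "f < 24" "f' < 24" "Fc f \<in> S" "Fc f' \<in> S"
    using flag[OF that(3)] that by blast
  show "(v, e, f) \<in> set flags" if "v < 30" "e < 60" "f < 24" "Vx v \<in> S" "Ed e \<in> S" "Fc f \<in> S"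
    using flag[OF that(4)] that by blast
qed

section \<open>The pieces of the order complex\<close>

lemma compact_order_complex: "compact (order_complex :: (real ^ 'p::{finite,order}) set)"
proof -
  have "bounded (simplex_on S)" for S :: "'p set"
    unfolding bounded_iff
  proof (intro exI ballI)
    fix y assume y: "y \<in> simplex_on S"
    have "norm y \<le> (\<Sum>p\<in>UNIV. \<bar>y $ p\<bar>)"
      by (rule norm_le_l1_cart)
    also have "\<dots> = 1"
      using y by (simp add: simplex_on_def)
    finally show "norm y \<le> 1" .
  qed
  then have "compact (simplex_on S)" for S :: "'p set"
    using closed_simplex_on by (simp add: compact_eq_bounded_closed)
  then show ?thesis
    unfolding order_complex_eq by (intro compact_UN) auto
qed

lemma compact_dual_cell: "compact (dual_cell S)"
  using closedin_dual_cell compact_order_complex by (rule closedin_compact[rotated])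

section \<open>Unions of dual cells along trees\<close>

fun grows :: "'n list \<Rightarrow> ('n \<times> 'l \<times> 'n) list \<Rightarrow> bool" where
  "grows V [] \<longleftrightarrow> True"
| "grows V ((u, l, w) # xs) \<longleftrightarrow> u \<in> set V \<and> w \<notin> set V \<and> grows (w # V) xs"

definition link :: "'n \<times> 'l \<times> 'n \<Rightarrow> 'l" where
  "link x = fst (snd x)"

lemma link_simp [simp]: "link (u, l, w) = l"
  by (simp add: link_def)

text \<open>Each entry adds two sets: the link \<open>M l\<close> meets the part built so far only
  in its overlap with \<open>D u\<close>, and then the new node \<open>D w\<close> meets it only in
  its overlap with \<open>M l\<close>. \<open>K\<close> records the links already attached, which
  the induction has to carry along.\<close>

lemma AR_grows:
  fixes D :: "'n \<Rightarrow> 'a::euclidean_space set" and M :: "'l \<Rightarrow> 'a set"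
  assumes "grows V xs" "distinct (map link xs)" "link ` set xs \<inter> K = {}" "set V \<subseteq> I" "(\<lambda>(u, l, w). w) ` set xs \<subseteq> I"
    and "AR ((\<Union>n\<in>set V. D n) \<union> (\<Union>l\<in>K. M l))" "compact ((\<Union>n\<in>set V. D n) \<union> (\<Union>l\<in>K. M l))"
    and D: "\<And>n. compact (D n)" "\<And>n. n \<in> I \<Longrightarrow> AR (D n)" "\<And>n n'. n \<in> I \<Longrightarrow> n' \<in> I \<Longrightarrow> n \<noteq> n' \<Longrightarrow> D n \<inter> D n' = {}"
    and M: "\<And>l. compact (M l)" "\<And>l. l \<in> K \<union> link ` set xs \<Longrightarrow> AR (M l)"
      "\<And>l l'. l \<in> K \<union> link ` set xs \<Longrightarrow> l' \<in> K \<union> link ` set xs \<Longrightarrow> l \<noteq> l' \<Longrightarrow> M l \<inter> M l' = {}"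
    and K: "\<And>l n. l \<in> K \<Longrightarrow> n \<in> I \<Longrightarrow> n \<notin> set V \<Longrightarrow> D n \<inter> M l = {}"
    and ends: "\<And>u l w. (u, l, w) \<in> set xs \<Longrightarrow> AR (D u \<inter> M l) \<and> AR (D w \<inter> M l)"
      "\<And>u l w n. (u, l, w) \<in> set xs \<Longrightarrow> n \<in> I \<Longrightarrow> n \<noteq> u \<Longrightarrow> n \<noteq> w \<Longrightarrow> D n \<inter> M l = {}"
  shows "AR ((\<Union>n\<in>set V. D n) \<union> (\<Union>l\<in>K. M l) \<union> (\<Union>(u, l, w)\<in>set xs. M l \<union> D w))"
  using assms(1-7) M(2,3) K ends
proof (induction xs arbitrary: V K)
  case Nil
  then show ?case
    by simp
next
  case (Cons x xs)
  obtain u l w where x: "x = (u, l, w)"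
    by (metis prod_cases3)
  let ?U = "(\<Union>n\<in>set V. D n) \<union> (\<Union>l\<in>K. M l)"
  have uw: "u \<in> set V" "w \<notin> set V" "grows (w # V) xs" "l \<notin> K" "u \<in> I" "w \<in> I"
    using Cons.prems(1,3,4,5) by (auto simp: x)
  have M_K: "M l \<inter> M l' = {}" if "l' \<in> K" for l'
    using Cons.prems(9)[of l l'] that uw(4) by (auto simp: x)
  have D_V: "D n \<inter> M l = {}" if "n \<in> set V" "n \<noteq> u" for n
    using Cons.prems(12)[of u l w n] that uw Cons.prems(4) by (auto simp: x)
  have eq1: "?U \<inter> M l = D u \<inter> M l"
    using M_K D_V uw(1) by blast
  have D_w: "D n \<inter> D w = {}" if "n \<in> set V" for n
    using D(3)[of n w] that uw Cons.prems(4) by blast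
  have "M l' \<inter> D w = {}" if "l' \<in> K" for l'
    using Cons.prems(10)[OF that uw(6,2)] by blast
  then have eq2: "(?U \<union> M l) \<inter> D w = D w \<inter> M l"
    using D_w by blast
  have AR_l: "AR (D u \<inter> M l) \<and> AR (D w \<inter> M l)"
    using Cons.prems(11)[of u l w] by (simp add: x)
  have M_l: "AR (M l)"
    using Cons.prems(8)[of l] by (simp add: x)
  have "AR (?U \<inter> M l)"
    unfolding eq1 using AR_l by blast
  then have AR1: "AR (?U \<union> M l)"
    by (rule AR_Un_compact[OF Cons.prems(7) M(1) Cons.prems(6) M_l])
  have "AR ((?U \<union> M l) \<inter> D w)"
    unfolding eq2 using AR_l by blast
  then have AR2: "AR (?U \<union> M l \<union> D w)"
    by (rule AR_Un_compact[OF compact_Un[OF Cons.prems(7) M(1)] D(1) AR1 D(2)[OF uw(6)]])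
  have eq3: "(\<Union>n\<in>set (w # V). D n) \<union> (\<Union>l\<in>insert l K. M l) = ?U \<union> M l \<union> D w"
    by auto
  have "AR ((\<Union>n\<in>set (w # V). D n) \<union> (\<Union>l\<in>insert l K. M l) \<union> (\<Union>(u, l, w)\<in>set xs. M l \<union> D w))"
  proof (rule Cons.IH)
    show "grows (w # V) xs" "distinct (map link xs)" "link ` set xs \<inter> insert l K = {}" "set (w # V) \<subseteq> I"
      "(\<lambda>(u, l, w). w) ` set xs \<subseteq> I"
      using Cons.prems(2-5) uw by (auto simp: x)
    show "AR ((\<Union>n\<in>set (w # V). D n) \<union> (\<Union>l\<in>insert l K. M l))"
      unfolding eq3 by (rule AR2)
    show "compact ((\<Union>n\<in>set (w # V). D n) \<union> (\<Union>l\<in>insert l K. M l))"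
      unfolding eq3 by (rule compact_Un[OF compact_Un[OF Cons.prems(7) M(1)] D(1)])
    show "AR (M l')" if "l' \<in> insert l K \<union> link ` set xs" for l'
      using Cons.prems(8) that by (auto simp: x)
    show "M l1 \<inter> M l2 = {}" if "l1 \<in> insert l K \<union> link ` set xs" "l2 \<in> insert l K \<union> link ` set xs" "l1 \<noteq> l2" for l1 l2
      using Cons.prems(9)[of l1 l2] that by (auto simp: x)
    show "D n \<inter> M l' = {}" if "l' \<in> insert l K" "n \<in> I" "n \<notin> set (w # V)" for l' n
    proof (cases "l' = l")
      case True
      then show ?thesis
        using Cons.prems(12)[of u l w n] that uw(1) by (auto simp: x)
    next
      case False
      then show ?thesis
        using Cons.prems(10)[of l' n] that by auto
    qed
    show "AR (D u' \<inter> M l') \<and> AR (D w' \<inter> M l')" if "(u', l', w') \<in> set xs" for u' l' w'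
      using Cons.prems(11)[of u' l' w'] that by simp
    show "D n \<inter> M l' = {}" if "(u', l', w') \<in> set xs" "n \<in> I" "n \<noteq> u'" "n \<noteq> w'" for u' l' w' n
      using Cons.prems(12)[of u' l' w' n] that by simp
  qed
  moreover have "(\<Union>n\<in>set (w # V). D n) \<union> (\<Union>l\<in>insert l K. M l) \<union> (\<Union>(u, l, w)\<in>set xs. M l \<union> D w) =
      ?U \<union> (\<Union>(u, l, w)\<in>set (x # xs). M l \<union> D w)"
    by (auto simp: x)
  ultimately show ?case
    by simp
qed

text \<open>An intersection of dual cells is the dual cell of a union, empty unless that union is a
  chain. The topological hypotheses of \<open>AR_grows\<close> thus become statements about which
  cells are comparable. The spanning trees and the paths of corners are all instances.\<close>

lemma AR_tree:
  fixes D :: "'n \<Rightarrow> cell set" and M :: "'l \<Rightarrow> cell set"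
  assumes grows: "grows [r] xs" "distinct (map link xs)" and I: "r \<in> I" "(\<lambda>(u, l, w). w) ` set xs \<subseteq> I"
    and ne: "\<And>n. D n \<noteq> {}" "\<And>l. M l \<noteq> {}"
    and D: "\<And>n. n \<in> I \<Longrightarrow> pairwise_comparable (D n)"
      "\<And>n n'. n \<in> I \<Longrightarrow> n' \<in> I \<Longrightarrow> pairwise_comparable (D n \<union> D n') \<Longrightarrow> n = n'"
    and M: "\<And>l l'. l \<in> link ` set xs \<Longrightarrow> l' \<in> link ` set xs \<Longrightarrow> pairwise_comparable (M l \<union> M l') \<Longrightarrow> l = l'"
    and ends: "\<And>u l w. (u, l, w) \<in> set xs \<Longrightarrow> pairwise_comparable (D u \<union> M l) \<and> pairwise_comparable (D w \<union> M l)"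
      "\<And>u l w n. (u, l, w) \<in> set xs \<Longrightarrow> n \<in> I \<Longrightarrow> pairwise_comparable (D n \<union> M l) \<Longrightarrow> n = u \<or> n = w"
  shows "AR (\<Union>T\<in>D ` insert r ((\<lambda>(u, l, w). w) ` set xs) \<union> M ` link ` set xs. dual_cell T)"
proof -
  have "AR ((\<Union>n\<in>set [r]. dual_cell (D n)) \<union> (\<Union>l\<in>{}. dual_cell (M l)) \<union>
      (\<Union>(u, l, w)\<in>set xs. dual_cell (M l) \<union> dual_cell (D w)))"
  proof (rule AR_grows[where I = I, OF grows])
    show "AR ((\<Union>n\<in>set [r]. dual_cell (D n)) \<union> (\<Union>l\<in>{}. dual_cell (M l)))"
      using AR_dual_cell[OF D(1)[OF I(1)] ne(1)] by simp
    show "compact ((\<Union>n\<in>set [r]. dual_cell (D n)) \<union> (\<Union>l\<in>{}. dual_cell (M l)))"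
      using compact_dual_cell by simp
    show "AR (dual_cell (M l))" if l: "l \<in> {} \<union> link ` set xs" for l
    proof -
      obtain u w where "(u, l, w) \<in> set xs"
        using l by force
      then have "pairwise_comparable (M l)"
        using ends(1) pairwise_comparable_subset by (metis Un_upper2)
      then show ?thesis
        using ne(2) by (rule AR_dual_cell)
    qed
    show "dual_cell (M l) \<inter> dual_cell (M l') = {}"
      if "l \<in> {} \<union> link ` set xs" "l' \<in> {} \<union> link ` set xs" "l \<noteq> l'" for l l'
      unfolding dual_cell_Int using M[of l l'] that by (intro dual_cell_empty) auto
    show "AR (dual_cell (D u) \<inter> dual_cell (M l)) \<and> AR (dual_cell (D w) \<inter> dual_cell (M l))"
      if "(u, l, w) \<in> set xs" for u l w
      unfolding dual_cell_Int using ends(1)[OF that] ne by (auto intro!: AR_dual_cell)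
    show "dual_cell (D n) \<inter> dual_cell (M l) = {}"
      if "(u, l, w) \<in> set xs" "n \<in> I" "n \<noteq> u" "n \<noteq> w" for u l w n
      unfolding dual_cell_Int using ends(2)[OF that(1,2)] that(3,4) by (intro dual_cell_empty) auto
    show "dual_cell (D n) \<inter> dual_cell (D n') = {}" if "n \<in> I" "n' \<in> I" "n \<noteq> n'" for n n'
      unfolding dual_cell_Int using D(2)[OF that(1,2)] that(3) by (intro dual_cell_empty) auto
    show "AR (dual_cell (D n))" if "n \<in> I" for n
      using AR_dual_cell[OF D(1)[OF that] ne(1)] .
  qed (use I compact_dual_cell in auto)
  moreover have "(\<Union>n\<in>set [r]. dual_cell (D n)) \<union> (\<Union>l\<in>{}. dual_cell (M l)) \<union>
      (\<Union>(u, l, w)\<in>set xs. dual_cell (M l) \<union> dual_cell (D w)) =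
      (\<Union>T\<in>D ` insert r ((\<lambda>(u, l, w). w) ` set xs) \<union> M ` link ` set xs. dual_cell T)"
    by (auto simp: link_def split: prod.splits; force)
  ultimately show ?thesis
    by simp
qed

section \<open>The pieces as unions of dual cells\<close>

lemmas sides_nth = nth_eqs[OF sides_def, simplified,
  unfolded numeral_2_eq_2[symmetric] Suc_numeral add_num_simps]

definition side_edges :: "nat list" where
  "side_edges = [54, 37, 57, 42, 44, 59, 51, 49]"

definition start_vertex :: "nat \<Rightarrow> nat" where "start_vertex k = fst (sides ! k)"
definition side_edge :: "nat \<Rightarrow> nat" where "side_edge k = fst (snd (sides ! k))"
definition side_face :: "nat \<Rightarrow> nat" where "side_face k = fst (snd (snd (sides ! k)))"
definition end_vertex :: "nat \<Rightarrow> nat" where "end_vertex k = snd (snd (snd (sides ! k)))"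

definition path_nodes :: "(nat \<times> nat \<times> nat) list \<Rightarrow> (nat \<times> nat) list" where
  "path_nodes p = map (\<lambda>(v, f, e). (v, f)) p"

text \<open>A node \<open>(v, f)\<close> stands for an arc in the common boundary of the two discs.
  Two successive nodes share the face if the boundary passes along an edge of the vertex tree, and
  the vertex if it crosses an edge of the face tree; the link between them is the arc beside that
  edge.\<close>

definition path_attach :: "(nat \<times> nat \<times> nat) list \<Rightarrow>
    ((nat \<times> nat) \<times> (nat \<times> nat + nat \<times> nat) \<times> (nat \<times> nat)) list" where
  "path_attach p = map (\<lambda>((v, f, e), (v', f', e')).
     ((v, f), if f = f' then Inl (e, f) else Inr (v, e), (v', f'))) (zip p (tl p))"

definition path_links :: "(nat \<times> nat \<times> nat) list \<Rightarrow> (nat \<times> nat + nat \<times> nat) list" where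
  "path_links p = map link (path_attach p)"

definition node_cells :: "nat \<times> nat \<Rightarrow> cell set" where
  "node_cells = (\<lambda>(v, f). {Vx v, Fc f})"

definition link_cells :: "nat \<times> nat + nat \<times> nat \<Rightarrow> cell set" where
  "link_cells = case_sum (\<lambda>(e, f). {Ed e, Fc f}) (\<lambda>(v, e). {Vx v, Ed e})"

definition vertex_tree_edges :: "nat list" where "vertex_tree_edges = map link vertex_tree"
definition face_tree_edges :: "nat list" where "face_tree_edges = map link face_tree"

text \<open>The chains whose dual cells make up a piece. Tree edges are absorbed into the discs, and
  the arcs beside them therefore belong to the \<open>VertexFace\<close> pieces.\<close>

primrec generators :: "piece \<Rightarrow> cell set set" where
  "generators Vertex = (\<lambda>v. {Vx v}) ` {..<30} \<union> (\<lambda>e. {Ed e}) ` set vertex_tree_edges"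
| "generators Face = (\<lambda>f. {Fc f}) ` {..<24} \<union> (\<lambda>e. {Ed e}) ` set face_tree_edges"
| "generators (Edge j) = {{Ed (side_edges ! j)}}"
| "generators (VertexEdge k) = {{Vx (start_vertex k), Ed (side_edge k)}}"
| "generators (EdgeFace k) = {{Ed (side_edge k), Fc (side_face k)}}"
| "generators (VertexFace k) = node_cells ` set (path_nodes (paths ! k)) \<union> link_cells ` set (path_links (paths ! k))"
| "generators (Corner k b) = {{Vx (if b then end_vertex k else start_vertex k), Ed (side_edge k), Fc (side_face k)}}"

definition labelled :: "'a list list \<Rightarrow> ('a \<times> nat) list" where
  "labelled xss = concat (map (\<lambda>(k, xs). map (\<lambda>x. (x, k)) xs) (List.enumerate 0 xss))"

lemma map_of_labelled:
  assumes "distinct (map fst (labelled xss))"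
  shows "map_of (labelled xss) x = Some k \<longleftrightarrow> k < length xss \<and> x \<in> set (xss ! k)"
proof -
  have "(x, k) \<in> set (labelled xss) \<longleftrightarrow> k < length xss \<and> x \<in> set (xss ! k)"
    unfolding labelled_def by (auto simp: in_set_enumerate_eq image_iff)
  then show ?thesis
    using assms by simp
qed

text \<open>Yields one rewrite rule for each entry of an association list, so that a lookup takes a
  single step.\<close>

lemma map_of_list_all:
  assumes "xs = ys" "distinct (map fst xs)"
  shows "list_all (\<lambda>(x, k). map_of xs x = Some k) ys"
  using assms by (auto simp: list_all_iff)

definition node_labels :: "((nat \<times> nat) \<times> nat) list" where
  "node_labels = labelled (map path_nodes paths)"

definition link_labels :: "((nat \<times> nat + nat \<times> nat) \<times> nat) list" where
  "link_labels = labelled (map path_links paths)"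

definition side_corners :: "((nat \<times> nat \<times> nat) \<times> nat) list" where
  "side_corners = labelled (map (\<lambda>(v, e, f, w). [(v, e, f)]) sides)"

definition side_corners' :: "((nat \<times> nat \<times> nat) \<times> nat) list" where
  "side_corners' = labelled (map (\<lambda>(v, e, f, w). [(w, e, f)]) sides)"

lemmas node_labels_eval = node_labels_def[unfolded labelled_def path_nodes_def paths_def, simplified,
  unfolded numeral_2_eq_2[symmetric] Suc_numeral add_num_simps]
lemmas link_labels_eval = link_labels_def[unfolded labelled_def path_links_def path_attach_def paths_def, simplified,
  unfolded numeral_2_eq_2[symmetric] Suc_numeral add_num_simps]
lemmas side_corners_eval = side_corners_def[unfolded labelled_def sides_def, simplified,
  unfolded numeral_2_eq_2[symmetric] Suc_numeral add_num_simps]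
lemmas side_corners'_eval = side_corners'_def[unfolded labelled_def sides_def, simplified,
  unfolded numeral_2_eq_2[symmetric] Suc_numeral add_num_simps]

lemma distinct_node_labels: "distinct (map fst node_labels)"
  by (simp add: node_labels_eval)

lemma distinct_link_labels: "distinct (map fst link_labels)"
  by (simp add: link_labels_eval)

lemma distinct_side_corners: "distinct (map fst side_corners)" "distinct (map fst side_corners')"
  by (simp_all add: side_corners_eval side_corners'_eval)

lemmas node_labels_rules = map_of_list_all[OF node_labels_eval distinct_node_labels, simplified]
lemmas link_labels_rules = map_of_list_all[OF link_labels_eval distinct_link_labels, simplified]

lemmas flags_eval = flags_def[unfolded chamber_table_def flags_of_row_def, simplified]
lemmas vertex_tree_edges_eval = vertex_tree_edges_def[unfolded vertex_tree_def, simplified]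
lemmas face_tree_edges_eval = face_tree_edges_def[unfolded face_tree_def, simplified]

lemma tree_edges_disjoint: "set vertex_tree_edges \<inter> set face_tree_edges = {}"
  by (simp add: vertex_tree_edges_eval face_tree_edges_eval)

text \<open>What has to be checked at each flag for the pieces to meet as in the polygon. At a tree
  edge, the corner and the arc beside the edge must lie on the same path. At one of the remaining
  edges, the flag must be the start or the end of a side \<open>k\<close>, and its corner must lie
  on path \<open>k\<close> or on the cyclically next path.\<close>

definition flag_kind :: "nat \<Rightarrow> nat \<Rightarrow> nat \<Rightarrow> bool" where
  "flag_kind v e f \<longleftrightarrow>
     (if e \<in> set vertex_tree_edges then map_of node_labels (v, f) \<noteq> None \<and>
        map_of link_labels (Inl (e, f)) = map_of node_labels (v, f)
      else if e \<in> set face_tree_edges then map_of node_labels (v, f) \<noteq> None \<and>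
        map_of link_labels (Inr (v, e)) = map_of node_labels (v, f)
      else case map_of side_corners (v, e, f) of
        Some k \<Rightarrow> map_of node_labels (v, f) = Some k
      | None \<Rightarrow> (case map_of side_corners' (v, e, f) of
          Some k \<Rightarrow> map_of node_labels (v, f) = Some ((k + 1) mod 16)
        | None \<Rightarrow> False))"

lemma flag_kind: "list_all (\<lambda>(v, e, f). flag_kind v e f) flags"
  unfolding flags_eval
  by (simp add: flag_kind_def vertex_tree_edges_eval face_tree_edges_eval node_labels_rules
      link_labels_rules side_corners_eval side_corners'_eval)

lemma sides_correct:
  "list_all (\<lambda>(v, e, f, w). v < 30 \<and> e < 60 \<and> f < 24 \<and> w < 30 \<and> v \<noteq> w \<and>
     e \<notin> set vertex_tree_edges \<and> e \<notin> set face_tree_edges) sides"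
  "distinct (map (\<lambda>(v, e, f, w). (v, e)) sides)" "distinct (map (\<lambda>(v, e, f, w). (e, f)) sides)"
  "length sides = 16" "length paths = 16" "distinct side_edges" "length side_edges = 8"
  by (simp_all add: sides_def vertex_tree_edges_eval face_tree_edges_eval paths_def side_edges_def)

text \<open>Here the boundary word of the face disc is seen to be the product of commutators:
  partner sides follow the same edge in opposite directions, and \<open>side_edges\<close> lists the
  edges by letter.\<close>

lemma side_partner_table:
  "\<forall>k\<in>{15, 14, 13, 12, 11, 10, 9, 8, 7, 6, 5, 4, 3, 2, 1, 0}. start_vertex (partner k) = end_vertex k \<and>
     side_edge (partner k) = side_edge k \<and> side_edge k = side_edges ! letter k"
  by (simp add: start_vertex_def side_edge_def end_vertex_def partner_def letter_def side_edges_def sides_nth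
      flip: numeral_2_eq_2 numeral_3_eq_3)

lemma side_partner:
  assumes "k < 16"
  shows "start_vertex (partner k) = end_vertex k" "side_edge (partner k) = side_edge k"
    "side_edge k = side_edges ! letter k"
proof -
  have "{..<16} = {15, 14, 13, 12, 11, 10, 9, 8, 7, 6, 5, 4, 3, 2, 1, 0::nat}"
    by (simp add: lessThan_nat_numeral lessThan_Suc)
  with assms have "k \<in> {15, 14, 13, 12, 11, 10, 9, 8, 7, 6, 5, 4, 3, 2, 1, 0}"
    by (metis lessThan_iff)
  from bspec[OF side_partner_table this]
  show "start_vertex (partner k) = end_vertex k" "side_edge (partner k) = side_edge k"
    "side_edge k = side_edges ! letter k"
    by blast+
qed

lemma link_labels_edges:
  "list_all (\<lambda>(x, k). case x of Inl (e, f) \<Rightarrow> e \<in> set vertex_tree_edges \<and> e < 60 \<and> f < 24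
     | Inr (v, e) \<Rightarrow> e \<in> set face_tree_edges \<and> v < 30 \<and> e < 60) link_labels"
  by (simp add: link_labels_eval vertex_tree_edges_eval face_tree_edges_eval)

lemma node_labels_bounds: "list_all (\<lambda>((v, f), k). v < 30 \<and> f < 24) node_labels"
  by (simp add: node_labels_eval)

definition incident :: "nat \<Rightarrow> nat \<Rightarrow> nat \<Rightarrow> bool" where
  "incident v e f \<longleftrightarrow> v < 30 \<and> e < 60 \<and> f < 24 \<and> face_table ! f \<in> set (edge_table ! e) \<and>
     list_all (\<lambda>x. x \<in> set (vertex_table ! v)) (edge_table ! e)"

lemma flags_edges:
  "list_all (\<lambda>(v, e, f). (v = fst (edge_ends ! e) \<or> v = snd (edge_ends ! e)) \<and>
     (f = fst (edge_faces ! e) \<or> f = snd (edge_faces ! e))) flags"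
  unfolding flags_eval by (simp add: edge_ends_nth edge_faces_nth)

lemma vertex_tree_correct:
  "grows [0] vertex_tree" "distinct (map link vertex_tree)"
  "set (0 # map (\<lambda>(u, l, w). w) vertex_tree) = {..<30}"
  unfolding vertex_tree_def by (simp, simp, auto simp: lessThan_nat_numeral lessThan_Suc)

lemma vertex_tree_incident:
  "list_all (\<lambda>(u, l, w). (edge_ends ! l = (u, w) \<or> edge_ends ! l = (w, u)) \<and>
     incident u l (fst (edge_faces ! l)) \<and> incident w l (fst (edge_faces ! l))) vertex_tree"
  unfolding vertex_tree_def
  by (simp add: incident_def edge_ends_nth edge_faces_nth edge_table_nth vertex_table_nth face_table_nth)

lemma face_tree_correct:
  "grows [0] face_tree" "distinct (map link face_tree)"
  "set (0 # map (\<lambda>(u, l, w). w) face_tree) = {..<24}"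
  unfolding face_tree_def by (simp, simp, auto simp: lessThan_nat_numeral lessThan_Suc)

lemma face_tree_incident:
  "list_all (\<lambda>(u, l, w). (edge_faces ! l = (u, w) \<or> edge_faces ! l = (w, u)) \<and>
     incident (fst (edge_ends ! l)) l u \<and> incident (fst (edge_ends ! l)) l w) face_tree"
  unfolding face_tree_def
  by (simp add: incident_def edge_ends_nth edge_faces_nth edge_table_nth vertex_table_nth face_table_nth)

definition link_correct :: "(nat \<times> nat) \<times> (nat \<times> nat + nat \<times> nat) \<times> (nat \<times> nat) \<Rightarrow> bool" where
  "link_correct = (\<lambda>((v, f), l, (v', f')). case l of
     Inl (e, f'') \<Rightarrow> f'' = f \<and> f' = f \<and> (edge_ends ! e = (v, v') \<or> edge_ends ! e = (v', v)) \<and>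
       incident v e f \<and> incident v' e f'
   | Inr (v'', e) \<Rightarrow> v'' = v \<and> v' = v \<and> (edge_faces ! e = (f, f') \<or> edge_faces ! e = (f', f)) \<and>
       incident v e f \<and> incident v' e f')"

lemma paths_correct:
  "list_all (\<lambda>p. grows [hd (path_nodes p)] (path_attach p)) paths"
  "list_all (\<lambda>p. distinct (path_links p)) paths"
  "list_all (\<lambda>p. path_nodes p = hd (path_nodes p) # map (\<lambda>(u, l, w). w) (path_attach p)) paths"
  by (simp_all add: paths_def path_nodes_def path_attach_def path_links_def)

lemma path_links_correct: "list_all (\<lambda>p. list_all link_correct (path_attach p)) paths"
  by (simp add: paths_def path_attach_def link_correct_def incident_def
      edge_ends_nth edge_faces_nth edge_table_nth vertex_table_nth face_table_nth)

lemma path_nodes_incident: "list_all (list_all (\<lambda>(v, f, e). incident v e f)) paths"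
  by (simp add: paths_def incident_def edge_table_nth vertex_table_nth face_table_nth)

lemma tree_edge_bounds: "e \<in> set vertex_tree_edges \<Longrightarrow> e < 60" "e \<in> set face_tree_edges \<Longrightarrow> e < 60"
proof -
  have "list_all (\<lambda>e. e < 60) vertex_tree_edges" "list_all (\<lambda>e. e < 60) face_tree_edges"
    by (simp_all add: vertex_tree_edges_eval face_tree_edges_eval)
  then show "e \<in> set vertex_tree_edges \<Longrightarrow> e < 60" "e \<in> set face_tree_edges \<Longrightarrow> e < 60"
    by (simp_all add: list_all_iff)
qed

lemma side_edges_bounds:
  assumes "j < 8"
  shows "side_edges ! j < 60" "side_edges ! j \<notin> set vertex_tree_edges" "side_edges ! j \<notin> set face_tree_edges"
proof -
  have "list_all (\<lambda>e. e < 60 \<and> e \<notin> set vertex_tree_edges \<and> e \<notin> set face_tree_edges) side_edges"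
    by (simp add: side_edges_def vertex_tree_edges_eval face_tree_edges_eval)
  then show "side_edges ! j < 60" "side_edges ! j \<notin> set vertex_tree_edges" "side_edges ! j \<notin> set face_tree_edges"
    using assms sides_correct(7) by (simp_all add: list_all_length)
qed

lemma side_bounds:
  assumes "k < 16"
  shows "start_vertex k < 30" "side_edge k < 60" "side_face k < 24" "end_vertex k < 30"
    "start_vertex k \<noteq> end_vertex k" "side_edge k \<notin> set vertex_tree_edges" "side_edge k \<notin> set face_tree_edges"
proof -
  have "sides ! k \<in> set sides"
    using assms sides_correct(4) by simp
  then have "(\<lambda>(v, e, f, w). v < 30 \<and> e < 60 \<and> f < 24 \<and> w < 30 \<and> v \<noteq> w \<and>
     e \<notin> set vertex_tree_edges \<and> e \<notin> set face_tree_edges) (sides ! k)"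
    using sides_correct(1) unfolding list_all_iff by (rule bspec[rotated])
  then show "start_vertex k < 30" "side_edge k < 60" "side_face k < 24" "end_vertex k < 30"
    "start_vertex k \<noteq> end_vertex k" "side_edge k \<notin> set vertex_tree_edges" "side_edge k \<notin> set face_tree_edges"
    by (simp_all add: start_vertex_def side_edge_def side_face_def end_vertex_def split: prod.splits)
qed

lemma side_eq_iff:
  assumes "k < 16" "l < 16"
  shows "start_vertex k = start_vertex l \<and> side_edge k = side_edge l \<longleftrightarrow> k = l"
    and "side_edge k = side_edge l \<and> side_face k = side_face l \<longleftrightarrow> k = l"
proof -
  have "map (\<lambda>(v, e, f, w). (v, e)) sides ! k = map (\<lambda>(v, e, f, w). (v, e)) sides ! l \<longleftrightarrow> k = l"
    using sides_correct(2,4) assms by (subst nth_eq_iff_index_eq) simp_all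
  then show "start_vertex k = start_vertex l \<and> side_edge k = side_edge l \<longleftrightarrow> k = l"
    using assms sides_correct(4) by (simp add: start_vertex_def side_edge_def split: prod.splits)
  have "map (\<lambda>(v, e, f, w). (e, f)) sides ! k = map (\<lambda>(v, e, f, w). (e, f)) sides ! l \<longleftrightarrow> k = l"
    using sides_correct(3,4) assms by (subst nth_eq_iff_index_eq) simp_all
  then show "side_edge k = side_edge l \<and> side_face k = side_face l \<longleftrightarrow> k = l"
    using assms sides_correct(4) by (simp add: side_face_def side_edge_def split: prod.splits)
qed

lemma side_edges_eq_iff:
  assumes "k < 16" "j < 8"
  shows "side_edges ! j = side_edge k \<longleftrightarrow> j = letter k"
  using assms side_partner(3)[of k] sides_correct(6,7) letter_less_8[of k]
  by (simp add: nth_eq_iff_index_eq)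

lemma node_label_iff:
  "map_of node_labels x = Some k \<longleftrightarrow> k < 16 \<and> x \<in> set (path_nodes (paths ! k))"
  using map_of_labelled[OF distinct_node_labels[unfolded node_labels_def], of x k] sides_correct(5)
  by (auto simp: node_labels_def)

lemma link_label_iff:
  "map_of link_labels x = Some k \<longleftrightarrow> k < 16 \<and> x \<in> set (path_links (paths ! k))"
  using map_of_labelled[OF distinct_link_labels[unfolded link_labels_def], of x k] sides_correct(5)
  by (auto simp: link_labels_def)

lemma side_corner_iff:
  "map_of side_corners (v, e, f) = Some k \<longleftrightarrow> k < 16 \<and> v = start_vertex k \<and> e = side_edge k \<and> f = side_face k"
  "map_of side_corners' (v, e, f) = Some k \<longleftrightarrow> k < 16 \<and> v = end_vertex k \<and> e = side_edge k \<and> f = side_face k"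
proof -
  obtain v' e' f' w' where k: "sides ! k = (v', e', f', w')"
    by (metis prod_cases4)
  show "map_of side_corners (v, e, f) = Some k \<longleftrightarrow> k < 16 \<and> v = start_vertex k \<and> e = side_edge k \<and> f = side_face k"
    using map_of_labelled[OF distinct_side_corners(1)[unfolded side_corners_def], of "(v, e, f)" k] sides_correct(4)
    by (auto simp: side_corners_def start_vertex_def side_edge_def side_face_def k)
  show "map_of side_corners' (v, e, f) = Some k \<longleftrightarrow> k < 16 \<and> v = end_vertex k \<and> e = side_edge k \<and> f = side_face k"
    using map_of_labelled[OF distinct_side_corners(2)[unfolded side_corners'_def], of "(v, e, f)" k] sides_correct(4)
    by (auto simp: side_corners'_def end_vertex_def side_edge_def side_face_def k)
qed

lemma node_bounds: "k < 16 \<Longrightarrow> (v, f) \<in> set (path_nodes (paths ! k)) \<Longrightarrow> v < 30 \<and> f < 24"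
  using node_labels_bounds map_of_SomeD[of node_labels "(v, f)" k] node_label_iff[of "(v, f)" k]
  by (auto simp: list_all_iff)

lemma link_bounds:
  "k < 16 \<Longrightarrow> Inl (e, f) \<in> set (path_links (paths ! k)) \<Longrightarrow> e < 60 \<and> f < 24 \<and> e \<in> set vertex_tree_edges"
  "k < 16 \<Longrightarrow> Inr (v, e) \<in> set (path_links (paths ! k)) \<Longrightarrow> v < 30 \<and> e < 60 \<and> e \<in> set face_tree_edges"
  using link_labels_edges map_of_SomeD[of link_labels "Inl (e, f)" k] link_label_iff[of "Inl (e, f)" k]
    map_of_SomeD[of link_labels "Inr (v, e)" k] link_label_iff[of "Inr (v, e)" k]
  by (auto simp: list_all_iff)

lemma flag_cases:
  assumes "(v, e, f) \<in> set flags"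
  obtains
    (vertex_tree) k where "e \<in> set vertex_tree_edges" "map_of node_labels (v, f) = Some k"
      "map_of link_labels (Inl (e, f)) = Some k"
  | (face_tree) k where "e \<in> set face_tree_edges" "map_of node_labels (v, f) = Some k"
      "map_of link_labels (Inr (v, e)) = Some k"
  | (side) k b where "k < 16" "v = (if b then end_vertex k else start_vertex k)" "e = side_edge k"
      "f = side_face k" "map_of node_labels (v, f) = Some (if b then (k + 1) mod 16 else k)"
proof -
  have k: "flag_kind v e f"
    using flag_kind assms by (auto simp: list_all_iff)
  show thesis
  proof (cases "e \<in> set vertex_tree_edges")
    case True
    then show thesis
      using k that(1) by (auto simp: flag_kind_def)
  next
    case notV: False
    show thesis
    proof (cases "e \<in> set face_tree_edges")
      case True
      then show thesis
        using k notV that(2) by (auto simp: flag_kind_def)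
    next
      case False
      show thesis
      proof (cases "map_of side_corners (v, e, f)")
        case (Some l)
        then have "map_of node_labels (v, f) = Some l"
          using k notV False by (simp add: flag_kind_def)
        with Some show thesis
          using that(3)[of l False] by (simp add: side_corner_iff)
      next
        case None
        then obtain l where l: "map_of side_corners' (v, e, f) = Some l" "map_of node_labels (v, f) = Some ((l + 1) mod 16)"
          using k notV False by (auto simp: flag_kind_def split: option.splits)
        then show thesis
          using that(3)[of l True] by (simp add: side_corner_iff)
      qed
    qed
  qed
qed

text \<open>With \<open>argmax y\<close> for \<open>S\<close>, this says that the point
  \<open>y\<close> lies in the union of dual cells making up the piece \<open>i\<close>.\<close>

definition hits :: "piece \<Rightarrow> cell set \<Rightarrow> bool" where
  "hits i S \<longleftrightarrow> (\<exists>T\<in>generators i. T \<subseteq> S)"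

text \<open>Inside a flag only one vertex, one edge and one face are available, so a generator
  contained in \<open>S\<close> must consist of these.\<close>

lemma hits_flag:
  assumes flag: "(v, e, f) \<in> set flags" and S: "S \<subseteq> flag_cells v e f"
  shows "hits Vertex S \<longleftrightarrow> Vx v \<in> S \<or> Ed e \<in> S \<and> e \<in> set vertex_tree_edges"
    and "hits Face S \<longleftrightarrow> Fc f \<in> S \<or> Ed e \<in> S \<and> e \<in> set face_tree_edges"
    and "j < 8 \<Longrightarrow> hits (Edge j) S \<longleftrightarrow> Ed e \<in> S \<and> e = side_edges ! j"
    and "k < 16 \<Longrightarrow> hits (VertexEdge k) S \<longleftrightarrow> Vx v \<in> S \<and> Ed e \<in> S \<and> v = start_vertex k \<and> e = side_edge k"
    and "k < 16 \<Longrightarrow> hits (EdgeFace k) S \<longleftrightarrow> Ed e \<in> S \<and> Fc f \<in> S \<and> e = side_edge k \<and> f = side_face k"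
    and "k < 16 \<Longrightarrow> hits (VertexFace k) S \<longleftrightarrow> Vx v \<in> S \<and> Fc f \<in> S \<and> map_of node_labels (v, f) = Some k \<or>
      Ed e \<in> S \<and> Fc f \<in> S \<and> map_of link_labels (Inl (e, f)) = Some k \<or>
      Vx v \<in> S \<and> Ed e \<in> S \<and> map_of link_labels (Inr (v, e)) = Some k"
    and "k < 16 \<Longrightarrow> hits (Corner k b) S \<longleftrightarrow> Vx v \<in> S \<and> Ed e \<in> S \<and> Fc f \<in> S \<and>
      v = (if b then end_vertex k else start_vertex k) \<and> e = side_edge k \<and> f = side_face k"
proof -
  have b: "v < 30" "e < 60" "f < 24"
    using flag_bounds[OF flag] by auto
  have v: "Vx v' \<in> S \<longleftrightarrow> v' = v \<and> Vx v \<in> S" if "v' < 30" for v'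
    using subsetD[OF S, of "Vx v'"] that b by (auto simp: flag_cells_def cell_eq_iff)
  have e: "Ed e' \<in> S \<longleftrightarrow> e' = e \<and> Ed e \<in> S" if "e' < 60" for e'
    using subsetD[OF S, of "Ed e'"] that b by (auto simp: flag_cells_def cell_eq_iff)
  have f: "Fc f' \<in> S \<longleftrightarrow> f' = f \<and> Fc f \<in> S" if "f' < 24" for f'
    using subsetD[OF S, of "Fc f'"] that b by (auto simp: flag_cells_def cell_eq_iff)
  show "hits Vertex S \<longleftrightarrow> Vx v \<in> S \<or> Ed e \<in> S \<and> e \<in> set vertex_tree_edges"
  proof -
    have "hits Vertex S \<longleftrightarrow> (\<exists>x<30. Vx x \<in> S) \<or> (\<exists>e'\<in>set vertex_tree_edges. Ed e' \<in> S)"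
      by (auto simp: hits_def)
    also have "(\<exists>x<30. Vx x \<in> S) \<longleftrightarrow> Vx v \<in> S"
      using v b by blast
    also have "(\<exists>e'\<in>set vertex_tree_edges. Ed e' \<in> S) \<longleftrightarrow> Ed e \<in> S \<and> e \<in> set vertex_tree_edges"
      using e tree_edge_bounds(1) by blast
    finally show ?thesis .
  qed
  show "hits Face S \<longleftrightarrow> Fc f \<in> S \<or> Ed e \<in> S \<and> e \<in> set face_tree_edges"
  proof -
    have "hits Face S \<longleftrightarrow> (\<exists>x<24. Fc x \<in> S) \<or> (\<exists>e'\<in>set face_tree_edges. Ed e' \<in> S)"
      by (auto simp: hits_def)
    also have "(\<exists>x<24. Fc x \<in> S) \<longleftrightarrow> Fc f \<in> S"
      using f b by blast
    also have "(\<exists>e'\<in>set face_tree_edges. Ed e' \<in> S) \<longleftrightarrow> Ed e \<in> S \<and> e \<in> set face_tree_edges"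
      using e tree_edge_bounds(2) by blast
    finally show ?thesis .
  qed
  show "hits (Edge j) S \<longleftrightarrow> Ed e \<in> S \<and> e = side_edges ! j" if "j < 8"
    using e[OF side_edges_bounds(1)[OF that]] by (auto simp: hits_def)
  show "hits (VertexEdge k) S \<longleftrightarrow> Vx v \<in> S \<and> Ed e \<in> S \<and> v = start_vertex k \<and> e = side_edge k" if "k < 16"
    unfolding hits_def generators.simps bex_simps insert_subset
      v[OF side_bounds(1)[OF that]] e[OF side_bounds(2)[OF that]] by blast
  show "hits (EdgeFace k) S \<longleftrightarrow> Ed e \<in> S \<and> Fc f \<in> S \<and> e = side_edge k \<and> f = side_face k" if "k < 16"
    unfolding hits_def generators.simps bex_simps insert_subset
      f[OF side_bounds(3)[OF that]] e[OF side_bounds(2)[OF that]] by blast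
  show "hits (Corner k b) S \<longleftrightarrow> Vx v \<in> S \<and> Ed e \<in> S \<and> Fc f \<in> S \<and>
      v = (if b then end_vertex k else start_vertex k) \<and> e = side_edge k \<and> f = side_face k" if "k < 16" for b
  proof -
    have "(if b then end_vertex k else start_vertex k) < 30"
      using side_bounds[OF that] by simp
    note v = v[OF this]
    show ?thesis
      unfolding hits_def generators.simps bex_simps insert_subset
        v e[OF side_bounds(2)[OF that]] f[OF side_bounds(3)[OF that]] by blast
  qed
  show "hits (VertexFace k) S \<longleftrightarrow> Vx v \<in> S \<and> Fc f \<in> S \<and> map_of node_labels (v, f) = Some k \<or>
      Ed e \<in> S \<and> Fc f \<in> S \<and> map_of link_labels (Inl (e, f)) = Some k \<or>
      Vx v \<in> S \<and> Ed e \<in> S \<and> map_of link_labels (Inr (v, e)) = Some k" if k: "k < 16"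
  proof -
    have nodes: "(\<exists>x\<in>set (path_nodes (paths ! k)). node_cells x \<subseteq> S) \<longleftrightarrow>
        Vx v \<in> S \<and> Fc f \<in> S \<and> (v, f) \<in> set (path_nodes (paths ! k))"
    proof (intro iffI)
      assume "\<exists>x\<in>set (path_nodes (paths ! k)). node_cells x \<subseteq> S"
      then obtain v' f' where x: "(v', f') \<in> set (path_nodes (paths ! k))" "Vx v' \<in> S" "Fc f' \<in> S"
        by (auto simp: node_cells_def)
      then show "Vx v \<in> S \<and> Fc f \<in> S \<and> (v, f) \<in> set (path_nodes (paths ! k))"
        using v[of v'] f[of f'] node_bounds[OF k x(1)] by simp
    qed (auto simp: node_cells_def intro!: bexI[of _ "(v, f)"])
    have links: "(\<exists>x\<in>set (path_links (paths ! k)). link_cells x \<subseteq> S) \<longleftrightarrow>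
        Ed e \<in> S \<and> Fc f \<in> S \<and> Inl (e, f) \<in> set (path_links (paths ! k)) \<or>
        Vx v \<in> S \<and> Ed e \<in> S \<and> Inr (v, e) \<in> set (path_links (paths ! k))"
    proof (intro iffI)
      assume "\<exists>x\<in>set (path_links (paths ! k)). link_cells x \<subseteq> S"
      then obtain x where x: "x \<in> set (path_links (paths ! k))" "link_cells x \<subseteq> S"
        by blast
      show "Ed e \<in> S \<and> Fc f \<in> S \<and> Inl (e, f) \<in> set (path_links (paths ! k)) \<or>
        Vx v \<in> S \<and> Ed e \<in> S \<and> Inr (v, e) \<in> set (path_links (paths ! k))"
      proof (cases x)
        case (Inl y)
        then obtain e' f' where y: "x = Inl (e', f')"
          by (cases y) simp
        then show ?thesis
          using x e[of e'] f[of f'] link_bounds(1)[OF k, of e' f'] by (simp add: link_cells_def)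
      next
        case (Inr y)
        then obtain v' e' where y: "x = Inr (v', e')"
          by (cases y) simp
        then show ?thesis
          using x e[of e'] v[of v'] link_bounds(2)[OF k, of v' e'] by (simp add: link_cells_def)
      qed
    next
      assume "Ed e \<in> S \<and> Fc f \<in> S \<and> Inl (e, f) \<in> set (path_links (paths ! k)) \<or>
        Vx v \<in> S \<and> Ed e \<in> S \<and> Inr (v, e) \<in> set (path_links (paths ! k))"
      then show "\<exists>x\<in>set (path_links (paths ! k)). link_cells x \<subseteq> S"
        by (elim disjE conjE) (auto simp: link_cells_def intro: bexI[of _ "Inl (e, f)"] bexI[of _ "Inr (v, e)"])
    qed
    show ?thesis
      unfolding hits_def generators.simps bex_Un bex_simps nodes links node_label_iff link_label_iff
      using k by blast
  qed
qed

lemma link_label_edges: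
  "map_of link_labels (Inl (e, f)) = Some k \<Longrightarrow> e \<in> set vertex_tree_edges"
  "map_of link_labels (Inr (v, e)) = Some k \<Longrightarrow> e \<in> set face_tree_edges"
  using link_bounds unfolding link_label_iff by blast+

text \<open>The combinatorial core: the unions of dual cells intersect in the same order as the
  pieces of the polygon. The least piece depends on which cells of the surrounding flag belong to
  the chain and on the kind of its edge.\<close>

lemma hits_stratum:
  assumes "pairwise_comparable S" "S \<noteq> {}"
  shows "\<exists>k\<in>pieces. \<forall>i\<in>pieces. hits i S \<longleftrightarrow> k \<le> i"
proof -
  obtain v e f where flag: "(v, e, f) \<in> set flags" and S: "S \<subseteq> flag_cells v e f"
    using comparable_subset_flag[OF assms] .
  note hits = hits_flag[OF flag S]
  have all: "(\<forall>i\<in>pieces. P i) \<longleftrightarrow> P Vertex \<and> P Face \<and> (\<forall>j<8. P (Edge j)) \<and> (\<forall>k<16. P (VertexEdge k)) \<and>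
      (\<forall>k<16. P (EdgeFace k)) \<and> (\<forall>k<16. P (VertexFace k)) \<and> (\<forall>k<16. \<forall>b. P (Corner k b))" for P
    unfolding pieces_def ball_Un by (auto simp: split_paired_Ball_Sigma)
  have some: "Vx v \<in> S \<or> Ed e \<in> S \<or> Fc f \<in> S"
    using S assms(2) by (auto simp: flag_cells_def)
  show ?thesis
    using flag
  proof (cases rule: flag_cases)
    case (vertex_tree l)
    have l: "l < 16"
      using vertex_tree(2) by (simp add: node_label_iff)
    have none: "map_of link_labels (Inr (v, e)) \<noteq> Some k" "e \<notin> set face_tree_edges" for k
      using vertex_tree(1) tree_edges_disjoint link_label_edges(2) by blast+
    have not_side: "k < 16 \<Longrightarrow> e \<noteq> side_edge k" for k
      using side_bounds(6) vertex_tree(1) by blast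
    have not_edge: "j < 8 \<Longrightarrow> e \<noteq> side_edges ! j" for j
      using side_edges_bounds(2) vertex_tree(1) by blast
    \<comment> \<open>An edge of the vertex tree counts as part of the vertex disc, so it only
      matters whether the chain touches the vertex disc, the face disc or both.\<close>
    define V F where "V \<longleftrightarrow> Vx v \<in> S \<or> Ed e \<in> S" and "F \<longleftrightarrow> Fc f \<in> S"
    define k where "k = (if V then if F then VertexFace l else Vertex else Face)"
    have "k \<in> pieces"
      using l by (auto simp: k_def pieces_def)
    moreover have "\<forall>i\<in>pieces. hits i S \<longleftrightarrow> k \<le> i"
      unfolding all using some
      by (auto simp: hits none not_side not_edge vertex_tree k_def V_def F_def less_eq_piece_def)
    ultimately show ?thesis
      by blast
  next
    case (face_tree l)
    have l: "l < 16"
      using face_tree(2) by (simp add: node_label_iff)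
    have none: "map_of link_labels (Inl (e, f)) \<noteq> Some k" "e \<notin> set vertex_tree_edges" for k
      using face_tree(1) tree_edges_disjoint link_label_edges(1) by blast+
    have not_side: "k < 16 \<Longrightarrow> e \<noteq> side_edge k" for k
      using side_bounds(7) face_tree(1) by blast
    have not_edge: "j < 8 \<Longrightarrow> e \<noteq> side_edges ! j" for j
      using side_edges_bounds(3) face_tree(1) by blast
    define V F where "V \<longleftrightarrow> Vx v \<in> S" and "F \<longleftrightarrow> Ed e \<in> S \<or> Fc f \<in> S"
    define k where "k = (if V then if F then VertexFace l else Vertex else Face)"
    have "k \<in> pieces"
      using l by (auto simp: k_def pieces_def)
    moreover have "\<forall>i\<in>pieces. hits i S \<longleftrightarrow> k \<le> i"
      unfolding all using some
      by (auto simp: hits none not_side not_edge face_tree k_def V_def F_def less_eq_piece_def)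
    ultimately show ?thesis
      by blast
  next
    case (side l b)
    have none: "map_of link_labels (Inl (e, f)) \<noteq> Some k" "map_of link_labels (Inr (v, e)) \<noteq> Some k"
      "e \<notin> set vertex_tree_edges" "e \<notin> set face_tree_edges" for k
      using side_bounds(6,7)[OF side(1)] link_label_edges unfolding side(3) by blast+
    \<comment> \<open>\<open>VertexEdge\<close> is indexed by the side that starts at the vertex;
      for the end of side \<open>l\<close> this is the partner side.\<close>
    define m where "m = (if b then partner l else l)"
    have m: "m < 16" "v = start_vertex m" "e = side_edge m"
      using side(1-3) partner_less_16[of l] side_partner(1,2)[OF side(1)] by (cases b; simp add: m_def)+
    have vertex_edge: "hits (VertexEdge k) S \<longleftrightarrow> Vx v \<in> S \<and> Ed e \<in> S \<and> k = m" if "k < 16" for k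
      using hits(4)[OF that] side_eq_iff(1)[OF m(1) that] unfolding m(2,3) by blast
    have edge_face: "hits (EdgeFace k) S \<longleftrightarrow> Ed e \<in> S \<and> Fc f \<in> S \<and> k = l" if "k < 16" for k
      using hits(5)[OF that] side_eq_iff(2)[OF side(1) that] unfolding side(3,4) by blast
    have edge: "hits (Edge j) S \<longleftrightarrow> Ed e \<in> S \<and> j = letter l" if "j < 8" for j
      using hits(3)[OF that] side_edges_eq_iff[OF side(1) that] unfolding side(3) by metis
    have corner: "hits (Corner k c) S \<longleftrightarrow> Vx v \<in> S \<and> Ed e \<in> S \<and> Fc f \<in> S \<and> k = l \<and> c = b"
      if "k < 16" for k c
    proof -
      have "v = (if c then end_vertex l else start_vertex l) \<longleftrightarrow> c = b"
        unfolding side(2) using side_bounds(5)[OF side(1)] by (cases b; cases c) simp_all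
      then show ?thesis
        using hits(7)[OF that] side_eq_iff(2)[OF side(1) that] unfolding side(3,4) by blast
    qed
    have vertex_face: "hits (VertexFace k) S \<longleftrightarrow> Vx v \<in> S \<and> Fc f \<in> S \<and> k = (if b then (l + 1) mod 16 else l)"
      if "k < 16" for k
      unfolding hits(6)[OF that] side(5) using none by auto
    have vertex: "hits Vertex S \<longleftrightarrow> Vx v \<in> S" and face: "hits Face S \<longleftrightarrow> Fc f \<in> S"
      using hits(1,2) none by simp_all
    have l: "letter l < 8" "letter m = letter l"
      using side(1) by (simp_all add: letter_less_8 m_def)
    define k where "k = (if Vx v \<in> S then if Ed e \<in> S then if Fc f \<in> S then Corner l b else VertexEdge m
        else if Fc f \<in> S then VertexFace (if b then (l + 1) mod 16 else l) else Vertex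
      else if Ed e \<in> S then if Fc f \<in> S then EdgeFace l else Edge (letter l) else Face)"
    have "Corner l b \<in> (\<lambda>(k, b). Corner k b) ` ({..<16} \<times> UNIV)"
      using side(1) by force
    then have "k \<in> pieces"
      unfolding k_def pieces_def using l(1) side(1) m(1) by simp
    moreover have "\<forall>i\<in>pieces. hits i S \<longleftrightarrow> k \<le> i"
      unfolding all using some
      by (cases "Vx v \<in> S"; cases "Ed e \<in> S"; cases "Fc f \<in> S";
        simp add: vertex_edge edge_face edge corner vertex_face vertex face k_def less_eq_piece_def l m_def[symmetric])
    ultimately show ?thesis
      by blast
  qed
qed

definition piece_cover :: "piece \<Rightarrow> (real ^ cell) set" where
  "piece_cover i = (\<Union>T\<in>generators i. dual_cell T)"

lemma piece_cover_iff: "y \<in> piece_cover i \<longleftrightarrow> y \<in> order_complex \<and> hits i (argmax y)"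
  by (auto simp: piece_cover_def dual_cell_def hits_def)

section \<open>The pieces of the order complex are absolute retracts\<close>

lemma incident_comparable:
  assumes "incident v e f"
  shows "pairwise_comparable (flag_cells v e f)"
proof -
  have "v < 30" "e < 60" "f < 24" "face_table ! f \<in> set (edge_table ! e)"
    "set (edge_table ! e) \<subseteq> set (vertex_table ! v)"
    using assms by (auto simp: incident_def list_all_iff)
  then have "Vx v \<le> Ed e" "Ed e \<le> Fc f"
    by (simp_all add: less_eq_cell_def Rep_Vx Rep_Ed Rep_Fc)
  moreover from this have "Vx v \<le> Fc f"
    by (rule order_trans)
  ultimately show ?thesis
    unfolding pairwise_comparable_def flag_cells_def by auto
qed

text \<open>A chain with an edge and a vertex, or an edge and a face, extends to a flag, and for the
  finitely many flags the claim has been checked.\<close>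

lemma comparable_ends:
  "v < 30 \<Longrightarrow> e < 60 \<Longrightarrow> pairwise_comparable S \<Longrightarrow> Vx v \<in> S \<Longrightarrow> Ed e \<in> S \<Longrightarrow>
     v = fst (edge_ends ! e) \<or> v = snd (edge_ends ! e)"
  "f < 24 \<Longrightarrow> e < 60 \<Longrightarrow> pairwise_comparable S \<Longrightarrow> Fc f \<in> S \<Longrightarrow> Ed e \<in> S \<Longrightarrow>
     f = fst (edge_faces ! e) \<or> f = snd (edge_faces ! e)"
proof -
  have "(v = fst (edge_ends ! e) \<or> v = snd (edge_ends ! e)) \<and> (f = fst (edge_faces ! e) \<or> f = snd (edge_faces ! e))"
    if "(v, e, f) \<in> set flags" for v e f
    using flags_edges that unfolding list_all_iff by blast
  then show "v < 30 \<Longrightarrow> e < 60 \<Longrightarrow> pairwise_comparable S \<Longrightarrow> Vx v \<in> S \<Longrightarrow> Ed e \<in> S \<Longrightarrow>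
     v = fst (edge_ends ! e) \<or> v = snd (edge_ends ! e)"
    "f < 24 \<Longrightarrow> e < 60 \<Longrightarrow> pairwise_comparable S \<Longrightarrow> Fc f \<in> S \<Longrightarrow> Ed e \<in> S \<Longrightarrow>
     f = fst (edge_faces ! e) \<or> f = snd (edge_faces ! e)"
    using comparable_pairD(1)[of S v e] comparable_pairD(2)[of S e f] by meson+
qed

lemma comparable_single: "pairwise_comparable {p}"
  by (simp add: pairwise_comparable_def)

text \<open>The nodes are the dual cells of the vertices and the links those of the tree edges. An
  edge has no vertices but its two ends, so its dual cell meets no other nodes.\<close>

lemma AR_vertex_cover: "AR (piece_cover Vertex)"
proof -
  have all: "insert 0 ((\<lambda>(u, l, w). w) ` set vertex_tree) = {..<30}"
    using vertex_tree_correct(3) by simp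
  have "AR (\<Union>T\<in>(\<lambda>v. {Vx v}) ` insert 0 ((\<lambda>(u, l, w). w) ` set vertex_tree) \<union>
      (\<lambda>e. {Ed e}) ` link ` set vertex_tree. dual_cell T)"
  proof (rule AR_tree[where I = "{..<30}", OF vertex_tree_correct(1,2)])
    show "(0::nat) \<in> {..<30}" "(\<lambda>(u, l, w). w) ` set vertex_tree \<subseteq> {..<30}"
      using all by blast+
    show "n = n'" if "n \<in> {..<30}" "n' \<in> {..<30}" "pairwise_comparable ({Vx n} \<union> {Vx n'})" for n n'
      using comparable_pairD(3)[OF that(3), of n n'] that(1,2) by simp
    have l: "l < 60" if "l \<in> link ` set vertex_tree" for l
      using that tree_edge_bounds(1)[of l] by (simp add: vertex_tree_edges_def)
    show "l = l'" if "l \<in> link ` set vertex_tree" "l' \<in> link ` set vertex_tree"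
      "pairwise_comparable ({Ed l} \<union> {Ed l'})" for l l'
      using comparable_pairD(4)[OF that(3), of l l'] l[OF that(1)] l[OF that(2)] by simp
    fix u l w assume x: "(u, l, w) \<in> set vertex_tree"
    then have *: "edge_ends ! l = (u, w) \<or> edge_ends ! l = (w, u)"
      "incident u l (fst (edge_faces ! l))" "incident w l (fst (edge_faces ! l))"
      using vertex_tree_incident unfolding list_all_iff by blast+
    show "pairwise_comparable ({Vx u} \<union> {Ed l}) \<and> pairwise_comparable ({Vx w} \<union> {Ed l})"
      using pairwise_comparable_subset[OF incident_comparable[OF *(2)], of "{Vx u} \<union> {Ed l}"]
        pairwise_comparable_subset[OF incident_comparable[OF *(3)], of "{Vx w} \<union> {Ed l}"]
      by (simp add: flag_cells_def)
    show "n = u \<or> n = w" if "n \<in> {..<30}" "pairwise_comparable ({Vx n} \<union> {Ed l})" for n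
    proof -
      have "l < 60"
        using *(2) by (simp add: incident_def)
      with comparable_ends(1)[OF _ _ that(2), of n l] that(1) *(1) show ?thesis
        by auto
    qed
  qed (simp_all add: comparable_single)
  then show ?thesis
    unfolding piece_cover_def generators.simps vertex_tree_edges_def set_map all .
qed

text \<open>Dual to the vertex disc: the nodes are faces, and a tree edge links the two faces on its
  sides.\<close>

lemma AR_face_cover: "AR (piece_cover Face)"
proof -
  have all: "insert 0 ((\<lambda>(u, l, w). w) ` set face_tree) = {..<24}"
    using face_tree_correct(3) by simp
  have "AR (\<Union>T\<in>(\<lambda>f. {Fc f}) ` insert 0 ((\<lambda>(u, l, w). w) ` set face_tree) \<union>
      (\<lambda>e. {Ed e}) ` link ` set face_tree. dual_cell T)"
  proof (rule AR_tree[where I = "{..<24}", OF face_tree_correct(1,2)])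
    show "(0::nat) \<in> {..<24}" "(\<lambda>(u, l, w). w) ` set face_tree \<subseteq> {..<24}"
      using all by blast+
    show "n = n'" if "n \<in> {..<24}" "n' \<in> {..<24}" "pairwise_comparable ({Fc n} \<union> {Fc n'})" for n n'
      using comparable_pairD(5)[OF that(3), of n n'] that(1,2) by simp
    have l: "l < 60" if "l \<in> link ` set face_tree" for l
      using that tree_edge_bounds(2)[of l] by (simp add: face_tree_edges_def)
    show "l = l'" if "l \<in> link ` set face_tree" "l' \<in> link ` set face_tree"
      "pairwise_comparable ({Ed l} \<union> {Ed l'})" for l l'
      using comparable_pairD(4)[OF that(3), of l l'] l[OF that(1)] l[OF that(2)] by simp
    fix u l w assume x: "(u, l, w) \<in> set face_tree"
    then have *: "edge_faces ! l = (u, w) \<or> edge_faces ! l = (w, u)"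
      "incident (fst (edge_ends ! l)) l u" "incident (fst (edge_ends ! l)) l w"
      using face_tree_incident unfolding list_all_iff by blast+
    show "pairwise_comparable ({Fc u} \<union> {Ed l}) \<and> pairwise_comparable ({Fc w} \<union> {Ed l})"
      using pairwise_comparable_subset[OF incident_comparable[OF *(2)], of "{Fc u} \<union> {Ed l}"]
        pairwise_comparable_subset[OF incident_comparable[OF *(3)], of "{Fc w} \<union> {Ed l}"]
      by (simp add: flag_cells_def)
    show "n = u \<or> n = w" if "n \<in> {..<24}" "pairwise_comparable ({Fc n} \<union> {Ed l})" for n
    proof -
      have "l < 60"
        using *(2) by (simp add: incident_def)
      with comparable_ends(2)[OF _ _ that(2), of n l] that(1) *(1) show ?thesis
        by auto
    qed
  qed (simp_all add: comparable_single)
  then show ?thesis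
    unfolding piece_cover_def generators.simps face_tree_edges_def set_map all .
qed

text \<open>A path is a tree without branches. Its nodes are pairs of a vertex and a face, and each
  link has one of the two in common with both neighbouring nodes, while its edge fixes the two
  possible values of the other.\<close>

lemma AR_path_cover:
  assumes k: "k < 16"
  shows "AR (piece_cover (VertexFace k))"
proof -
  define p where "p = paths ! k"
  have p: "p \<in> set paths"
    using k sides_correct(5) by (simp add: p_def)
  have grows: "grows [hd (path_nodes p)] (path_attach p)" and dist: "distinct (map link (path_attach p))"
    and nodes: "path_nodes p = hd (path_nodes p) # map (\<lambda>(u, l, w). w) (path_attach p)"
    using paths_correct p unfolding list_all_iff path_links_def by blast+
  have set_nodes: "set (path_nodes p) = insert (hd (path_nodes p)) ((\<lambda>(u, l, w). w) ` set (path_attach p))"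
    by (subst nodes) simp
  have nb: "v < 30" "f < 24" if "(v, f) \<in> set (path_nodes p)" for v f
    using node_bounds[OF k] that by (auto simp: p_def)
  have set_links: "set (path_links p) = link ` set (path_attach p)"
    by (simp add: path_links_def)
  have "AR (\<Union>T\<in>node_cells ` insert (hd (path_nodes p)) ((\<lambda>(u, l, w). w) ` set (path_attach p)) \<union>
      link_cells ` link ` set (path_attach p). dual_cell T)"
  proof (rule AR_tree[where I = "set (path_nodes p)", OF grows dist])
    show "hd (path_nodes p) \<in> set (path_nodes p)"
      "(\<lambda>(u, l, w). w) ` set (path_attach p) \<subseteq> set (path_nodes p)"
      unfolding set_nodes by blast+
    show "node_cells n \<noteq> {}" for n
      by (simp add: node_cells_def split: prod.splits)
    show "link_cells l \<noteq> {}" for l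
      by (simp add: link_cells_def split: sum.splits prod.splits)
    show "pairwise_comparable (node_cells n)" if n: "n \<in> set (path_nodes p)" for n
    proof -
      obtain v f e where vfe: "n = (v, f)" "(v, f, e) \<in> set p"
        using n by (auto simp: path_nodes_def)
      then have "incident v e f"
        using path_nodes_incident p unfolding list_all_iff by blast
      from incident_comparable[OF this] show ?thesis
        by (rule pairwise_comparable_subset) (auto simp: vfe node_cells_def flag_cells_def)
    qed
    show "n = n'" if "n \<in> set (path_nodes p)" "n' \<in> set (path_nodes p)"
      "pairwise_comparable (node_cells n \<union> node_cells n')" for n n'
    proof -
      obtain v f v' f' where n: "n = (v, f)" "n' = (v', f')"
        by (metis surj_pair)
      then show ?thesis
        using comparable_pairD(3)[OF that(3), of v v'] comparable_pairD(5)[OF that(3), of f f'] nb[of v f] nb[of v' f'] that(1,2)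
        by (simp add: node_cells_def)
    qed
    show "l = l'" if l: "l \<in> link ` set (path_attach p)" "l' \<in> link ` set (path_attach p)"
      "pairwise_comparable (link_cells l \<union> link_cells l')" for l l'
    proof -
      have links: "l \<in> set (path_links (paths ! k))" "l' \<in> set (path_links (paths ! k))"
        using l(1,2) set_links by (simp_all add: p_def)
      note D = comparable_pairD[OF l(3)]
      have ne: "e \<noteq> e'" if "e \<in> set vertex_tree_edges" "e' \<in> set face_tree_edges" for e e'
        using that tree_edges_disjoint by blast
      show ?thesis
      proof (cases l)
        case (Inl a)
        then obtain e f where a: "l = Inl (e, f)"
          by (cases a) simp
        note b = link_bounds(1)[OF k links(1)[unfolded a]]
        show ?thesis
        proof (cases l')
          case (Inl a')
          then obtain e' f' where a': "l' = Inl (e', f')"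
            by (cases a') simp
          note b' = link_bounds(1)[OF k links(2)[unfolded a']]
          show ?thesis
            using D(4)[of e e'] D(5)[of f f'] b b' by (simp add: a a' link_cells_def)
        next
          case (Inr a')
          then obtain v' e' where a': "l' = Inr (v', e')"
            by (cases a') simp
          note b' = link_bounds(2)[OF k links(2)[unfolded a']]
          show ?thesis
            using D(4)[of e e'] ne[of e e'] b b' by (simp add: a a' link_cells_def)
        qed
      next
        case (Inr a)
        then obtain v e where a: "l = Inr (v, e)"
          by (cases a) simp
        note b = link_bounds(2)[OF k links(1)[unfolded a]]
        show ?thesis
        proof (cases l')
          case (Inl a')
          then obtain e' f' where a': "l' = Inl (e', f')"
            by (cases a') simp
          note b' = link_bounds(1)[OF k links(2)[unfolded a']]
          show ?thesis
            using D(4)[of e' e] ne[of e' e] b b' by (simp add: a a' link_cells_def)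
        next
          case (Inr a')
          then obtain v' e' where a': "l' = Inr (v', e')"
            by (cases a') simp
          note b' = link_bounds(2)[OF k links(2)[unfolded a']]
          show ?thesis
            using D(4)[of e e'] D(3)[of v v'] b b' by (simp add: a a' link_cells_def)
        qed
      qed
    qed
    fix u l w assume x: "(u, l, w) \<in> set (path_attach p)"
    then have correct: "link_correct (u, l, w)"
      using path_links_correct p unfolding list_all_iff by blast
    obtain v f v' f' where uw: "u = (v, f)" "w = (v', f')"
      by (metis surj_pair)
    have "pairwise_comparable (node_cells u \<union> link_cells l) \<and> pairwise_comparable (node_cells w \<union> link_cells l) \<and>
      (\<forall>n\<in>set (path_nodes p). pairwise_comparable (node_cells n \<union> link_cells l) \<longrightarrow> n = u \<or> n = w)"
    proof (cases l)
      case (Inl a)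
      then obtain e f'' where a: "l = Inl (e, f'')"
        by (cases a) simp
      have *: "f'' = f" "f' = f" "edge_ends ! e = (v, v') \<or> edge_ends ! e = (v', v)" "incident v e f" "incident v' e f'"
        using correct by (auto simp: link_correct_def uw a)
      have eq: "node_cells u \<union> link_cells l = flag_cells v e f" "node_cells w \<union> link_cells l = flag_cells v' e f'"
        using * by (auto simp: node_cells_def link_cells_def flag_cells_def uw a)
      have "n = u \<or> n = w" if n: "n \<in> set (path_nodes p)" "pairwise_comparable (node_cells n \<union> link_cells l)" for n
      proof -
        obtain x y where xy: "n = (x, y)"
          by (metis surj_pair)
        have "y < 24" "x < 30" "e < 60" "f < 24"
          using nb[of x y] n(1) *(4) by (simp_all add: xy incident_def)
        then have "y = f" "x = fst (edge_ends ! e) \<or> x = snd (edge_ends ! e)"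
          using comparable_pairD(5)[OF n(2), of y f] comparable_ends(1)[OF _ _ n(2), of x e]
          by (simp_all add: xy a node_cells_def link_cells_def *(1))
        then show ?thesis
          using *(2,3) by (auto simp: uw xy)
      qed
      then show ?thesis
        unfolding eq using incident_comparable[OF *(4)] incident_comparable[OF *(5)] by blast
    next
      case (Inr a)
      then obtain v'' e where a: "l = Inr (v'', e)"
        by (cases a) simp
      have *: "v'' = v" "v' = v" "edge_faces ! e = (f, f') \<or> edge_faces ! e = (f', f)" "incident v e f" "incident v' e f'"
        using correct by (auto simp: link_correct_def uw a)
      have eq: "node_cells u \<union> link_cells l = flag_cells v e f" "node_cells w \<union> link_cells l = flag_cells v' e f'"
        using * by (auto simp: node_cells_def link_cells_def flag_cells_def uw a)
      have "n = u \<or> n = w" if n: "n \<in> set (path_nodes p)" "pairwise_comparable (node_cells n \<union> link_cells l)" for n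
      proof -
        obtain x y where xy: "n = (x, y)"
          by (metis surj_pair)
        have "y < 24" "x < 30" "e < 60" "v < 30"
          using nb[of x y] n(1) *(4) by (simp_all add: xy incident_def)
        then have "x = v" "y = fst (edge_faces ! e) \<or> y = snd (edge_faces ! e)"
          using comparable_pairD(3)[OF n(2), of x v] comparable_ends(2)[OF _ _ n(2), of y e]
          by (simp_all add: xy a node_cells_def link_cells_def *(1))
        then show ?thesis
          using *(2,3) by (auto simp: uw xy)
      qed
      then show ?thesis
        unfolding eq using incident_comparable[OF *(4)] incident_comparable[OF *(5)] by blast
    qed
    then show "pairwise_comparable (node_cells u \<union> link_cells l) \<and> pairwise_comparable (node_cells w \<union> link_cells l)"
      "\<And>n. n \<in> set (path_nodes p) \<Longrightarrow> pairwise_comparable (node_cells n \<union> link_cells l) \<Longrightarrow> n = u \<or> n = w"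
      by blast+
  qed
  then show ?thesis
    unfolding piece_cover_def generators.simps p_def[symmetric] set_nodes set_links .
qed

lemma sides_incident:
  "list_all (\<lambda>(v, e, f, w). incident v e f \<and> incident w e f) sides"
  by (simp add: sides_def incident_def edge_table_nth vertex_table_nth face_table_nth)

lemma AR_piece_cover:
  assumes "i \<in> pieces"
  shows "AR (piece_cover i)"
proof -
  have side: "pairwise_comparable (flag_cells (if b then end_vertex k else start_vertex k) (side_edge k) (side_face k))"
    if "k < 16" for k b
  proof -
    have "sides ! k \<in> set sides"
      using that sides_correct(4) by simp
    then have "(\<lambda>(v, e, f, w). incident v e f \<and> incident w e f) (sides ! k)"
      using sides_incident unfolding list_all_iff by (rule bspec[rotated])
    then have "incident (if b then end_vertex k else start_vertex k) (side_edge k) (side_face k)"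
      by (simp add: start_vertex_def end_vertex_def side_edge_def side_face_def split: prod.splits)
    then show ?thesis
      by (rule incident_comparable)
  qed
  have single: "AR (piece_cover i)" if "generators i = {T}" "T \<noteq> {}" "pairwise_comparable T" for i T
    using AR_dual_cell[OF that(3,2)] that(1) by (simp add: piece_cover_def)
  show ?thesis
  proof (cases i)
    case (Edge j)
    then show ?thesis
      by (intro single[of _ "{Ed (side_edges ! j)}"]) (simp_all add: comparable_single)
  next
    case (VertexEdge k)
    then have "k < 16"
      using assms by (auto simp: pieces_def)
    from side[OF this, of False] have "pairwise_comparable {Vx (start_vertex k), Ed (side_edge k)}"
      by (rule pairwise_comparable_subset) (auto simp: flag_cells_def)
    then show ?thesis
      by (intro single[of i]) (simp_all add: VertexEdge)
  next
    case (EdgeFace k)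
    then have "k < 16"
      using assms by (auto simp: pieces_def)
    from side[OF this, of False] have "pairwise_comparable {Ed (side_edge k), Fc (side_face k)}"
      by (rule pairwise_comparable_subset) (auto simp: flag_cells_def)
    then show ?thesis
      by (intro single[of i]) (simp_all add: EdgeFace)
  next
    case (VertexFace k)
    then have "k < 16"
      using assms by (auto simp: pieces_def)
    then show ?thesis
      unfolding VertexFace by (rule AR_path_cover)
  next
    case (Corner k b)
    then have "k < 16"
      using assms by (auto simp: pieces_def)
    from side[OF this, of b] show ?thesis
      by (intro single[of i]) (simp_all add: Corner flag_cells_def)
  qed (simp_all only: AR_vertex_cover AR_face_cover)
qed

text \<open>The coordinates at which a point is maximal form a nonempty chain, and the least piece
  for this chain is the least index at the point.\<close>

theorem AR_cover_pieces: "AR_cover pieces order_complex piece_cover"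
  unfolding AR_cover_def
proof (intro conjI ballI finite_pieces AR_piece_cover)
  show "closedin (top_of_set order_complex) (piece_cover i)" for i
    unfolding piece_cover_def by (intro closedin_Union) (auto intro: closedin_dual_cell)
  fix y :: "real ^ cell"
  assume y: "y \<in> order_complex"
  obtain k where "k \<in> pieces" "\<forall>i\<in>pieces. hits i (argmax y) \<longleftrightarrow> k \<le> i"
    using hits_stratum[OF pairwise_comparable_argmax[OF y] argmax_nonempty] by blast
  then show "\<exists>k\<in>pieces. \<forall>i\<in>pieces. y \<in> piece_cover i \<longleftrightarrow> k \<le> i"
    using y by (auto simp: piece_cover_iff)
qed

theorem theorem11:
  fixes p :: complex
  assumes "p \<in> circle"
  shows "Q_space p 5 homotopy_equivalent_space closed_orientable_surface 4"
proof -
  have "config p homotopy_eqv (order_complex :: (real ^ cell) set)"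
    by (rule AR_cover_homotopy_eqv[OF AR_cover_config[OF assms] AR_cover_order_complex])
  \<comment> \<open>The same complex as before, covered now by unions of dual cells instead of the
    subcomplexes below the cells.\<close>
  moreover have "(order_complex :: (real ^ cell) set) homotopy_eqv model_surface"
    by (rule AR_cover_homotopy_eqv[OF AR_cover_pieces AR_cover_model_surface])
  ultimately have "top_of_set (config p) homotopy_equivalent_space top_of_set model_surface"
    by (rule homotopy_eqv_trans)
  moreover have "Q_space p 5 homotopy_equivalent_space top_of_set (config p)"
    by (rule homeomorphic_imp_homotopy_equivalent_space[OF Q_space_homeomorphic_config[OF assms]])
  moreover have "closed_orientable_surface 4 homotopy_equivalent_space top_of_set model_surface"
    by (rule homeomorphic_imp_homotopy_equivalent_space[OF closed_orientable_surface_homeomorphic_model])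
  ultimately show ?thesis
    by (meson homotopy_equivalent_space_sym homotopy_eqv_trans)
qed

end
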